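(* Let $f:\mathbb{R}^{m\times n}\to\mathbb{R}$ be locally Lipschitz, let $\mathcal{D}_f:\mathbb{R}^{m\times n}\rightrightarrows\mathbb{R}^{m\times n}$ be a convex-valued conservative field for $f$, and suppose that $\{f(W):0\in\mathcal{D}_f(W)\}$ has empty interior in $\mathbb{R}$. Run the MAGD algorithm (defined in the context) with $\gamma>0$, and suppose that a closed ball $K\subseteq\mathbb{R}^{m\times n}$ contains $\{U_t\}_{t\ge0}$ and $\{S_t\}_{t\ge0}$. Set $L_K:=\sup\{\|G\|_F:W\in K,\ G\in\mathcal{D}_f(W)\}$ and $R:=\sup_{t\ge0}\|S_t-U_t\|_F$. Assume that one of the following regimes holds. (i) $\eta_t>0$, $\eta_t\to0$, $\sum_t\eta_t=+\infty$, and $(1-\alpha_t)\eta_t^{\rm M}/\eta_t\to0$. (ii) For some $\tau>0$: $\delta_t^{\rm M}\to0$, $\delta_t^{\rm M}\sigma_t^{\rm M}\to0$, $\beta_t^{\rm M}=1-\tau\eta_t^{\rm M}\in[0,1]$, $\eta_t^{\rm M}>0$, $\eta_t^{\rm M}\to0$, $\sum_t\eta_t^{\rm M}=+\infty$, and $\eta_t\ge0$ with $\eta_t/\eta_t^{\rm M}\to r\in[0,+\infty)$; in addition $\gamma rL_KR\le\tau$; and if $r=0$, also $\limsup_{t\to\infty}\alpha_t<1$. Then every cluster point of $\{W_t\}$ lies in $\{W:0\in\mathcal{D}_f(W)\}$, and $\{f(W_t)\}$ converges. In regime (ii), additionally $M_t\to0$.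
   Context: Conservative field: let $f:\mathbb{R}^{m\times n}\to\mathbb{R}$ be locally Lipschitz and let $\mathcal{D}_f:\mathbb{R}^{m\times n}\rightrightarrows\mathbb{R}^{m\times n}$ be a set-valued map with closed graph and nonempty compact values, which is locally bounded (every point has a neighborhood $V$ such that $\bigcup_{Y\in V}\mathcal{D}_f(Y)$ is bounded). $\mathcal{D}_f$ is a conservative field of $f$ if for every absolutely continuous $\gamma:[0,1]\to\mathbb{R}^{m\times n}$ and every measurable $v:[0,1]\to\mathbb{R}^{m\times n}$ with $v(t)\in\mathcal{D}_f(\gamma(t))$ for almost every $t\in[0,1]$, $$f(\gamma(1))-f(\gamma(0))=\int_0^1\langle\dot\gamma(t),v(t)\rangle\,dt,$$ where $\langle\cdot,\cdot\rangle$ is the Frobenius inner product. $\|\cdot\|_F$ is the Frobenius norm. Inexact polar map: for $\delta\in[0,1)$ and $Z\in\mathbb{R}^{m\times n}$ with $\|Z\|_F\le1$ and $r=\operatorname{rank}(Z)$, set $\operatorname{polar}_\delta(0):=\{0\}$ and, for $Z\ne0$, let $\operatorname{polar}_\delta(Z)$ be the set of all matrices $U\operatorname{Diag}(\phi_1,\dots,\phi_r)V^\top$ such that $Z=U\operatorname{Diag}(\sigma_1,\dots,\sigma_r)V^\top$ is a compact SVD of $Z$, $0\le\phi_j\le1+\delta$ for every $j$, and $\phi_j\ge1-\delta$ whenever $\sigma_j\ge\delta$. MAGD algorithm (Muon Advised by Gradient Descent). Inputs: $W_0\in\mathbb{R}^{m\times n}$, $\eta_t\ge0$, $\gamma>0$,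 $\rho\in(0,1)$, $\beta_t^{\rm M}\in[0,1]$, $\eta_t^{\rm M}\ge0$, $\delta_t^{\rm M}\in[0,1)$, $\sigma_t^{\rm M}\ge0$. Initialization: $U_0=S_0=W_0$, $M_0=0$, $z_0=\log(\rho/(1-\rho))$. For $t=0,1,\dots$: $$\alpha_t=(1+e^{-z_t})^{-1},\qquad W_t=(1-\alpha_t)U_t+\alpha_tS_t,\qquad G_t\in\mathcal{D}_f(W_t),$$ $$z_{t+1}=z_t-\gamma\eta_t\langle G_t,S_t-U_t\rangle,\qquad S_{t+1}=S_t-\eta_tG_t,\qquad M_{t+1}=\beta_t^{\rm M}M_t+(1-\beta_t^{\rm M})G_t,$$ $$U_{t+1}\in U_t-\eta_t^{\rm M}\operatorname{polar}_{\delta_t^{\rm M}}\left(\frac{M_{t+1}}{\|M_{t+1}\|_F+\sigma_t^{\rm M}}\right),\quad\text{with }\tfrac00:=0.$$ *)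

theory Defs
  imports "HOL-Analysis.Analysis"
begin

text \<open>
  An \<open>m \<times> n\<close> real matrix is an element of \<^typ>\<open>real^'n^'m\<close>. The library's \<^const>\<open>inner\<close> and
  \<^const>\<open>norm\<close> on this type are the Frobenius inner product and the Frobenius norm.
\<close>

definition locally_lipschitz :: "('a::metric_space \<Rightarrow> 'b::metric_space) \<Rightarrow> bool" where
  "locally_lipschitz f \<longleftrightarrow> (\<forall>x. \<exists>e>0. \<exists>L. L-lipschitz_on (ball x e) f)"

text \<open>
  Absolute continuity of a curve, as opposed to the library's \<^const>\<open>absolutely_continuous\<close>, which is
  about measures. The families \<open>d\<close> are the finite families of nonoverlapping compact subintervals
  of \<open>{a..b}\<close>.
\<close>

definition abs_continuous_curve :: "real \<Rightarrow> real \<Rightarrow> (real \<Rightarrow> 'a::real_normed_vector) \<Rightarrow> bool" where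
  "abs_continuous_curve a b g \<longleftrightarrow>
     (\<forall>\<epsilon>>0. \<exists>\<delta>>0. \<forall>d. d division_of \<Union>d \<and> \<Union>d \<subseteq> {a..b} \<and> (\<Sum>k\<in>d. Sup k - Inf k) < \<delta> \<longrightarrow>
        (\<Sum>k\<in>d. norm (g (Sup k) - g (Inf k))) < \<epsilon>)"

text \<open>
  An absolutely continuous curve is differentiable almost everywhere, so the arbitrary value of
  \<^const>\<open>vector_derivative\<close> elsewhere does not affect the integral.
\<close>

definition conservative_field ::
    "(real^'n^'m \<Rightarrow> real) \<Rightarrow> (real^'n^'m \<Rightarrow> (real^'n^'m) set) \<Rightarrow> bool" where
  "conservative_field f D \<longleftrightarrow>
     closed {(X, Y). Y \<in> D X} \<and>
     (\<forall>X. D X \<noteq> {} \<and> compact (D X)) \<and>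
     (\<forall>X. \<exists>V. open V \<and> X \<in> V \<and> bounded (\<Union>Y\<in>V. D Y)) \<and>
     (\<forall>g v. abs_continuous_curve 0 1 g \<and>
            v \<in> borel_measurable (lebesgue_on {0..1}) \<and>
            (AE t in lebesgue_on {0..1}. v t \<in> D (g t)) \<longrightarrow>
        has_bochner_integral (lebesgue_on {0..1})
          (\<lambda>t. inner (vector_derivative g (at t within {0..1})) (v t)) (f (g 1) - f (g 0)))"

text \<open>
  The number \<open>r\<close> of columns of the factors of a compact SVD depends on the matrix, so \<open>U\<close> and \<open>V\<close>
  are given by their columns \<open>U j\<close>, \<open>V j\<close> for \<open>j < r\<close>, and the diagonal by its entries \<open>s j\<close>.
  Then \<open>usv r U s V\<close> is the product of \<open>U\<close>, \<open>Diag(s 0, \<dots>, s (r-1))\<close> and the transpose of \<open>V\<close>.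
\<close>

definition usv ::
    "nat \<Rightarrow> (nat \<Rightarrow> real^'m) \<Rightarrow> (nat \<Rightarrow> real) \<Rightarrow> (nat \<Rightarrow> real^'n) \<Rightarrow> real^'n^'m" where
  "usv r U s V = (\<chi> i k. \<Sum>j<r. U j $ i * s j * V j $ k)"

definition orthonormal_cols :: "nat \<Rightarrow> (nat \<Rightarrow> real^'k) \<Rightarrow> bool" where
  "orthonormal_cols r U \<longleftrightarrow> (\<forall>i<r. \<forall>j<r. inner (U i) (U j) = (if i = j then 1 else 0))"

definition compact_svd ::
    "real^'n^'m \<Rightarrow> (nat \<Rightarrow> real^'m) \<Rightarrow> (nat \<Rightarrow> real) \<Rightarrow> (nat \<Rightarrow> real^'n) \<Rightarrow> bool" where
  "compact_svd Z U \<sigma> V \<longleftrightarrow>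
     orthonormal_cols (rank Z) U \<and> orthonormal_cols (rank Z) V \<and>
     (\<forall>j<rank Z. \<sigma> j > 0) \<and> (\<forall>i j. i \<le> j \<and> j < rank Z \<longrightarrow> \<sigma> j \<le> \<sigma> i) \<and>
     Z = usv (rank Z) U \<sigma> V"

definition inexact_polar :: "real \<Rightarrow> real^'n^'m \<Rightarrow> (real^'n^'m) set" where
  "inexact_polar \<delta> Z =
     (if Z = 0 then {0}
      else {usv (rank Z) U \<phi> V | U \<phi> V. \<exists>\<sigma>. compact_svd Z U \<sigma> V \<and>
              (\<forall>j<rank Z. 0 \<le> \<phi> j \<and> \<phi> j \<le> 1 + \<delta>) \<and>
              (\<forall>j<rank Z. \<sigma> j \<ge> \<delta> \<longrightarrow> \<phi> j \<ge> 1 - \<delta>)})"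

definition magd_inputs ::
    "(nat \<Rightarrow> real) \<Rightarrow> real \<Rightarrow> real \<Rightarrow> (nat \<Rightarrow> real) \<Rightarrow> (nat \<Rightarrow> real) \<Rightarrow> (nat \<Rightarrow> real) \<Rightarrow> (nat \<Rightarrow> real) \<Rightarrow> bool"
  where
  "magd_inputs \<eta> \<gamma> \<rho> \<beta>M \<eta>M \<delta>M \<sigma>M \<longleftrightarrow>
     \<gamma> > 0 \<and> 0 < \<rho> \<and> \<rho> < 1 \<and>
     (\<forall>t. \<eta> t \<ge> 0 \<and> 0 \<le> \<beta>M t \<and> \<beta>M t \<le> 1 \<and> \<eta>M t \<ge> 0 \<and> 0 \<le> \<delta>M t \<and> \<delta>M t < 1 \<and> \<sigma>M t \<ge> 0)"

text \<open>
  In the argument of the polar map the convention \<open>0/0 = 0\<close> holds automatically, because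
  \<^term>\<open>inverse (0::real) = 0\<close>.
\<close>

definition magd_run ::
    "(real^'n^'m \<Rightarrow> (real^'n^'m) set) \<Rightarrow> real^'n^'m \<Rightarrow>
     (nat \<Rightarrow> real) \<Rightarrow> real \<Rightarrow> real \<Rightarrow> (nat \<Rightarrow> real) \<Rightarrow> (nat \<Rightarrow> real) \<Rightarrow> (nat \<Rightarrow> real) \<Rightarrow> (nat \<Rightarrow> real) \<Rightarrow>
     (nat \<Rightarrow> real) \<Rightarrow> (nat \<Rightarrow> real) \<Rightarrow>
     (nat \<Rightarrow> real^'n^'m) \<Rightarrow> (nat \<Rightarrow> real^'n^'m) \<Rightarrow> (nat \<Rightarrow> real^'n^'m) \<Rightarrow> (nat \<Rightarrow> real^'n^'m) \<Rightarrow>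
     (nat \<Rightarrow> real^'n^'m) \<Rightarrow> bool"
  where
  "magd_run D W0 \<eta> \<gamma> \<rho> \<beta>M \<eta>M \<delta>M \<sigma>M z \<alpha> W G S M U \<longleftrightarrow>
     U 0 = W0 \<and> S 0 = W0 \<and> M 0 = 0 \<and> z 0 = ln (\<rho> / (1 - \<rho>)) \<and>
     (\<forall>t. \<alpha> t = inverse (1 + exp (- z t)) \<and>
          W t = (1 - \<alpha> t) *\<^sub>R U t + \<alpha> t *\<^sub>R S t \<and>
          G t \<in> D (W t) \<and>
          z (Suc t) = z t - \<gamma> * \<eta> t * inner (G t) (S t - U t) \<and>
          S (Suc t) = S t - \<eta> t *\<^sub>R G t \<and>
          M (Suc t) = \<beta>M t *\<^sub>R M t + (1 - \<beta>M t) *\<^sub>R G t \<and>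
          U (Suc t) \<in> (\<lambda>P. U t - \<eta>M t *\<^sub>R P) `
                        inexact_polar (\<delta>M t) (M (Suc t) /\<^sub>R (norm (M (Suc t)) + \<sigma>M t)))"

definition regime_i :: "(nat \<Rightarrow> real) \<Rightarrow> (nat \<Rightarrow> real) \<Rightarrow> (nat \<Rightarrow> real) \<Rightarrow> bool" where
  "regime_i \<eta> \<eta>M \<alpha> \<longleftrightarrow>
     (\<forall>t. \<eta> t > 0) \<and> \<eta> \<longlonglongrightarrow> 0 \<and>
     filterlim (\<lambda>n. \<Sum>t<n. \<eta> t) at_top sequentially \<and>
     (\<lambda>t. (1 - \<alpha> t) * \<eta>M t / \<eta> t) \<longlonglongrightarrow> 0"

definition regime_ii ::
    "(nat \<Rightarrow> real) \<Rightarrow> real \<Rightarrow> (nat \<Rightarrow> real) \<Rightarrow> (nat \<Rightarrow> real) \<Rightarrow> (nat \<Rightarrow> real) \<Rightarrow> (nat \<Rightarrow> real) \<Rightarrow>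
     (nat \<Rightarrow> real) \<Rightarrow> real \<Rightarrow> real \<Rightarrow> bool" where
  "regime_ii \<eta> \<gamma> \<beta>M \<eta>M \<delta>M \<sigma>M \<alpha> LK R \<longleftrightarrow>
     (\<exists>\<tau>>0. \<exists>r\<ge>0.
        \<delta>M \<longlonglongrightarrow> 0 \<and> (\<lambda>t. \<delta>M t * \<sigma>M t) \<longlonglongrightarrow> 0 \<and>
        (\<forall>t. \<beta>M t = 1 - \<tau> * \<eta>M t \<and> 0 \<le> \<beta>M t \<and> \<beta>M t \<le> 1) \<and>
        (\<forall>t. \<eta>M t > 0) \<and> \<eta>M \<longlonglongrightarrow> 0 \<and>
        filterlim (\<lambda>n. \<Sum>t<n. \<eta>M t) at_top sequentially \<and>
        (\<forall>t. \<eta> t \<ge> 0) \<and> (\<lambda>t. \<eta> t / \<eta>M t) \<longlonglongrightarrow> r \<and>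
        \<gamma> * r * LK * R \<le> \<tau> \<and>
        (r = 0 \<longrightarrow> limsup (\<lambda>t. ereal (\<alpha> t)) < 1))"

end

theory Submission
  imports Defs "HOL-Complex_Analysis.Great_Picard"
begin

text \<open>
  Rescaled by the step sizes, shifted copies of the iterates accumulate at solutions of a differential
  inclusion whose right-hand side involves \<open>D\<close> through an averaged direction \<open>v t \<in> D (W t)\<close>. Lipschitz
  curves are differentiable almost everywhere, so conservativity turns into a chain rule for \<open>f\<close> along
  these limit curves. In regime (i) it gives \<open>(f \<circ> W)' \<le> - \<alpha> \<parallel>v\<parallel>\<^sup>2\<close>. In regime (ii) the Lyapunov function is
  \<open>f W + (1 - \<alpha>) \<parallel>M\<parallel>\<^sub>* / \<tau>\<close> with the nuclear norm \<open>\<parallel>\<cdot>\<parallel>\<^sub>*\<close>, and its derivative is at most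
  \<open>- (1 - \<alpha>)\<^sup>2 \<parallel>M\<parallel>\<^sub>* - \<alpha> r \<parallel>v\<parallel>\<^sup>2\<close>; the assumption \<open>\<gamma> r L\<^sub>K R \<le> \<tau>\<close> absorbs the contribution of \<open>\<alpha>'\<close>.
  If the values of the Lyapunov function along the run oscillated, some regular value would be crossed
  upwards infinitely often, although limit curves starting at that value strictly descend. Hence
  the values converge, the Lyapunov function is constant along limit curves, and this forces criticality.
\<close>

section \<open>Differentiability of Lipschitz curves\<close>

text \<open>Conservativity is an integral identity over \<open>{0..1}\<close> for measurable
  selections \<open>v\<close>, and this dictates two choices. Limit curves live on
  \<open>{0..1}\<close>, with the elapsed time \<open>T\<close> moved into the right-hand side. And
  \<open>v\<close> must be measurable, although an inclusion only yields a selection pointwise: each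
  state carries a component whose velocity is an injective affine function of \<open>v\<close> (S' =
  - v in regime (i), M' = \<tau> (v - M) in regime (ii)), so \<open>v\<close> is read off from the
  derivative.

  In regime (i) the Muon step is controlled only through (1 - \<alpha>) \<eta>M / \<eta>, and
  rescaled velocities of U may be unbounded as \<alpha> tends to 1; the state therefore contains W
  in place of U, at the price of a quotient by 1 - \<alpha>. Dissipation degenerates where \<alpha>
  = 0. There W is frozen, and a noncritical W would make S drift in a fixed direction with speed
  bounded below, which the ball forbids after a long enough time. In regime (ii) the dissipation in
  M degenerates where \<alpha> = 1; the limsup assumption excludes this for r = 0, and for r > 0 the
  term \<alpha> r |v|^2 takes over.\<close>

lemma vitali_image_bound:
  fixes g :: "real \<Rightarrow> real"
  assumes mono: "strict_mono g" and lip: "L-lipschitz_on UNIV g" and p: "0 < p"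
    and steep: "\<And>x d. x \<in> E \<Longrightarrow> 0 < d \<Longrightarrow> \<exists>a b. a < x \<and> x < b \<and> b - a < d \<and> g b - g a \<le> p * (b - a)"
    and T: "E \<subseteq> T" "T \<in> lmeasurable" and e: "0 < e"
  shows "\<exists>T'. g ` E \<subseteq> T' \<and> T' \<in> lmeasurable \<and> measure lebesgue T' \<le> p * measure lebesgue T + e"
proof -
  obtain V where V: "open V" "T \<subseteq> V" "V \<in> lmeasurable"
      "measure lebesgue V < measure lebesgue T + e / p"
  proof -
    have "0 < e / p" using e p by simp
    then obtain V where V: "open V" "T \<subseteq> V" "V - T \<in> lmeasurable" "emeasure lebesgue (V - T) < ennreal (e / p)"
      using sets_lebesgue_outer_open[of T "e / p"] T(2) by blast
    have VT: "V = T \<union> (V - T)" using V(2) by blast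
    have "measure lebesgue (V - T) < e / p"
      using V(3,4) \<open>0 < e / p\<close> by (simp add: emeasure_eq_measure2 ennreal_less_iff)
    moreover have "measure lebesgue V \<le> measure lebesgue T + measure lebesgue (V - T)"
      using measure_Un_le[of T lebesgue "V - T"] T(2) V(3) VT by (simp add: fmeasurableD)
    moreover have "V \<in> lmeasurable"
      using fmeasurable.Un[OF T(2) V(3)] VT by simp
    ultimately show ?thesis using that V(1,2) by (meson add_strict_left_mono order_le_less_trans)
  qed
  \<comment> \<open>Confining the intervals to \<open>V\<close> bounds the total length of disjoint
    ones by the measure of \<open>V\<close>, which exceeds that of \<open>T\<close> by less than e /
    p; the slope factor \<open>p\<close> turns this excess into \<open>e\<close>. \<open>cen\<close>
    and \<open>rad\<close> recode intervals as balls for the covering theorem.\<close>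
  define K where "K = {(a, b). a < b \<and> {a<..<b} \<subseteq> V \<and> g b - g a \<le> p * (b - a)}"
  define cen where "cen = (\<lambda>(a::real, b). (a + b) / 2)"
  define rad where "rad = (\<lambda>(a::real, b). (b - a) / 2)"
  have ball_eq: "ball (cen i) (rad i) = {fst i<..<snd i}" for i
    unfolding cen_def rad_def case_prod_beta
    by (auto simp: dist_real_def abs_if field_simps split: if_splits)
  have cov: "\<exists>i. i \<in> K \<and> x \<in> ball (cen i) (rad i) \<and> rad i < d" if x: "x \<in> E" and d: "0 < d" for x d
  proof -
    obtain r where r: "r > 0" "ball x r \<subseteq> V"
      using V(1,2) T(1) x by (meson openE subsetD)
    obtain a b where ab: "a < x" "x < b" "b - a < min r d" "g b - g a \<le> p * (b - a)"
      using steep[OF x, of "min r d"] r(1) d by auto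
    have "{a<..<b} \<subseteq> ball x r"
      using ab by (auto simp: dist_real_def)
    then have "(a, b) \<in> K" unfolding K_def using ab r by auto
    moreover have "x \<in> ball (cen (a, b)) (rad (a, b))"
      using ab by (simp add: ball_eq)
    moreover have "rad (a, b) < d" using ab by (simp add: rad_def)
    ultimately show ?thesis by blast
  qed
  \<comment> \<open>Vitali selects disjoint intervals that cover \<open>E\<close> up to a null set.
    By monotonicity the image of each lies in an interval at most \<open>p\<close> times as long,
    and the Lipschitz bound keeps the image of the exceptional set null.\<close>
  obtain C where C: "countable C" "C \<subseteq> K"
     "pairwise (\<lambda>i j. disjnt (ball (cen i) (rad i)) (ball (cen j) (rad j))) C"
     "negligible (E - (\<Union>i \<in> C. ball (cen i) (rad i)))"
    by (rule Vitali_covering_theorem_balls[of E K cen rad]) (use cov in blast)+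
  define N where "N = g ` (E - (\<Union>i \<in> C. ball (cen i) (rad i)))"
  have negN: "negligible N"
    unfolding N_def
  proof (rule negligible_locally_Lipschitz_image[OF _ C(4)])
    show "\<exists>T B. open T \<and> x \<in> T \<and> (\<forall>y\<in>(E - (\<Union>i \<in> C. ball (cen i) (rad i))) \<inter> T. norm (g y - g x) \<le> B * norm (y - x))" for x
      using lipschitz_on_normD[OF lip] by (intro exI[of _ UNIV] exI[of _ L]) auto
  qed simp
  define I where "I = (\<lambda>i. {g (fst i)..g (snd i)})"
  have sums: "measure lebesgue (\<Union>i\<in>J. I i) \<le> p * measure lebesgue V" if J: "J \<subseteq> C" "finite J" for J
  proof -
    have "measure lebesgue (\<Union>i\<in>J. I i) \<le> (\<Sum>i\<in>J. measure lebesgue (I i))"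
      using J by (intro measure_UNION_le) (auto simp: I_def)
    also have "\<dots> \<le> (\<Sum>i\<in>J. p * measure lebesgue (ball (cen i) (rad i)))"
    proof (rule sum_mono)
      fix i assume "i \<in> J"
      then have "i \<in> K" using J C by auto
      then have *: "fst i < snd i" "g (snd i) - g (fst i) \<le> p * (snd i - fst i)" by (auto simp: K_def)
      have "g (fst i) \<le> g (snd i)" using strict_mono_less[OF mono] *(1) by (simp add: less_imp_le)
      then show "measure lebesgue (I i) \<le> p * measure lebesgue (ball (cen i) (rad i))"
        using * by (simp add: I_def ball_eq)
    qed
    also have "\<dots> = p * (\<Sum>i\<in>J. measure lebesgue (ball (cen i) (rad i)))"
      by (simp add: sum_distrib_left)
    also have "(\<Sum>i\<in>J. measure lebesgue (ball (cen i) (rad i))) = measure lebesgue (\<Union>i\<in>J. ball (cen i) (rad i))"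
      using J C(3) by (intro measure_UNION'[symmetric]) (auto intro: pairwise_subset)
    also have "p * \<dots> \<le> p * measure lebesgue V"
    proof (intro mult_left_mono measure_mono_fmeasurable V)
      show "(\<Union>i\<in>J. ball (cen i) (rad i)) \<subseteq> V"
        using J C(2) by (fastforce simp: ball_eq K_def)
    qed (use J p in auto)
    finally show ?thesis .
  qed
  have U: "(\<Union>i\<in>C. I i) \<in> lmeasurable" "measure lebesgue (\<Union>i\<in>C. I i) \<le> p * measure lebesgue V"
    using sums by (auto intro!: fmeasurable_UN_bound[OF C(1)] measure_UN_bound[OF C(1)] simp: I_def)
  define T' where "T' = (\<Union>i\<in>C. I i) \<union> N"
  have "g ` E \<subseteq> T'"
  proof
    fix y assume "y \<in> g ` E"
    then obtain x where x: "x \<in> E" "y = g x" by blast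
    show "y \<in> T'"
    proof (cases "x \<in> (\<Union>i\<in>C. ball (cen i) (rad i))")
      case True
      then obtain i where "i \<in> C" "fst i < x" "x < snd i" by (auto simp: ball_eq)
      then have "y \<in> I i" using x strict_mono_less[OF mono] by (simp add: I_def less_imp_le)
      then show ?thesis using \<open>i \<in> C\<close> by (auto simp: T'_def)
    next
      case False
      then show ?thesis using x by (auto simp: T'_def N_def)
    qed
  qed
  moreover have "T' \<in> lmeasurable"
    unfolding T'_def using U negN by (simp add: fmeasurable.Un negligible_imp_measurable)
  moreover have "measure lebesgue T' \<le> p * measure lebesgue T + e"
  proof -
    have "measure lebesgue T' \<le> measure lebesgue (\<Union>i\<in>C. I i) + measure lebesgue N"
      unfolding T'_def using U negN by (intro measure_Un_le) (auto simp: negligible_imp_measurable fmeasurableD)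
    also have "\<dots> \<le> p * measure lebesgue V" using U negN by (simp add: negligible_imp_measure0)
    also have "\<dots> \<le> p * (measure lebesgue T + e / p)" using V p by (intro mult_left_mono) auto
    also have "\<dots> = p * measure lebesgue T + e" using p by (simp add: field_simps)
    finally show ?thesis .
  qed
  ultimately show ?thesis by blast
qed

text \<open>\<open>E\<close> need not be measurable, so the argument runs with the outer measure
  \<open>m\<close>, the infimum over measurable supersets. Contracting nearly optimal supersets
  gives m \<le> k m, hence m = 0.\<close>

lemma negligible_if_measure_contracts:
  assumes T0: "E \<subseteq> T0" "T0 \<in> lmeasurable" and k: "k < 1" "0 < k"
    and step: "\<And>T e. E \<subseteq> T \<Longrightarrow> T \<in> lmeasurable \<Longrightarrow> 0 < e \<Longrightarrow>
                 \<exists>T'. E \<subseteq> T' \<and> T' \<in> lmeasurable \<and> measure lebesgue T' \<le> k * measure lebesgue T + e"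
  shows "negligible E"
proof -
  define A where "A = {measure lebesgue T | T. E \<subseteq> T \<and> T \<in> lmeasurable}"
  define m where "m = Inf A"
  have A: "A \<noteq> {}" "bdd_below A" unfolding A_def using T0 by (auto intro!: bdd_belowI[of _ 0])
  have low: "m \<le> measure lebesgue T" if "E \<subseteq> T" "T \<in> lmeasurable" for T
    unfolding m_def using A(2) that by (intro cInf_lower) (auto simp: A_def)
  have m0: "m \<ge> 0" unfolding m_def using A(1) by (intro cInf_greatest) (auto simp: A_def)
  have near: "\<exists>T. E \<subseteq> T \<and> T \<in> lmeasurable \<and> measure lebesgue T < m + e" if "0 < e" for e
  proof -
    have "Inf A < m + e" using that m_def by simp
    then show ?thesis using A cInf_lessD[of A "m + e"] by (auto simp: A_def)
  qed
  have "m \<le> k * m + e" if e: "0 < e" for e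
  proof -
    obtain T where T: "E \<subseteq> T" "T \<in> lmeasurable" "measure lebesgue T < m + e / 2"
      using near[of "e / 2"] e by auto
    obtain T' where T': "E \<subseteq> T'" "T' \<in> lmeasurable" "measure lebesgue T' \<le> k * measure lebesgue T + e / 2"
      using step[OF T(1,2), of "e / 2"] e by auto
    have "k * measure lebesgue T \<le> k * (m + e / 2)" using T k by (intro mult_left_mono) auto
    also have "\<dots> \<le> k * m + e / 2" using k e by (auto simp: algebra_simps)
    finally show ?thesis using low[OF T'(1,2)] T'(3) by linarith
  qed
  then have "m \<le> k * m" using field_le_epsilon by blast
  then have "(1 - k) * m \<le> 0" by (simp add: algebra_simps)
  then have "m = 0" using k m0 by (simp add: mult_le_0_iff)
  then show ?thesis
    unfolding negligible_outer using near by simp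
qed

text \<open>The bounds for the image under \<open>g\<close> and under its inverse together shrink the outer measure of
  \<open>E\<close> by the factor \<open>p / q < 1\<close>.\<close>

lemma strong_derivates_agree:
  fixes g :: "real \<Rightarrow> real"
  assumes slope: "\<And>x y. x \<le> y \<Longrightarrow> y - x \<le> g y - g x" and lip: "L-lipschitz_on UNIV g"
    and pq: "0 < p" "p < q" and E: "bounded E"
    and lower: "\<And>x d. x \<in> E \<Longrightarrow> 0 < d \<Longrightarrow> \<exists>a b. a < x \<and> x < b \<and> b - a < d \<and> g b - g a \<le> p * (b - a)"
    and upper: "\<And>x d. x \<in> E \<Longrightarrow> 0 < d \<Longrightarrow> \<exists>a b. a < x \<and> x < b \<and> b - a < d \<and> q * (b - a) \<le> g b - g a"
  shows "negligible E"
proof -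
  have mono: "strict_mono g"
    using slope by (intro strict_monoI) (smt (verit))
  have cont: "continuous_on UNIV g" using lip lipschitz_on_continuous_on by blast
  have surj: "surj g"
  proof (rule surjI)
    fix y
    define r where "r = \<bar>y - g 0\<bar>"
    have "g (-r) \<le> y" "y \<le> g r" using slope[of "-r" 0] slope[of 0 r] by (auto simp: r_def)
    moreover have "-r \<le> r" by (simp add: r_def)
    ultimately have "\<exists>x\<ge>-r. x \<le> r \<and> g x = y"
      using IVT'[of g "-r" y r] cont continuous_on_subset by blast
    then show "g (SOME x. g x = y) = y" by (metis (mono_tags, lifting) someI)
  qed
  define h where "h = inv g"
  have gh: "g (h y) = y" and hg: "h (g x) = x" for x y
    unfolding h_def using surj mono by (auto simp: surj_f_inv_f inv_f_f strict_mono_imp_inj_on)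
  have hmono: "strict_mono h"
    using gh strict_mono_less[OF mono] by (intro strict_monoI) metis
  \<comment> \<open>The lower slope bound 1 of \<open>g\<close> is an upper slope bound 1 of its
    inverse.\<close>
  have hlip: "1-lipschitz_on UNIV h"
  proof (rule lipschitz_onI)
    fix x y :: real
    have "\<bar>h x - h y\<bar> \<le> \<bar>x - y\<bar>"
      using slope[of "h x" "h y"] slope[of "h y" "h x"] by (auto simp: gh abs_if split: if_splits)
    then show "dist (h x) (h y) \<le> 1 * dist x y" by (simp add: dist_real_def)
  qed simp
  have L: "L \<ge> 0" using lip lipschitz_on_nonneg by blast
  \<comment> \<open>A steep interval of \<open>g\<close> is a flat one of \<open>h\<close>: slope at
    least \<open>q\<close> becomes slope at most 1 / q. Asking for length below d / (L + 1) keeps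
    the image shorter than \<open>d\<close>.\<close>
  have hsteep: "\<exists>a b. a < y \<and> y < b \<and> b - a < d \<and> h b - h a \<le> (1/q) * (b - a)" if "y \<in> g ` E" "0 < d" for y d
  proof -
    obtain x where x: "x \<in> E" "y = g x" using \<open>y \<in> g ` E\<close> by auto
    have "0 < d / (L + 1)" using that L by simp
    then obtain a b where ab: "a < x" "x < b" "b - a < d / (L + 1)" "q * (b - a) \<le> g b - g a"
      using upper[OF x(1)] by blast
    have "g b - g a \<le> L * (b - a)" using lipschitz_on_normD[OF lip, of b a] ab by auto
    also have "\<dots> \<le> (L + 1) * (b - a)" using ab by (intro mult_right_mono) auto
    also have "\<dots> < d" using ab L by (simp add: field_simps)
    finally have "g b - g a < d" .
    moreover have "b - a \<le> (1/q) * (g b - g a)" using ab pq by (simp add: field_simps)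
    ultimately show ?thesis
      using ab x strict_mono_less[OF mono] hg by (intro exI[of _ "g a"] exI[of _ "g b"]) auto
  qed
  obtain B where B: "E \<subseteq> cball 0 B"
    using bounded_subset_ballD[OF E, of 0] ball_subset_cball by (metis subset_trans)
  show ?thesis
  proof (rule negligible_if_measure_contracts[of E "cball 0 B" "p / q"])
    fix T e assume T: "E \<subseteq> T" "T \<in> lmeasurable" "(0::real) < e"
    obtain T' where T': "g ` E \<subseteq> T'" "T' \<in> lmeasurable"
        "measure lebesgue T' \<le> p * measure lebesgue T + q * e / 2"
      using vitali_image_bound[OF mono lip pq(1) lower T(1,2), of "q * e / 2"] T(3) pq by auto
    obtain T'' where T'': "h ` (g ` E) \<subseteq> T''" "T'' \<in> lmeasurable"
        "measure lebesgue T'' \<le> (1/q) * measure lebesgue T' + e / 2"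
      using vitali_image_bound[OF hmono hlip _ hsteep T'(1,2), of "e / 2"] T(3) pq by auto
    have "(1/q) * measure lebesgue T' \<le> (1/q) * (p * measure lebesgue T + q * e / 2)"
      using T'(3) pq by (intro mult_left_mono) auto
    also have "\<dots> = p / q * measure lebesgue T + e / 2" using pq by (simp add: field_simps)
    finally have "measure lebesgue T'' \<le> p / q * measure lebesgue T + e" using T''(3) by linarith
    moreover have "E \<subseteq> T''" using T''(1) by (simp add: image_image hg)
    ultimately show "\<exists>T'. E \<subseteq> T' \<and> T' \<in> lmeasurable \<and> measure lebesgue T' \<le> p / q * measure lebesgue T + e"
      using T'' by blast
  qed (use B pq in auto)
qed

text \<open>The classical argument by derivates, with slopes over short intervals that contain the
  point in their interior. Adding (L + 1) x makes every slope at least 1, so that the function is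
  invertible and slope bounds can also be applied to the inverse. For each rational pair p < q, the
  points with slopes at most \<open>p\<close> and slopes at least \<open>q\<close> at every scale
  form a null set; elsewhere the slopes converge.\<close>

lemma lipschitz_real_differentiable_ae:
  fixes g :: "real \<Rightarrow> real"
  assumes lip: "L-lipschitz_on UNIV g"
  shows "negligible {x. \<not> g differentiable (at x)}"
proof -
  define G where "G x = g x + (L + 1) * x" for x
  have L: "L \<ge> 0" using lip lipschitz_on_nonneg by blast
  have glip: "\<bar>g y - g x\<bar> \<le> L * \<bar>y - x\<bar>" for x y using lipschitz_on_normD[OF lip, of y x] by simp
  have slope: "y - x \<le> G y - G x" if "x \<le> y" for x y
    using glip[of y x] that by (auto simp: G_def algebra_simps abs_if split: if_splits)
  have upper: "G y - G x \<le> (2 * L + 1) * (y - x)" if "x \<le> y" for x y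
    using glip[of y x] that by (auto simp: G_def algebra_simps abs_if split: if_splits)
  have Glip: "(2 * L + 1)-lipschitz_on UNIV G"
  proof (rule lipschitz_onI)
    fix x y :: real
    show "dist (G x) (G y) \<le> (2 * L + 1) * dist x y"
    proof (cases "x \<le> y")
      case True
      then show ?thesis using slope[of x y] upper[of x y] by (simp add: dist_real_def)
    next
      case False
      then show ?thesis using slope[of y x] upper[of y x] by (simp add: dist_real_def)
    qed
  qed (use L in simp)
  define low where "low p x d \<longleftrightarrow> (\<exists>a b. a < x \<and> x < b \<and> b - a < d \<and> G b - G a \<le> p * (b - a))" for p x d
  define upp where "upp q x d \<longleftrightarrow> (\<exists>a b. a < x \<and> x < b \<and> b - a < d \<and> q * (b - a) \<le> G b - G a)" for q x d
  define E where "E = (\<lambda>(p, q, n). {x. \<bar>x\<bar> \<le> real n \<and> (\<forall>d>0. low p x d) \<and> (\<forall>d>0. upp q x d)})"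
  define I where "I = {(p :: real, q :: real, n :: nat). p \<in> \<rat> \<and> q \<in> \<rat> \<and> 0 < p \<and> p < q}"
  have cI: "countable I"
  proof (rule countable_subset)
    show "I \<subseteq> \<rat> \<times> \<rat> \<times> (UNIV :: nat set)" by (auto simp: I_def)
    show "countable (\<rat> \<times> \<rat> \<times> (UNIV :: nat set) :: (real \<times> real \<times> nat) set)"
      by (intro countable_SIGMA countable_rat) auto
  qed
  have neg: "negligible (E i)" if "i \<in> I" for i
  proof -
    obtain p q n where i: "i = (p, q, n)" by (cases i)
    then have pq: "0 < p" "p < q" using that by (auto simp: I_def)
    have "bounded (E i)" unfolding i E_def by (auto simp: bounded_iff)
    moreover have "low p x d" "upp q x d" if "x \<in> E i" "0 < d" for x d
      using that by (auto simp: i E_def)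
    ultimately show ?thesis
      using strong_derivates_agree[OF slope Glip pq] unfolding low_def upp_def by blast
  qed
  have negU: "negligible (\<Union>i\<in>I. E i)"
    using negligible_countable_Union[of "E ` I"] cI neg by auto
  have "g differentiable (at x)" if x: "x \<notin> (\<Union>i\<in>I. E i)" for x
  proof -
    have split: "(\<exists>d>0. \<not> low p x d) \<or> (\<exists>d>0. \<not> upp q x d)"
      if pq: "p \<in> \<rat>" "q \<in> \<rat>" "0 < p" "p < q" for p q
    proof -
      obtain n :: nat where n: "\<bar>x\<bar> \<le> real n" using real_arch_simple by blast
      have "(p, q, n) \<in> I" using that by (simp add: I_def)
      then have "x \<notin> E (p, q, n)" using x by blast
      then show ?thesis using n by (auto simp: E_def)
    qed
    \<comment> \<open>The numbers that bound all slopes at small scales from below; their supremum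
      is the lower derivate, hence the candidate derivative.\<close>
    define P where "P = {p. \<exists>d>0. \<forall>a b. a < x \<and> x < b \<and> b - a < d \<longrightarrow> p * (b - a) \<le> G b - G a}"
    have P1: "1 \<in> P" unfolding P_def using slope by (auto intro!: exI[of _ 1])
    have Pb: "p \<le> 2 * L + 1" if p: "p \<in> P" for p
    proof -
      obtain d where d: "d > 0" "\<forall>a b. a < x \<and> x < b \<and> b - a < d \<longrightarrow> p * (b - a) \<le> G b - G a"
        using p by (auto simp: P_def)
      have "p * (d / 2) \<le> G (x + d/4) - G (x - d/4)" using d(2)[rule_format, of "x - d/4" "x + d/4"] d(1) by simp
      also have "\<dots> \<le> (2 * L + 1) * (d / 2)" using upper[of "x - d/4" "x + d/4"] d(1) by simp
      finally show ?thesis using d(1) by simp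
    qed
    define l where "l = Sup P"
    have bdd: "bdd_above P" using Pb by (intro bdd_aboveI)
    have l1: "l \<ge> 1" unfolding l_def using P1 bdd by (rule cSup_upper)
    have "\<exists>d>0. \<forall>a b. a < x \<and> x < b \<and> b - a < d \<longrightarrow> \<bar>G b - G a - l * (b - a)\<bar> \<le> e * (b - a)"
      if e: "e > 0" for e
    proof -
      obtain p where p: "p \<in> P" "l - e < p"
        using less_cSup_iff[of P "l - e"] P1 bdd e unfolding l_def by force
      obtain d1 where d1: "d1 > 0" "\<forall>a b. a < x \<and> x < b \<and> b - a < d1 \<longrightarrow> p * (b - a) \<le> G b - G a"
        using p(1) by (auto simp: P_def)
      \<comment> \<open>Since \<open>p'\<close> exceeds the supremum, slopes at most
        \<open>p'\<close> occur at every scale, and \<open>split\<close> for the pair p' < q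
        excludes slopes at least \<open>q\<close> at small scales.\<close>
      obtain p' where p': "p' \<in> \<rat>" "l < p'" "p' < l + e" using Rats_dense_in_real[of l "l + e"] e by auto
      obtain q where q: "q \<in> \<rat>" "p' < q" "q < l + e" using Rats_dense_in_real[of p' "l + e"] p' by auto
      have "p' \<notin> P" using p'(2) bdd unfolding l_def by (meson cSup_upper not_less)
      have "low p' x d" if d: "d > 0" for d
      proof (rule ccontr)
        assume "\<not> low p' x d"
        then have "p' * (b - a) \<le> G b - G a" if "a < x" "x < b" "b - a < d" for a b
          unfolding low_def using that by (meson linorder_linear)
        then have "p' \<in> P" unfolding P_def using d by blast
        with \<open>p' \<notin> P\<close> show False ..
      qed
      then obtain d2 where d2: "d2 > 0" "\<not> upp q x d2" using split[of p' q] p' q l1 by auto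
      show ?thesis
      proof (intro exI[of _ "min d1 d2"] conjI allI impI)
        fix a b assume ab: "a < x \<and> x < b \<and> b - a < min d1 d2"
        have "p * (b - a) \<le> G b - G a" using d1 ab by simp
        moreover have "(l - e) * (b - a) \<le> p * (b - a)" using p ab by (intro mult_right_mono) auto
        moreover have "G b - G a < q * (b - a)" using d2(2) ab unfolding upp_def by (meson min_less_iff_conj not_le)
        moreover have "q * (b - a) \<le> (l + e) * (b - a)" using q ab by (intro mult_right_mono) auto
        ultimately show "\<bar>G b - G a - l * (b - a)\<bar> \<le> e * (b - a)"
          unfolding abs_le_iff by (auto simp: algebra_simps)
      qed (use d1 d2 in auto)
    qed note two_sided = this
    have cont: "isCont G y" for y
      using Glip lipschitz_on_continuous_on continuous_on_eq_continuous_at by blast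
    have "(G has_derivative (\<lambda>h. l * h)) (at x)"
      unfolding has_derivative_at_alt
    proof (intro conjI allI impI)
      show "bounded_linear ((*) l)" by (rule bounded_linear_mult_right)
      fix e :: real assume e: "0 < e"
      obtain d where d: "d > 0" "\<And>a b. a < x \<Longrightarrow> x < b \<Longrightarrow> b - a < d \<Longrightarrow> \<bar>G b - G a - l * (b - a)\<bar> \<le> e * (b - a)"
        using two_sided[OF e] by blast
      show "\<exists>d>0. \<forall>y. norm (y - x) < d \<longrightarrow> norm (G y - G x - l * (y - x)) \<le> e * norm (y - x)"
      proof (intro exI[of _ d] conjI allI impI d(1))
        fix y assume y: "norm (y - x) < d"
        \<comment> \<open>The estimate is known for intervals with \<open>x\<close> in the interior;
          moving one endpoint to \<open>x\<close> by continuity gives the one-sided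
          quotients.\<close>
        consider "y = x" | "x < y" | "y < x" by linarith
        then show "norm (G y - G x - l * (y - x)) \<le> e * norm (y - x)"
        proof cases
          case 2
          have "\<bar>G y - G x - l * (y - x)\<bar> \<le> e * (y - x)"
          proof (rule tendsto_le[of "at_left x" "\<lambda>a. e * (y - a)" _ "\<lambda>a. \<bar>G y - G a - l * (y - a)\<bar>"])
            have G: "(G \<longlongrightarrow> G x) (at_left x)"
              using cont[of x] by (simp add: isCont_def filterlim_at_split)
            show "((\<lambda>a. e * (y - a)) \<longlongrightarrow> e * (y - x)) (at_left x)" by (intro tendsto_intros)
            show "((\<lambda>a. \<bar>G y - G a - l * (y - a)\<bar>) \<longlongrightarrow> \<bar>G y - G x - l * (y - x)\<bar>) (at_left x)"
              by (intro tendsto_intros G)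
            have "eventually (\<lambda>a. a \<in> {y - d<..<x}) (at_left x)"
              using y 2 by (intro eventually_at_left_real) auto
            then show "\<forall>\<^sub>F a in at_left x. \<bar>G y - G a - l * (y - a)\<bar> \<le> e * (y - a)"
              by eventually_elim (use 2 in \<open>auto intro!: d(2)\<close>)
          qed simp
          then show ?thesis using 2 by simp
        next
          case 3
          have "\<bar>G x - G y - l * (x - y)\<bar> \<le> e * (x - y)"
          proof (rule tendsto_le[of "at_right x" "\<lambda>b. e * (b - y)" _ "\<lambda>b. \<bar>G b - G y - l * (b - y)\<bar>"])
            have G: "(G \<longlongrightarrow> G x) (at_right x)"
              using cont[of x] by (simp add: isCont_def filterlim_at_split)
            show "((\<lambda>b. e * (b - y)) \<longlongrightarrow> e * (x - y)) (at_right x)" by (intro tendsto_intros)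
            show "((\<lambda>b. \<bar>G b - G y - l * (b - y)\<bar>) \<longlongrightarrow> \<bar>G x - G y - l * (x - y)\<bar>) (at_right x)"
              by (intro tendsto_intros G)
            have "eventually (\<lambda>b. b \<in> {x<..<y + d}) (at_right x)"
              using y 3 by (intro eventually_at_right_real) auto
            then show "\<forall>\<^sub>F b in at_right x. \<bar>G b - G y - l * (b - y)\<bar> \<le> e * (b - y)"
              by eventually_elim (use 3 in \<open>auto intro!: d(2)\<close>)
          qed simp
          moreover have "G y - G x - l * (y - x) = - (G x - G y - l * (x - y))" by (simp add: algebra_simps)
          ultimately show ?thesis using 3 by simp
        qed simp
      qed
    qed
    then have "G differentiable (at x)" by (auto simp: differentiable_def)
    then have "(\<lambda>x. G x - (L + 1) * x) differentiable (at x)"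
      by (intro derivative_intros)
    then show ?thesis by (simp add: G_def)
  qed
  then have "{x. \<not> g differentiable (at x)} \<subseteq> (\<Union>i\<in>I. E i)"
    by (metis (mono_tags, lifting) mem_Collect_eq subsetI)
  then show ?thesis by (rule negligible_subset[OF negU])
qed

lemma lipschitz_differentiable_ae:
  fixes y :: "real \<Rightarrow> 'a::euclidean_space"
  assumes lip: "L-lipschitz_on UNIV y"
  shows "negligible {t. \<not> y differentiable (at t)}"
proof -
  have "negligible {t. \<not> (\<lambda>x. y x \<bullet> i) differentiable (at t)}" if i: "i \<in> Basis" for i
  proof (rule lipschitz_real_differentiable_ae)
    show "L-lipschitz_on UNIV (\<lambda>x. y x \<bullet> i)"
    proof (rule lipschitz_onI)
      fix s t :: real
      have "\<bar>y s \<bullet> i - y t \<bullet> i\<bar> \<le> norm (y s - y t)"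
        using Basis_le_norm[OF i, of "y s - y t"] by (simp add: inner_diff_left)
      also have "\<dots> \<le> L * dist s t" using lipschitz_onD[OF lip, of s t] by (simp add: dist_norm)
      finally show "dist (y s \<bullet> i) (y t \<bullet> i) \<le> L * dist s t" by (simp add: dist_norm)
    qed (use lip lipschitz_on_nonneg in blast)
  qed
  then have "negligible (\<Union>i\<in>(Basis::'a set). {t. \<not> (\<lambda>x. y x \<bullet> i) differentiable (at t)})"
    by (intro negligible_Union) auto
  moreover have "{t. \<not> y differentiable (at t)} = (\<Union>i\<in>(Basis::'a set). {t. \<not> (\<lambda>x. y x \<bullet> i) differentiable (at t)})"
    using differentiable_componentwise_within[of y _ UNIV] by auto
  ultimately show ?thesis by simp
qed

section \<open>Integrating the derivative of a Lipschitz curve\<close>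

lemma has_vector_derivative_seq:
  assumes der: "(f has_vector_derivative D) (at x within S)"
    and X: "X \<longlonglongrightarrow> x" "\<And>n. X n \<in> S" "\<And>n. X n > x"
  shows "(\<lambda>n. (f (X n) - f x) /\<^sub>R (X n - x)) \<longlonglongrightarrow> D"
proof -
  have lim: "((\<lambda>y. (1 / norm (y - x)) *\<^sub>R (f y - (f x + (y - x) *\<^sub>R D))) \<longlongrightarrow> 0) (at x within S)"
    using der unfolding has_vector_derivative_def has_derivative_within by blast
  have flt: "filterlim X (at x within S) sequentially"
    unfolding filterlim_at using X by (auto simp: less_imp_neq[THEN not_sym])
  have "(\<lambda>n. (1 / norm (X n - x)) *\<^sub>R (f (X n) - (f x + (X n - x) *\<^sub>R D))) \<longlonglongrightarrow> 0"
    by (rule filterlim_compose[OF lim flt])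
  moreover have "(1 / norm (X n - x)) *\<^sub>R (f (X n) - (f x + (X n - x) *\<^sub>R D)) = (f (X n) - f x) /\<^sub>R (X n - x) - D" for n
    using X(3)[of n] by (simp add: scaleR_diff_right scaleR_add_right divide_inverse)
  ultimately show ?thesis by (simp add: LIM_zero_iff)
qed

text \<open>Difference quotients are bounded by \<open>L\<close> and converge almost everywhere, so
  dominated convergence applies. Their integral telescopes into a mean of the curve just after 1
  minus a mean just after 0, and continuity sends this to the increment.\<close>

lemma lipschitz_fundamental_theorem:
  fixes y :: "real \<Rightarrow> 'a::euclidean_space"
  assumes lip0: "L-lipschitz_on {0..1} y"
  obtains w where "w \<in> borel_measurable (lebesgue_on {0..1})"
    "AE t in lebesgue_on {0..1}. 0 < t \<and> t < 1 \<and> (y has_vector_derivative w t) (at t)"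
    "has_bochner_integral (lebesgue_on {0..1}) w (y 1 - y 0)"
proof -
  \<comment> \<open>Constant extension beyond \<open>{0..1}\<close>: quotients with nodes past 1
    make sense and the Lipschitz constant is kept.\<close>
  define Y where "Y t = y (max 0 (min 1 t))" for t
  have L: "L \<ge> 0" using lip0 lipschitz_on_nonneg by blast
  have lip: "L-lipschitz_on UNIV Y"
  proof (rule lipschitz_onI)
    fix s t :: real
    have "dist (Y s) (Y t) \<le> L * dist (max 0 (min 1 s)) (max 0 (min 1 t))"
      unfolding Y_def by (rule lipschitz_onD[OF lip0]) auto
    also have "\<dots> \<le> L * dist s t" using L by (intro mult_left_mono) (auto simp: dist_real_def)
    finally show "dist (Y s) (Y t) \<le> L * dist s t" .
  qed (rule L)
  have cont: "continuous_on A Y" for A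
    using lip lipschitz_on_continuous_on continuous_on_subset by blast
  define h where "h n = 1 / (real n + 1)" for n
  have h: "0 < h n" "h n \<le> 1" for n by (auto simp: h_def)
  have h0: "h \<longlonglongrightarrow> 0"
    unfolding h_def using LIMSEQ_inverse_real_of_nat by (simp add: inverse_eq_divide add.commute)
  define q where "q n t = (Y (t + h n) - Y t) /\<^sub>R h n" for n t
  \<comment> \<open>A limit of Borel functions taken with \<open>lim\<close> is Borel, whatever its
    value at the null set of points where the quotients diverge.\<close>
  define w where "w t = lim (\<lambda>n. q n t)" for t
  have qm: "q n \<in> borel_measurable borel" for n
    unfolding q_def by (intro borel_measurable_continuous_onI continuous_intros continuous_on_compose2[OF cont]) auto
  have wm: "w \<in> borel_measurable borel"
    unfolding w_def using qm by (intro borel_measurable_lim_metric)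
  have bm: "u \<in> borel_measurable (lebesgue_on {0..1})" if "u \<in> borel_measurable borel" for u :: "real \<Rightarrow> 'a"
    using that by (intro measurable_restrict_space1 measurable_completion) simp
  let ?N = "{t. \<not> Y differentiable (at t)} \<union> {0, 1}"
  have "negligible ?N" using lipschitz_differentiable_ae[OF lip] by (intro negligible_Un) auto
  then have "AE t in lebesgue. t \<notin> ?N"
    by (intro AE_not_in) (simp only: negligible_iff_null_sets)
  then have AEN: "AE t in lebesgue_on {0..1}. t \<notin> ?N"
    by (subst AE_restrict_space_iff) auto
  have dif: "(Y has_vector_derivative w t) (at t)" "(\<lambda>n. q n t) \<longlonglongrightarrow> w t" if t: "t \<notin> ?N" for t
  proof -
    obtain D where D: "(Y has_vector_derivative D) (at t)"
      using t vector_derivative_works by blast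
    have "(\<lambda>n. (Y (t + h n) - Y t) /\<^sub>R (t + h n - t)) \<longlonglongrightarrow> D"
      using tendsto_add[OF tendsto_const[of t] h0] h by (intro has_vector_derivative_seq[OF D]) auto
    then have "(\<lambda>n. q n t) \<longlonglongrightarrow> D" by (simp add: q_def)
    then show "(\<lambda>n. q n t) \<longlonglongrightarrow> w t" "(Y has_vector_derivative w t) (at t)"
      using D limI by (auto simp: w_def)
  qed
  have ae: "AE t in lebesgue_on {0..1}. 0 < t \<and> t < 1 \<and> (y has_vector_derivative w t) (at t)"
    using AEN AE_space[of "lebesgue_on {0..1}"]
  proof eventually_elim
    case (elim t)
    then have t: "0 < t" "t < 1" by (auto simp: order.strict_iff_order)
    have "(y has_vector_derivative w t) (at t)"
      using dif(1)[of t] elim t has_vector_derivative_transform_within_open[of Y "w t" t "{0<..<1}" y]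
      by (auto simp: Y_def)
    then show ?case using t by simp
  qed
  have bound: "AE t in lebesgue_on {0..1}. norm (q n t) \<le> L" for n
  proof (rule AE_I2)
    fix t
    have "norm (Y (t + h n) - Y t) \<le> L * h n"
      using lipschitz_on_normD[OF lip, of "t + h n" t] h[of n] by simp
    then show "norm (q n t) \<le> L" using h[of n] by (simp add: q_def) (simp add: field_simps)
  qed
  have lim: "AE t in lebesgue_on {0..1}. (\<lambda>n. q n t) \<longlonglongrightarrow> w t"
    using AEN by eventually_elim (rule dif(2))
  have fin: "integrable (lebesgue_on {0..1::real}) (\<lambda>_. L)" by simp
  have intw: "integrable (lebesgue_on {0..1}) w"
    by (rule integrable_dominated_convergence[OF bm[OF wm] bm[OF qm] fin lim bound])
  have intq: "integrable (lebesgue_on {0..1}) (q n)" for n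
    by (rule integrable_dominated_convergence2[OF bm[OF wm] bm[OF qm] fin lim bound])
  have conv: "(\<lambda>n. integral\<^sup>L (lebesgue_on {0..1}) (q n)) \<longlonglongrightarrow> integral\<^sup>L (lebesgue_on {0..1}) w"
    by (rule integral_dominated_convergence[OF bm[OF wm] bm[OF qm] fin lim bound])
  define F where "F u = integral {0..u} Y" for u
  have integ: "Y integrable_on {a..b}" for a b using cont integrable_continuous_real by blast
  \<comment> \<open>The interval reaches 2 because the shifted nodes 1 + h n lie in [1, 2].\<close>
  have F: "(F has_vector_derivative Y u) (at u within {0..2})" if "u \<in> {0..2}" for u
    unfolding F_def using cont that by (rule integral_has_vector_derivative)
  have qF: "integral\<^sup>L (lebesgue_on {0..1}) (q n) = (F (1 + h n) - F 1) /\<^sub>R h n - (F (0 + h n) - F 0) /\<^sub>R h n" for n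
  proof -
    have "integral\<^sup>L (lebesgue_on {0..1}) (q n) = integral {0..1} (q n)"
      using intq by (rule lebesgue_integral_eq_integral) simp
    also have "\<dots> = (integral {0..1} (Y \<circ> (\<lambda>x. x + h n)) - integral {0..1} Y) /\<^sub>R h n"
    proof -
      have "(Y \<circ> (\<lambda>x. x + h n)) integrable_on {0..1}"
        by (intro integrable_continuous_real continuous_on_compose continuous_intros cont)
      then show ?thesis unfolding q_def o_def
        using integral_diff[of "\<lambda>x. Y (x + h n)" "{0..1}" Y] integ[of 0 1] by (simp add: integral_cmul o_def)
    qed
    also have "integral {0..1} (Y \<circ> (\<lambda>x. x + h n)) = integral {0 + h n..1 + h n} Y"
      by (rule integral_shift) (rule cont)
    also have "integral {0 + h n..1 + h n} Y = F (1 + h n) - F (h n)"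
      using Henstock_Kurzweil_Integration.integral_combine[where f=Y and a=0 and c="h n" and b="1 + h n"] integ h[of n] by (simp add: F_def algebra_simps)
    finally show ?thesis by (simp add: F_def scaleR_diff_right algebra_simps)
  qed
  have quot: "(\<lambda>n. (F (u + h n) - F u) /\<^sub>R h n) \<longlonglongrightarrow> Y u" if "u \<in> {0..1}" for u
  proof -
    have "u + h n \<le> 2" "0 \<le> u + h n" for n using that h[of n] by auto
    then have "(\<lambda>n. (F (u + h n) - F u) /\<^sub>R (u + h n - u)) \<longlonglongrightarrow> Y u"
      using that tendsto_add[OF tendsto_const[of u] h0] h by (intro has_vector_derivative_seq[OF F[of u]]) auto
    then show ?thesis by simp
  qed
  have "(\<lambda>n. integral\<^sup>L (lebesgue_on {0..1}) (q n)) \<longlonglongrightarrow> Y 1 - Y 0"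
    unfolding qF by (intro tendsto_diff quot) auto
  then have "integral\<^sup>L (lebesgue_on {0..1}) w = Y 1 - Y 0" using conv LIMSEQ_unique by blast
  then have "has_bochner_integral (lebesgue_on {0..1}) w (y 1 - y 0)"
    using intw by (simp add: has_bochner_integral_iff Y_def)
  then show ?thesis using that[OF bm[OF wm] ae] by blast
qed

section \<open>Limit curves of discrete inclusions\<close>

text \<open>If the sequence oscillated, some level \<open>c\<close> outside \<open>C\<close> would
  be crossed upwards infinitely often, and the vanishing increments force the values just before the
  crossings to tend to \<open>c\<close>. By \<open>descent\<close> the sequence then falls below
  \<open>c\<close> without rising much above it, against the crossing. The limit lies in
  \<open>C\<close> because a level outside \<open>C\<close> is left downwards.\<close>

lemma convergent_if_descending:
  fixes e :: "nat \<Rightarrow> real"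
  assumes bdd: "bounded (range e)" and inc: "(\<lambda>n. e (Suc n) - e n) \<longlonglongrightarrow> 0" and C: "interior C = {}"
    and descent: "\<And>s c. strict_mono s \<Longrightarrow> (e \<circ> s) \<longlonglongrightarrow> c \<Longrightarrow> c \<notin> C \<Longrightarrow>
      \<exists>\<delta>>0. \<forall>\<epsilon>>0. \<forall>k0. \<exists>k\<ge>k0. \<exists>n\<ge>s k. e n \<le> c - \<delta> \<and> (\<forall>m. s k \<le> m \<and> m \<le> n \<longrightarrow> e m \<le> c + \<epsilon>)"
  shows "\<exists>c\<in>C. e \<longlonglongrightarrow> c"
proof -
  have no_osc: False if ab: "a < b" and lo: "\<And>N. \<exists>n\<ge>N. e n < a" and hi: "\<And>N. \<exists>n\<ge>N. b < e n" for a b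
  proof -
    obtain c where c: "a < c" "c < b" "c \<notin> C"
    proof -
      have "\<not> {a<..<b} \<subseteq> C" using interior_maximal[of "{a<..<b}" C] C ab by auto
      then obtain x where "x \<in> {a<..<b}" "x \<notin> C" by blast
      then show ?thesis using that[of x] by simp
    qed
    \<comment> \<open>\<open>p\<close> is the last index below \<open>c\<close> before the level
      \<open>b\<close> is reached; the maximum of \<open>A\<close> below realizes this
      choice.\<close>
    define P where "P p \<longleftrightarrow> e p < c \<and> (\<exists>q>p. b \<le> e q \<and> (\<forall>m. p < m \<and> m \<le> q \<longrightarrow> c \<le> e m))" for p
    have "\<exists>p\<ge>N. P p" for N
    proof -
      obtain n where n: "n \<ge> N" "e n < a" using lo by blast
      obtain q where q: "q \<ge> n" "b < e q" using hi by blast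
      define A where "A = {m. n \<le> m \<and> m \<le> q \<and> e m < c}"
      have A: "finite A" "n \<in> A" unfolding A_def using n q c by auto
      define p where "p = Max A"
      have p: "p \<in> A" unfolding p_def using A by (intro Max_in) auto
      have "c \<le> e m" if "p < m" "m \<le> q" for m
      proof (rule ccontr)
        assume "\<not> c \<le> e m"
        then have "m \<in> A" using that p by (auto simp: A_def)
        then have "m \<le> p" unfolding p_def using A(1) by simp
        then show False using that by simp
      qed
      moreover have "p < q" using p q c by (auto simp: A_def order.strict_iff_order)
      ultimately have "P p" unfolding P_def using p q by (auto simp: A_def intro!: exI[of _ q])
      then show ?thesis using p n by (intro exI[of _ p]) (auto simp: A_def)
    qed
    then have "infinite {p. P p}" by (auto simp: infinite_nat_iff_unbounded_le)
    then obtain s where s: "strict_mono (s :: nat \<Rightarrow> nat)" "\<And>k. P (s k)"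
      using infinite_enumerate[of "{p. P p}"] by auto
    have up: "e (s k) < c \<and> c \<le> e (Suc (s k))" for k
      using s(2)[of k] unfolding P_def by (metis Suc_leI lessI)
    have "(\<lambda>k. e (Suc (s k)) - e (s k)) \<longlonglongrightarrow> 0"
      using LIMSEQ_subseq_LIMSEQ[OF inc s(1)] by (simp add: o_def)
    then have "(\<lambda>k. c - e (s k)) \<longlonglongrightarrow> 0"
      by (rule tendsto_sandwich[OF _ _ tendsto_const, rotated 2]) (use up in \<open>auto intro!: always_eventually simp: less_imp_le\<close>)
    then have lim: "(e \<circ> s) \<longlonglongrightarrow> c"
      using tendsto_diff[OF tendsto_const[of c], of "\<lambda>k. c - e (s k)" 0] by (simp add: o_def)
    obtain \<delta> where \<delta>: "\<delta> > 0" "\<And>\<epsilon> k0. \<epsilon> > 0 \<Longrightarrow> \<exists>k\<ge>k0. \<exists>n\<ge>s k. e n \<le> c - \<delta> \<and> (\<forall>m. s k \<le> m \<and> m \<le> n \<longrightarrow> e m \<le> c + \<epsilon>)"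
      using descent[OF s(1) lim c(3)] by blast
    obtain k0 where k0: "\<And>k. k \<ge> k0 \<Longrightarrow> c - \<delta> < e (s k)"
      using order_tendstoD(1)[OF lim, of "c - \<delta>"] \<delta>(1) by (auto simp: eventually_sequentially o_def)
    \<comment> \<open>The margin (b - c) / 2 keeps all values up to \<open>n\<close> below
      \<open>b\<close>, while \<open>n\<close> must come after \<open>q\<close>, where
      \<open>b\<close> is reached.\<close>
    obtain k n where kn: "k \<ge> k0" "n \<ge> s k" "e n \<le> c - \<delta>" "\<And>m. s k \<le> m \<Longrightarrow> m \<le> n \<Longrightarrow> e m \<le> c + (b - c) / 2"
      using \<delta>(2)[of "(b - c) / 2" k0] c by auto
    obtain q where q: "q > s k" "b \<le> e q" "\<And>m. s k < m \<Longrightarrow> m \<le> q \<Longrightarrow> c \<le> e m"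
      using s(2)[of k] by (auto simp: P_def)
    have "n \<noteq> s k" using kn k0 by force
    then have "q < n" using q(3)[of n] kn \<delta>(1) by (cases "n \<le> q") auto
    then show False using kn(4)[of q] q c by (auto simp: field_simps)
  qed
  obtain l r where r: "strict_mono (r :: nat \<Rightarrow> nat)" "(e \<circ> r) \<longlonglongrightarrow> l"
    using bounded_imp_convergent_subsequence[OF bdd] by blast
  have freq: "\<exists>n\<ge>N. \<bar>e n - l\<bar> < \<epsilon>" if "\<epsilon> > 0" for N \<epsilon>
  proof -
    obtain k0 where "\<And>k. k \<ge> k0 \<Longrightarrow> \<bar>e (r k) - l\<bar> < \<epsilon>"
      using r(2) \<open>\<epsilon> > 0\<close> by (auto simp: LIMSEQ_iff)
    then show ?thesis using seq_suble[OF r(1), of "max k0 N"] by (intro exI[of _ "r (max k0 N)"]) auto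
  qed
  have "e \<longlonglongrightarrow> l"
  proof (rule ccontr)
    assume "\<not> e \<longlonglongrightarrow> l"
    then obtain \<epsilon> where \<epsilon>: "\<epsilon> > 0" "\<And>N. \<exists>n\<ge>N. \<epsilon> \<le> \<bar>e n - l\<bar>"
      by (auto simp: LIMSEQ_iff not_less)
    show False
    proof (cases "\<forall>N. \<exists>n\<ge>N. e n \<ge> l + \<epsilon>")
      case True
      have "\<exists>n\<ge>N. e n < l + \<epsilon> / 3" for N
      proof -
        obtain n where "n \<ge> N" "\<bar>e n - l\<bar> < \<epsilon> / 3" using freq[of "\<epsilon> / 3" N] \<epsilon>(1) by auto
        then show ?thesis by (intro exI[of _ n]) linarith
      qed
      moreover have "\<exists>n\<ge>N. l + \<epsilon> / 2 < e n" for N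
      proof -
        obtain n where "n \<ge> N" "l + \<epsilon> \<le> e n" using True by blast
        then show ?thesis using \<epsilon>(1) by (intro exI[of _ n]) linarith
      qed
      ultimately show False using no_osc[of "l + \<epsilon> / 3" "l + \<epsilon> / 2"] \<epsilon>(1) by auto
    next
      case False
      then obtain N0 where N0: "\<And>n. n \<ge> N0 \<Longrightarrow> e n < l + \<epsilon>" by (meson not_le)
      have "\<exists>n\<ge>N. e n < l - \<epsilon> / 2" for N
      proof -
        obtain n where "n \<ge> max N N0" "\<epsilon> \<le> \<bar>e n - l\<bar>" using \<epsilon>(2) by blast
        then show ?thesis using N0[of n] \<epsilon>(1) by (intro exI[of _ n]) auto
      qed
      moreover have "\<exists>n\<ge>N. l - \<epsilon> / 3 < e n" for N
      proof -
        obtain n where "n \<ge> N" "\<bar>e n - l\<bar> < \<epsilon> / 3" using freq[of "\<epsilon> / 3" N] \<epsilon>(1) by auto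
        then show ?thesis by (intro exI[of _ n]) linarith
      qed
      ultimately show False using no_osc[of "l - \<epsilon> / 2" "l - \<epsilon> / 3"] \<epsilon>(1) by auto
    qed
  qed
  moreover have "l \<in> C"
  proof (rule ccontr)
    assume "l \<notin> C"
    have "strict_mono (id :: nat \<Rightarrow> nat)" by (simp add: strict_mono_def)
    from descent[OF this _ \<open>l \<notin> C\<close>] \<open>e \<longlonglongrightarrow> l\<close>
    obtain \<delta> where \<delta>: "\<delta> > 0" "\<And>k0. \<exists>k\<ge>k0. \<exists>n\<ge>k. e n \<le> l - \<delta>"
      by simp metis
    obtain k0 where k0: "\<And>k. k \<ge> k0 \<Longrightarrow> l - \<delta> < e k"
      using order_tendstoD(1)[OF \<open>e \<longlonglongrightarrow> l\<close>, of "l - \<delta>"] \<delta>(1) by (auto simp: eventually_sequentially)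
    then show False using \<delta>(2)[of k0] by (meson leD le_trans)
  qed
  ultimately show ?thesis by blast
qed

text \<open>The coefficient of \<open>d i\<close> is the length of the part of the i-th time step
  that lies before \<open>u\<close>. This closed form of the polygonal curve shows its increments
  directly as weighted sums of directions.\<close>

definition interpolation :: "(nat \<Rightarrow> real) \<Rightarrow> (nat \<Rightarrow> 'a::real_vector) \<Rightarrow> 'a \<Rightarrow> nat \<Rightarrow> real \<Rightarrow> 'a" where
  "interpolation h d x0 N u =
     x0 + (\<Sum>i<N. (min u (sum h {..<Suc i}) - min u (sum h {..<i})) *\<^sub>R d i)"

lemma interpolation_node:
  assumes h: "\<And>i. 0 < h i" and x: "\<And>i. x (Suc i) = x i + h i *\<^sub>R d i" and n: "n \<le> N"
  shows "interpolation h d (x 0) N (sum h {..<n}) = x n"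
proof -
  have mono: "sum h {..<i} \<le> sum h {..<j}" if "i \<le> j" for i j
    using that h by (intro sum_mono2) (auto simp: less_imp_le)
  have "(\<Sum>i<N. (min (sum h {..<n}) (sum h {..<Suc i}) - min (sum h {..<n}) (sum h {..<i})) *\<^sub>R d i)
      = (\<Sum>i<n. h i *\<^sub>R d i)"
  proof (rule sum.mono_neutral_cong_right)
    fix i assume "i \<in> {..<n}"
    then show "(min (sum h {..<n}) (sum h {..<Suc i}) - min (sum h {..<n}) (sum h {..<i})) *\<^sub>R d i = h i *\<^sub>R d i"
      using mono[of "Suc i" n] mono[of i n] by (simp add: min_absorb2)
  next
    show "\<forall>i\<in>{..<N} - {..<n}. (min (sum h {..<n}) (sum h {..<Suc i}) - min (sum h {..<n}) (sum h {..<i})) *\<^sub>R d i = 0"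
      using mono[of n] by (simp add: min_absorb1 del: sum.lessThan_Suc)
  qed (use n in auto)
  moreover have "x n = x 0 + (\<Sum>i<n. h i *\<^sub>R d i)" by (induction n) (simp_all add: x add.assoc)
  ultimately show ?thesis by (simp add: interpolation_def)
qed

text \<open>The slope over [u, v] is the average of the directions, weighted by the overlap of their
  time steps with [u, v].\<close>

lemma interpolation_slope_in_convex:
  assumes h: "\<And>i. 0 < h i" and u: "0 \<le> u" "u < v" "v \<le> sum h {..<N}" and Q: "convex Q"
    and d: "\<And>i. i < N \<Longrightarrow> sum h {..<i} < v \<Longrightarrow> u < sum h {..<Suc i} \<Longrightarrow> d i \<in> Q"
  shows "(interpolation h d x0 N v - interpolation h d x0 N u) /\<^sub>R (v - u) \<in> Q"
proof -
  define c where "c i = (min v (sum h {..<Suc i}) - min v (sum h {..<i})) - (min u (sum h {..<Suc i}) - min u (sum h {..<i}))" for i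
  have c0: "c i \<ge> 0" for i
    using h[of i] u by (auto simp: c_def min_def)
  have czero: "c i = 0" if "\<not> (sum h {..<i} < v \<and> u < sum h {..<Suc i})" for i
    using that h[of i] u by (auto simp: c_def min_def)
  have tele: "(\<Sum>i<N. min t (sum h {..<Suc i}) - min t (sum h {..<i})) = min t (sum h {..<N}) - min t 0" for t
    using sum_lessThan_telescope[of "\<lambda>i. min t (sum h {..<i})" N] by simp
  have csum: "(\<Sum>i<N. c i) = v - u"
    unfolding c_def sum_subtractf using tele[of v] tele[of u] u by (simp add: sum_subtractf del: sum.lessThan_Suc)
  define S where "S = {i\<in>{..<N}. sum h {..<i} < v \<and> u < sum h {..<Suc i}}"
  have S: "(\<Sum>i\<in>S. c i) = v - u"
    unfolding csum[symmetric] by (rule sum.mono_neutral_left) (auto simp: S_def intro: czero)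
  have "(\<Sum>i\<in>S. (c i / (v - u)) *\<^sub>R d i) \<in> Q"
  proof (rule convex_sum[OF _ Q])
    show "(\<Sum>i\<in>S. c i / (v - u)) = 1" using S u by (simp flip: sum_divide_distrib)
    show "d i \<in> Q" if "i \<in> S" for i using that d by (auto simp: S_def)
  qed (use c0 u in \<open>auto simp: S_def\<close>)
  also have "(\<Sum>i\<in>S. (c i / (v - u)) *\<^sub>R d i) = (\<Sum>i<N. (c i / (v - u)) *\<^sub>R d i)"
    by (rule sum.mono_neutral_left) (auto simp: S_def intro: czero)
  also have "\<dots> = (\<Sum>i<N. c i *\<^sub>R d i) /\<^sub>R (v - u)"
    by (simp add: scaleR_sum_right divide_inverse mult.commute)
  also have "(\<Sum>i<N. c i *\<^sub>R d i) = interpolation h d x0 N v - interpolation h d x0 N u"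
    unfolding interpolation_def c_def
    by (simp only: add_diff_cancel_left sum_subtractf[symmetric] scaleR_diff_left[symmetric])
  finally show ?thesis .
qed


text \<open>Only difference quotients of the limit curve are compared with averages of the \<open>d n\<close>, so that
  closedness and convexity of the values of \<open>F\<close> suffice and no weak limit of the velocities is needed.\<close>

lemma limit_trajectory_unit:
  fixes x d :: "nat \<Rightarrow> 'a::euclidean_space"
  assumes h: "\<And>n. 0 < h n" "h \<longlonglongrightarrow> 0" "filterlim (\<lambda>n. sum h {..<n}) at_top sequentially"
    and step: "\<And>n. x (Suc n) = x n + h n *\<^sub>R d n"
    and bx: "bounded (range x)" and bd: "bounded (range d)"
    and F: "\<And>z. closed (F z)" "\<And>z. convex (F z)"
    and incl: "\<And>m z w. filterlim m at_top sequentially \<Longrightarrow> (\<lambda>k. x (m k)) \<longlonglongrightarrow> z \<Longrightarrow>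
      (\<lambda>k. d (m k)) \<longlonglongrightarrow> w \<Longrightarrow> w \<in> F z"
    and s: "filterlim s at_top sequentially"
  obtains r y L N where "strict_mono (r :: nat \<Rightarrow> nat)" "L-lipschitz_on {0..1} y"
    "\<And>u D. 0 < u \<Longrightarrow> u < 1 \<Longrightarrow> (y has_vector_derivative D) (at u) \<Longrightarrow> D \<in> F (y u)"
    "(\<lambda>k. x (s (r k))) \<longlonglongrightarrow> y 0"
    "\<And>u. u \<in> {0..1} \<Longrightarrow> \<exists>n. (\<forall>k. n k \<le> N k) \<and> (\<lambda>k. x (s (r k) + n k)) \<longlonglongrightarrow> y u"
    "\<And>\<epsilon>. \<epsilon> > 0 \<Longrightarrow> \<exists>k0. \<forall>k\<ge>k0. \<forall>n\<le>N k. \<exists>u\<in>{0..1}. norm (x (s (r k) + n) - y u) < \<epsilon>"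
proof -
  obtain B where B: "B > 0" "\<And>n. norm (d n) \<le> B" using bd by (auto simp: bounded_pos)
  obtain Bx where Bx: "\<And>n. norm (x n) \<le> Bx" using bx by (auto simp: bounded_iff)
  define H where "H k i = h (s k + i)" for k i
  define \<tau> where "\<tau> k n = sum (H k) {..<n}" for k n
  have H0: "0 < H k i" for k i by (simp add: H_def h)
  have \<tau>mono: "\<tau> k i \<le> \<tau> k j" if "i \<le> j" for k i j
    unfolding \<tau>_def using that H0 by (intro sum_mono2) (auto simp: less_imp_le)
  have \<tau>0: "\<tau> k 0 = 0" for k by (simp add: \<tau>_def)
  have "\<exists>n. 1 \<le> \<tau> k n" for k
  proof -
    have split: "sum h {..<s k + n} = sum h {..<s k} + \<tau> k n" for n
      unfolding \<tau>_def H_def by (induction n) auto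
    obtain n where n: "sum h {..<s k} + 1 \<le> sum h {..<n}" "n \<ge> s k"
      using h(3) unfolding filterlim_at_top eventually_sequentially by (meson nle_le)
    then show ?thesis using split[of "n - s k"] by auto
  qed
  then have "\<exists>n. \<tau> k n < 1 \<and> 1 \<le> \<tau> k (Suc n)" for k
    using ex_least_nat_less[of "\<lambda>n. 1 \<le> \<tau> k n"] \<tau>0 by (metis linorder_not_less zero_less_one order_refl)
  \<comment> \<open>\<open>N k\<close> is the last node before unit time; one more step makes the
    polygon cover \<open>{0..1}\<close>.\<close>
  then obtain N where N: "\<And>k. \<tau> k (N k) < 1" "\<And>k. 1 \<le> \<tau> k (Suc (N k))" by metis
  define Y where "Y k = interpolation (H k) (\<lambda>i. d (s k + i)) (x (s k)) (Suc (N k))" for k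
  have node: "Y k (\<tau> k n) = x (s k + n)" if "n \<le> Suc (N k)" for k n
    using interpolation_node[of "H k" "\<lambda>i. x (s k + i)" "\<lambda>i. d (s k + i)" n "Suc (N k)"] that
    by (simp add: Y_def h(1) \<tau>_def step H_def)
  have slope: "(Y k v - Y k u) /\<^sub>R (v - u) \<in> Q"
    if "0 \<le> u" "u < v" "v \<le> 1" "convex Q"
      "\<And>i. i \<le> N k \<Longrightarrow> \<tau> k i < v \<Longrightarrow> u < \<tau> k (Suc i) \<Longrightarrow> d (s k + i) \<in> Q" for k u v Q
    unfolding Y_def
  proof (rule interpolation_slope_in_convex)
    show "v \<le> sum (H k) {..<Suc (N k)}" using N(2)[of k] that(3) unfolding \<tau>_def by linarith
  qed (use that H0 in \<open>auto simp: \<tau>_def less_Suc_eq_le\<close>)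
  have Ylip: "B-lipschitz_on {0..1} (Y k)" for k
  proof (rule lipschitz_on_leI)
    fix u v :: real assume uv: "u \<in> {0..1}" "v \<in> {0..1}" "u \<le> v"
    show "dist (Y k u) (Y k v) \<le> B * dist u v"
    proof (cases "u = v")
      case False
      then have "(Y k v - Y k u) /\<^sub>R (v - u) \<in> cball 0 B"
        using uv B by (intro slope) auto
      then have "norm (Y k v - Y k u) / (v - u) \<le> B" using uv False by (simp add: divide_inverse mult.commute)
      then show ?thesis using uv False by (simp add: dist_norm norm_minus_commute field_simps)
    qed simp
  qed (use B in simp)
  have Ybd: "norm (Y k u) \<le> Bx + B" if "u \<in> {0..1}" for k u
  proof -
    have "norm (Y k u - Y k 0) \<le> B * norm (u - 0)"
      using that by (intro lipschitz_on_normD[OF Ylip]) auto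
    also have "\<dots> \<le> B * 1" using that B by (intro mult_left_mono) auto
    finally have "norm (Y k u - Y k 0) \<le> B" by simp
    moreover have "norm (Y k 0) \<le> Bx" using node[of 0 k] Bx by (simp add: \<tau>0)
    ultimately show ?thesis using norm_triangle_ineq[of "Y k u - Y k 0" "Y k 0"] by simp
  qed
  have equi: "\<exists>d>0. \<forall>n v. v \<in> {0..1} \<and> norm (u - v) < d \<longrightarrow> norm (Y n u - Y n v) < e"
    if ue: "u \<in> {0..1}" "e > 0" for u e
  proof (intro exI[of _ "e / B"] conjI allI impI)
    fix n v assume v: "v \<in> {0..1} \<and> norm (u - v) < e / B"
    have "norm (Y n u - Y n v) \<le> B * norm (u - v)"
      using ue v by (intro lipschitz_on_normD[OF Ylip]) auto
    also have "\<dots> < B * (e / B)" using v B by (intro mult_strict_left_mono) auto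
    finally show "norm (Y n u - Y n v) < e" using B by simp
  qed (use ue B in simp)
  obtain y r where y: "continuous_on {0..1} y" "strict_mono (r :: nat \<Rightarrow> nat)"
     "\<And>e. 0 < e \<Longrightarrow> \<exists>N. \<forall>n u. n \<ge> N \<and> u \<in> {0..1} \<longrightarrow> norm (Y (r n) u - y u) < e"
    by (rule Arzela_Ascoli[of "{0..1::real}" Y "Bx + B"]) (use Ybd equi in \<open>blast intro: compact_Icc\<close>)+
  have pt: "(\<lambda>k. Y (r k) u) \<longlonglongrightarrow> y u" if "u \<in> {0..1}" for u
    unfolding LIMSEQ_iff using y(3) that by blast
  have ylip: "B-lipschitz_on {0..1} y"
  proof (rule lipschitz_onI)
    fix u v :: real assume uv: "u \<in> {0..1}" "v \<in> {0..1}"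
    have "(\<lambda>k. dist (Y (r k) u) (Y (r k) v)) \<longlonglongrightarrow> dist (y u) (y v)"
      using uv by (intro tendsto_dist pt)
    then show "dist (y u) (y v) \<le> B * dist u v"
      by (rule LIMSEQ_le_const2) (use lipschitz_onD[OF Ylip] uv in blast)
  qed (use B in simp)
  have sr: "filterlim (\<lambda>k. s (r k)) at_top sequentially"
    using filterlim_compose[OF s filterlim_subseq[OF y(2)]] .
  \<comment> \<open>Upper semicontinuity in quantifier form, from the sequential hypothesis:
    otherwise directions outside the neighbourhood would accumulate, by boundedness, at a point that
    \<open>incl\<close> places in \<open>F z\<close>.\<close>
  have near: "\<exists>\<rho>>0. \<exists>n0. \<forall>n\<ge>n0. norm (x n - z) < \<rho> \<longrightarrow> d n \<in> {a + b |a b. a \<in> F z \<and> b \<in> cball 0 \<epsilon>}"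
    if \<epsilon>: "\<epsilon> > 0" for \<epsilon> z
  proof (rule ccontr)
    define Q where "Q = {a + b |a b. a \<in> F z \<and> b \<in> cball 0 \<epsilon>}"
    assume "\<not> ?thesis"
    then have no: "\<not> (\<exists>\<rho>>0. \<exists>n0. \<forall>n\<ge>n0. norm (x n - z) < \<rho> \<longrightarrow> d n \<in> Q)" unfolding Q_def .
    have "\<exists>n\<ge>j. norm (x n - z) < inverse (real (Suc j)) \<and> d n \<notin> Q" for j
    proof -
      have "0 < inverse (real (Suc j))" by simp
      then show ?thesis using no by blast
    qed
    then have "\<exists>g. \<forall>j. g j \<ge> j \<and> norm (x (g j) - z) < inverse (real (Suc j)) \<and> d (g j) \<notin> Q"
      by (intro choice) blast
    then obtain g where g: "\<And>j. g j \<ge> j" "\<And>j. norm (x (g j) - z) < inverse (real (Suc j))"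
        "\<And>j. d (g j) \<notin> Q" by blast
    have "bounded (range (d \<circ> g))" using bd by (rule bounded_subset) auto
    then obtain w p where p: "strict_mono p" "(d \<circ> g \<circ> p) \<longlonglongrightarrow> w"
      using bounded_imp_convergent_subsequence by blast
    have "filterlim g at_top sequentially"
      using g(1) by (intro filterlim_at_top_mono[OF filterlim_ident]) auto
    then have "filterlim (\<lambda>k. g (p k)) at_top sequentially"
      using filterlim_compose filterlim_subseq[OF p(1)] by blast
    moreover have "(\<lambda>k. x (g k)) \<longlonglongrightarrow> z"
      by (rule LIM_zero_cancel, rule Lim_null_comparison[OF _ LIMSEQ_inverse_real_of_nat])
        (use g(2) in \<open>auto intro!: always_eventually less_imp_le\<close>)
    then have "(\<lambda>k. x (g (p k))) \<longlonglongrightarrow> z" using LIMSEQ_subseq_LIMSEQ[OF _ p(1)] by (auto simp: o_def)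
    ultimately have w: "w \<in> F z" using incl[of "\<lambda>k. g (p k)" z w] p(2) by (simp add: o_def)
    obtain k where "norm (d (g (p k)) - w) < \<epsilon>"
      using p(2) \<epsilon> unfolding LIMSEQ_iff o_def by blast
    then have "d (g (p k)) = w + (d (g (p k)) - w)" "d (g (p k)) - w \<in> cball 0 \<epsilon>" by auto
    with w g(3)[of "p k"] show False unfolding Q_def by blast
  qed
  have der: "D \<in> F (y u)" if u: "0 < u" "u < 1" and D: "(y has_vector_derivative D) (at u)" for u D
  proof -
    have "\<exists>a\<in>F (y u). dist a D < 2 * \<epsilon>" if \<epsilon>: "\<epsilon> > 0" for \<epsilon>
    proof -
      \<comment> \<open>The closed neighbourhood of radius \<open>\<epsilon>\<close> stays closed
        and convex, so it retains averages of directions near \<open>y u\<close> and the limits of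
        these averages.\<close>
      define Q where "Q = {a + b |a b. a \<in> F (y u) \<and> b \<in> cball 0 \<epsilon>}"
      have Q: "convex Q" "closed Q"
      proof -
        have "Q = (\<Union>a\<in>F (y u). \<Union>b\<in>cball 0 \<epsilon>. {a + b})" unfolding Q_def by blast
        then show "convex Q" "closed Q"
          using F[of "y u"] by (simp_all only: convex_sums convex_cball closed_compact_sums compact_cball)
      qed
      obtain \<rho> n0 where \<rho>: "\<rho> > 0" "\<And>n. n \<ge> n0 \<Longrightarrow> norm (x n - y u) < \<rho> \<Longrightarrow> d n \<in> Q"
        using near[OF \<epsilon>, of "y u"] unfolding Q_def by blast
      \<comment> \<open>Within time \<open>\<eta>\<close> of \<open>u\<close> the limit curve moves
        by at most \<rho> / 3; another \<rho> / 3 is spent on the uniform distance between polygon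
        and limit.\<close>
      define \<eta> where "\<eta> = min (\<rho> / (3 * B)) (min (u / 2) ((1 - u) / 2))"
      have \<eta>: "0 < \<eta>" "B * \<eta> \<le> \<rho> / 3" "\<eta> < u" "u + \<eta> < 1"
      proof -
        have "\<eta> \<le> \<rho> / (3 * B)" unfolding \<eta>_def by (rule min.cobounded1)
        moreover have "\<eta> \<le> u / 2" unfolding \<eta>_def by (rule min.coboundedI2) (rule min.cobounded1)
        moreover have "\<eta> \<le> (1 - u) / 2" unfolding \<eta>_def by (rule min.coboundedI2) (rule min.cobounded2)
        ultimately show "B * \<eta> \<le> \<rho> / 3" "\<eta> < u" "u + \<eta> < 1" using u B by (auto simp: field_simps)
        show "0 < \<eta>" using \<rho>(1) B(1) u by (simp add: \<eta>_def)
      qed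
      have quot: "(y v - y u) /\<^sub>R (v - u) \<in> Q" if v: "u < v" "v < u + \<eta>" for v
      proof -
        obtain k1 where k1: "\<And>n t. n \<ge> k1 \<Longrightarrow> t \<in> {0..1} \<Longrightarrow> norm (Y (r n) t - y t) < \<rho> / 3"
          using y(3)[of "\<rho> / 3"] \<rho>(1) by auto
        obtain k2 where k2: "\<And>k. k \<ge> k2 \<Longrightarrow> n0 \<le> s (r k)"
          using sr unfolding filterlim_at_top eventually_sequentially by blast
        \<comment> \<open>A step that overlaps [u, v] may begin before \<open>u\<close>; once steps
          are shorter than \<open>\<eta>\<close>, its node is still within \<open>\<eta>\<close> of
          \<open>u\<close>.\<close>
        obtain n3 where n3: "\<And>n. n \<ge> n3 \<Longrightarrow> h n < \<eta>"
          using order_tendstoD(2)[OF h(2) \<eta>(1)] by (auto simp: eventually_sequentially)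
        obtain k3 where k3: "\<And>k. k \<ge> k3 \<Longrightarrow> n3 \<le> s (r k)"
          using sr unfolding filterlim_at_top eventually_sequentially by blast
        have "(Y (r k) v - Y (r k) u) /\<^sub>R (v - u) \<in> Q" if k: "k \<ge> max k1 (max k2 k3)" for k
        proof (rule slope)
          fix i assume i: "i \<le> N (r k)" "\<tau> (r k) i < v" "u < \<tau> (r k) (Suc i)"
          have "\<tau> (r k) (Suc i) = \<tau> (r k) i + h (s (r k) + i)" by (simp add: \<tau>_def H_def)
          moreover have "h (s (r k) + i) < \<eta>" using n3[of "s (r k) + i"] k3[of k] k by simp
          ultimately have t: "\<bar>\<tau> (r k) i - u\<bar> < \<eta>" using i v by (auto simp: abs_less_iff)
          then have t1: "\<tau> (r k) i \<in> {0..1}" using \<eta> u by (auto simp: abs_less_iff)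
          have "norm (x (s (r k) + i) - y (\<tau> (r k) i)) < \<rho> / 3"
            using k1[of k "\<tau> (r k) i"] t1 k node[of i "r k"] i(1) by simp
          moreover have "norm (y (\<tau> (r k) i) - y u) \<le> B * \<bar>\<tau> (r k) i - u\<bar>"
            using lipschitz_on_normD[OF ylip t1, of u] u by simp
          moreover have "B * \<bar>\<tau> (r k) i - u\<bar> \<le> B * \<eta>" using t B by (intro mult_left_mono) auto
          ultimately have "norm (x (s (r k) + i) - y u) < \<rho>"
            using norm_triangle_ineq[of "x (s (r k) + i) - y (\<tau> (r k) i)" "y (\<tau> (r k) i) - y u"] \<eta>(2) \<rho>(1) by simp
          then show "d (s (r k) + i) \<in> Q" using \<rho>(2)[of "s (r k) + i"] k2[of k] k by simp
        qed (use u v \<eta> Q in auto)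
        moreover have "(\<lambda>k. (Y (r k) v - Y (r k) u) /\<^sub>R (v - u)) \<longlonglongrightarrow> (y v - y u) /\<^sub>R (v - u)"
          using u v \<eta> by (intro tendsto_intros pt) auto
        ultimately show ?thesis
          by (intro Lim_in_closed_set[OF Q(2) _ sequentially_bot])
            (auto intro!: eventually_sequentiallyI[of "max k1 (max k2 k3)"])
      qed
      define X where "X n = u + \<eta> / (real n + 2)" for n
      have X: "X n > u" "X n < u + \<eta>" for n
        using \<eta>(1) by (auto simp: X_def divide_less_eq)
      have "(\<lambda>n. \<eta> / (real n + 2)) \<longlonglongrightarrow> 0"
        using LIMSEQ_ignore_initial_segment[OF lim_const_over_n[of \<eta>], of 2] by (simp add: add.commute)
      then have "X \<longlonglongrightarrow> u" unfolding X_def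
        using tendsto_add[OF tendsto_const[of u]] by fastforce
      then have "(\<lambda>n. (y (X n) - y u) /\<^sub>R (X n - u)) \<longlonglongrightarrow> D"
        using X by (intro has_vector_derivative_seq[OF D]) auto
      then have "D \<in> Q"
        using quot X by (intro Lim_in_closed_set[OF Q(2) _ sequentially_bot]) auto
      then show ?thesis using \<epsilon> unfolding Q_def by (force simp: dist_norm)
    qed
    then have "\<forall>e>0. \<exists>a\<in>F (y u). dist a D < e" by (metis field_sum_of_halves half_gt_zero mult_2)
    then show ?thesis using F(1)[of "y u"] closed_approachable by blast
  qed
  have lim0: "(\<lambda>k. x (s (r k))) \<longlonglongrightarrow> y 0"
    using pt[of 0] node[of 0] by (simp add: \<tau>0)
  have lims: "\<exists>n. (\<forall>k. n k \<le> N (r k)) \<and> (\<lambda>k. x (s (r k) + n k)) \<longlonglongrightarrow> y u" if u: "u \<in> {0..1}" for u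
  proof -
    have "\<exists>n\<le>N k. \<tau> k n \<le> u \<and> u \<le> \<tau> k (Suc n)" for k
    proof (cases "u = 0")
      case True
      then show ?thesis using \<tau>0[of k] \<tau>mono[of 0 1 k] by (intro exI[of _ 0]) auto
    next
      case False
      have "\<not> u \<le> \<tau> k 0" "u \<le> \<tau> k (Suc (N k))" using False u \<tau>0[of k] N(2)[of k] by auto
      then obtain n where n: "\<tau> k n < u" "u \<le> \<tau> k (Suc n)"
        using ex_least_nat_less[of "\<lambda>n. u \<le> \<tau> k n"] by (metis linorder_not_less order_refl)
      have "n \<le> N k"
      proof (rule ccontr)
        assume "\<not> n \<le> N k"
        then have "\<tau> k (Suc (N k)) \<le> \<tau> k n" by (intro \<tau>mono) auto
        then show False using N(2)[of k] n u by auto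
      qed
      then show ?thesis using n by (auto intro!: exI[of _ n])
    qed
    then have "\<forall>k. \<exists>n\<le>N (r k). \<tau> (r k) n \<le> u \<and> u \<le> \<tau> (r k) (Suc n)" by blast
    then obtain n where n: "\<And>k. n k \<le> N (r k)" "\<And>k. \<tau> (r k) (n k) \<le> u" "\<And>k. u \<le> \<tau> (r k) (Suc (n k))"
      by metis
    have major: "(\<lambda>k. B * h (s (r k) + n k) + norm (Y (r k) u - y u)) \<longlonglongrightarrow> B * 0 + 0"
    proof (intro tendsto_intros)
      have "filterlim (\<lambda>k. s (r k) + n k) at_top sequentially"
        by (rule filterlim_at_top_mono[OF sr]) auto
      then show "(\<lambda>k. h (s (r k) + n k)) \<longlonglongrightarrow> 0" by (rule filterlim_compose[OF h(2)])
      show "(\<lambda>k. norm (Y (r k) u - y u)) \<longlonglongrightarrow> 0"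
        using pt[OF u] by (simp add: tendsto_norm_zero_iff LIM_zero_iff)
    qed
    have minor: "norm (x (s (r k) + n k) - y u) \<le> B * h (s (r k) + n k) + norm (Y (r k) u - y u)" for k
    proof -
      let ?t = "\<tau> (r k) (n k)"
      have t: "0 \<le> ?t" "?t \<le> u" "u \<le> ?t + h (s (r k) + n k)"
        using n(2,3)[of k] \<tau>mono[of 0 "n k" "r k"] by (auto simp: \<tau>_def H_def)
      have "norm (Y (r k) ?t - Y (r k) u) \<le> B * norm (?t - u)"
        using t u by (intro lipschitz_on_normD[OF Ylip]) auto
      also have "\<dots> \<le> B * h (s (r k) + n k)" using t B by (intro mult_left_mono) auto
      finally show ?thesis
        using norm_triangle_ineq[of "Y (r k) ?t - Y (r k) u" "Y (r k) u - y u"] node[of "n k" "r k"] n(1)[of k] by simp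
    qed
    have "(\<lambda>k. x (s (r k) + n k) - y u) \<longlonglongrightarrow> 0"
      by (rule Lim_null_comparison[OF always_eventually[OF allI[OF minor]]]) (use major in simp)
    then have "(\<lambda>k. x (s (r k) + n k)) \<longlonglongrightarrow> y u" by (rule LIM_zero_cancel)
    then show ?thesis using n(1) by (intro exI[of _ n]) simp
  qed
  have close: "\<exists>k0. \<forall>k\<ge>k0. \<forall>n\<le>N (r k). \<exists>u\<in>{0..1}. norm (x (s (r k) + n) - y u) < \<epsilon>" if \<epsilon>: "\<epsilon> > 0" for \<epsilon>
  proof -
    obtain k0 where k0: "\<And>n t. n \<ge> k0 \<Longrightarrow> t \<in> {0..1} \<Longrightarrow> norm (Y (r n) t - y t) < \<epsilon>"
      using y(3)[OF \<epsilon>] by auto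
    have "\<exists>u\<in>{0..1}. norm (x (s (r k) + n) - y u) < \<epsilon>" if "k \<ge> k0" "n \<le> N (r k)" for k n
    proof -
      have "\<tau> (r k) n \<in> {0..1}"
        using \<tau>mono[of 0 n "r k"] \<tau>mono[of n "N (r k)" "r k"] N(1)[of "r k"] that by (auto simp: \<tau>0)
      then show ?thesis using k0[of k "\<tau> (r k) n"] that node[of n "r k"] by auto
    qed
    then show ?thesis by blast
  qed
  show ?thesis by (rule that[OF y(2) ylip der lim0 lims close])
qed

text \<open>The elapsed time is rescaled to 1 and \<open>T\<close> multiplies the right-hand side,
  matching the unit interval in \<open>conservative_field\<close>. The inclusion is imposed at every
  interior point of differentiability, hence almost everywhere by the Lipschitz bound.\<close>

definition trajectory :: "('a \<Rightarrow> 'a set) \<Rightarrow> 'a set \<Rightarrow> real \<Rightarrow> (real \<Rightarrow> 'a::euclidean_space) \<Rightarrow> bool" where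
  "trajectory F X T y \<longleftrightarrow> (\<exists>L. L-lipschitz_on {0..1} y) \<and> y ` {0..1} \<subseteq> X \<and>
     (\<forall>u D. 0 < u \<longrightarrow> u < 1 \<longrightarrow> (y has_vector_derivative D) (at u) \<longrightarrow> D \<in> (*\<^sub>R) T ` F (y u))"

text \<open>Transfers facts proved for the endpoint of trajectories of every duration to
  intermediate times.\<close>

lemma trajectory_restrict:
  assumes y: "trajectory F X T y" and a: "0 < a" "a \<le> 1"
  shows "trajectory F X (a * T) (\<lambda>u. y (a * u))"
  unfolding trajectory_def
proof (intro conjI allI impI)
  obtain L where L: "L-lipschitz_on {0..1} y" using y by (auto simp: trajectory_def)
  have "(L * a)-lipschitz_on {0..1} (y \<circ> (\<lambda>u. a * u))"
  proof (rule lipschitz_on_compose)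
    show "a-lipschitz_on {0..1} ((*) a)"
      using a by (intro lipschitz_onI) (auto simp: dist_real_def abs_mult simp flip: right_diff_distrib)
    show "L-lipschitz_on ((*) a ` {0..1}) y"
      using a by (intro lipschitz_on_subset[OF L]) (auto simp: mult_le_one)
  qed
  then show "\<exists>L. L-lipschitz_on {0..1} (\<lambda>u. y (a * u))" by (auto simp: o_def)
  show "(\<lambda>u. y (a * u)) ` {0..1} \<subseteq> X"
    using y a by (auto simp: trajectory_def image_subset_iff mult_le_one)
  fix u D assume u: "0 < u" "u < 1" and D: "((\<lambda>u. y (a * u)) has_vector_derivative D) (at u)"
  have au: "0 < a * u" "a * u < 1" using a u by (auto simp: mult_less_le_imp_less mult_le_one)
     (metis a(2) mult_left_le_one_le less_imp_le order_le_less_trans)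
  have "(((\<lambda>u. y (a * u)) \<circ> (\<lambda>v. v / a)) has_vector_derivative (1 / a) *\<^sub>R D) (at (a * u))"
    using a D by (intro vector_diff_chain_at) (auto intro!: derivative_eq_intros)
  moreover have "((\<lambda>u. y (a * u)) \<circ> (\<lambda>v. v / a)) = y" using a by (auto simp: o_def)
  ultimately have "(1 / a) *\<^sub>R D \<in> (*\<^sub>R) T ` F (y (a * u))"
    using y au by (auto simp: trajectory_def)
  then obtain w where w: "w \<in> F (y (a * u))" "(1 / a) *\<^sub>R D = T *\<^sub>R w" by blast
  have "D = a *\<^sub>R ((1 / a) *\<^sub>R D)" using a by simp
  then have "D = (a * T) *\<^sub>R w" using w(2) by simp
  then show "D \<in> (*\<^sub>R) (a * T) ` F (y (a * u))" using w(1) by blast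
qed

text \<open>A perturbed Euler scheme. \<open>d n\<close> need not lie in \<open>F (x n)\<close>; the
  inclusion is imposed on joint limits of states and directions, so vanishing perturbations of the
  directions are absorbed by \<open>incl\<close>.\<close>

locale asymptotic_inclusion =
  fixes x d :: "nat \<Rightarrow> 'a::euclidean_space" and h :: "nat \<Rightarrow> real"
    and F :: "'a \<Rightarrow> 'a set" and X :: "'a set"
  assumes h_pos: "\<And>n. 0 < h n" and h_lim: "h \<longlonglongrightarrow> 0"
    and h_sum: "filterlim (\<lambda>n. sum h {..<n}) at_top sequentially"
    and step: "\<And>n. x (Suc n) = x n + h n *\<^sub>R d n"
    and d_bounded: "bounded (range d)"
    and X_compact: "compact X" and x_in: "\<And>n. x n \<in> X"
    and F_closed: "\<And>z. closed (F z)" and F_convex: "\<And>z. convex (F z)"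
    and incl: "\<And>m z w. filterlim m at_top sequentially \<Longrightarrow> (\<lambda>k. x (m k)) \<longlonglongrightarrow> z \<Longrightarrow>
      (\<lambda>k. d (m k)) \<longlonglongrightarrow> w \<Longrightarrow> w \<in> F z"
begin

definition limit_set :: "'a set" where
  "limit_set = {z. \<exists>m. filterlim m at_top sequentially \<and> (\<lambda>k. x (m k)) \<longlonglongrightarrow> z}"

lemma limit_set_subset: "limit_set \<subseteq> X"
proof
  fix z assume "z \<in> limit_set"
  then obtain m where "(\<lambda>k. x (m k)) \<longlonglongrightarrow> z" by (auto simp: limit_set_def)
  then show "z \<in> X"
    using x_in by (intro Lim_in_closed_set[OF compact_imp_closed[OF X_compact] _ sequentially_bot]) auto
qed

lemma limit_set_level:
  assumes E: "continuous_on X E" and lim: "(\<lambda>n. E (x n)) \<longlonglongrightarrow> (c::real)" and z: "z \<in> limit_set"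
  shows "E z = c"
proof -
  obtain m where m: "filterlim m at_top sequentially" "(\<lambda>k. x (m k)) \<longlonglongrightarrow> z"
    using z by (auto simp: limit_set_def)
  have "(\<lambda>k. E (x (m k))) \<longlonglongrightarrow> E z"
    using continuous_on_tendsto_compose[OF E m(2)] limit_set_subset z x_in by auto
  moreover have "(\<lambda>k. E (x (m k))) \<longlonglongrightarrow> c" by (rule filterlim_compose[OF lim m(1)])
  ultimately show ?thesis using LIMSEQ_unique by blast
qed

text \<open>Dividing the steps by \<open>T\<close> and multiplying the directions by
  \<open>T\<close> leaves the iterates unchanged and turns a window of length \<open>T\<close> into
  one of length 1. Every point of the curve is a limit of iterates with indices tending to infinity,
  hence lies in \<open>limit_set\<close>.\<close>

lemma limit_trajectory:
  assumes T: "0 < T" and s: "filterlim s at_top sequentially"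
  obtains r y N where "strict_mono (r :: nat \<Rightarrow> nat)" "trajectory F limit_set T y"
    "(\<lambda>k. x (s (r k))) \<longlonglongrightarrow> y 0"
    "\<And>u. u \<in> {0..1} \<Longrightarrow> \<exists>n. (\<forall>k. n k \<le> N k) \<and> (\<lambda>k. x (s (r k) + n k)) \<longlonglongrightarrow> y u"
    "\<And>\<epsilon>. \<epsilon> > 0 \<Longrightarrow> \<exists>k0. \<forall>k\<ge>k0. \<forall>n\<le>N k. \<exists>u\<in>{0..1}. norm (x (s (r k) + n) - y u) < \<epsilon>"
proof -
  have 1: "0 < h n / T" for n using h_pos T by simp
  have 2: "(\<lambda>n. h n / T) \<longlonglongrightarrow> 0" using tendsto_divide[OF h_lim tendsto_const[of T]] T by simp
  have 3: "filterlim (\<lambda>n. sum (\<lambda>i. h i / T) {..<n}) at_top sequentially"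
  proof -
    have "filterlim (\<lambda>n. (1 / T) * sum h {..<n}) at_top sequentially"
      using T by (intro filterlim_tendsto_pos_mult_at_top[OF tendsto_const _ h_sum]) auto
    then show ?thesis by (simp add: sum_divide_distrib)
  qed
  have 4: "x (Suc n) = x n + (h n / T) *\<^sub>R (T *\<^sub>R d n)" for n using step T by simp
  have 5: "bounded (range x)" using compact_imp_bounded[OF X_compact] x_in by (auto intro: bounded_subset)
  have 6: "bounded (range (\<lambda>n. T *\<^sub>R d n))" using bounded_scaling[OF d_bounded, of T] by (simp add: image_image)
  have 7: "closed ((*\<^sub>R) T ` F z)" for z by (intro closed_scaling F_closed)
  have 8: "convex ((*\<^sub>R) T ` F z)" for z by (intro convex_scaling F_convex)
  have 9: "w \<in> (*\<^sub>R) T ` F z"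
    if "filterlim m at_top sequentially" "(\<lambda>k. x (m k)) \<longlonglongrightarrow> z" "(\<lambda>k. T *\<^sub>R d (m k)) \<longlonglongrightarrow> w" for m z w
  proof -
    have "(\<lambda>k. (1 / T) *\<^sub>R (T *\<^sub>R d (m k))) \<longlonglongrightarrow> (1 / T) *\<^sub>R w"
      using that(3) by (intro tendsto_intros)
    then have "(\<lambda>k. d (m k)) \<longlonglongrightarrow> (1 / T) *\<^sub>R w" using T by simp
    then have "(1 / T) *\<^sub>R w \<in> F z" using incl that by blast
    moreover have "w = T *\<^sub>R ((1 / T) *\<^sub>R w)" using T by simp
    ultimately show ?thesis by blast
  qed
  obtain r L y N where r: "strict_mono (r :: nat \<Rightarrow> nat)" "L-lipschitz_on {0..1} y"
    "\<And>u D. 0 < u \<Longrightarrow> u < 1 \<Longrightarrow> (y has_vector_derivative D) (at u) \<Longrightarrow> D \<in> (*\<^sub>R) T ` F (y u)"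
    "(\<lambda>k. x (s (r k))) \<longlonglongrightarrow> y 0"
    "\<And>u. u \<in> {0..1} \<Longrightarrow> \<exists>n. (\<forall>k. n k \<le> N k) \<and> (\<lambda>k. x (s (r k) + n k)) \<longlonglongrightarrow> y u"
    "\<And>\<epsilon>. \<epsilon> > 0 \<Longrightarrow> \<exists>k0. \<forall>k\<ge>k0. \<forall>n\<le>N k. \<exists>u\<in>{0..1}. norm (x (s (r k) + n) - y u) < \<epsilon>"
    by (rule limit_trajectory_unit[OF 1 2 3 4 5 6 7 8 9 s]) blast+
  have "y u \<in> limit_set" if u: "u \<in> {0..1}" for u
  proof -
    obtain n where "(\<lambda>k. x (s (r k) + n k)) \<longlonglongrightarrow> y u" using r(5)[OF u] by blast
    moreover have "filterlim (\<lambda>k. s (r k) + n k) at_top sequentially"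
      using filterlim_compose[OF s filterlim_subseq[OF r(1)]] by (rule filterlim_at_top_mono) auto
    ultimately show ?thesis unfolding limit_set_def by blast
  qed
  then have "trajectory F limit_set T y" using r(2,3) by (auto simp: trajectory_def)
  then show ?thesis using that r(1,4,5,6) by blast
qed

text \<open>Near a level \<open>c\<close> outside \<open>C\<close> the iterates shadow a limit curve
  that starts at a point of value \<open>c\<close>, never rises above \<open>c\<close> and ends
  strictly below it. Uniform continuity of \<open>E\<close> passes this to the iterates, which is
  the descent demanded of scalar sequences. The duration may depend on the starting point.\<close>

lemma lyapunov_convergence:
  assumes E: "continuous_on X E" and C: "interior C = {}"
    and mono: "\<And>T y. 0 < T \<Longrightarrow> trajectory F limit_set T y \<Longrightarrow> E (y 1) \<le> E (y 0)"
    and strict: "\<And>z. z \<in> limit_set \<Longrightarrow> E z \<notin> C \<Longrightarrow>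
      \<exists>T>0. \<forall>y. trajectory F limit_set T y \<longrightarrow> y 0 = z \<longrightarrow> E (y 1) < E (y 0)"
  shows "\<exists>c\<in>C. (\<lambda>n. E (x n)) \<longlonglongrightarrow> (c::real)"
proof (rule convergent_if_descending[OF _ _ C])
  have "bounded (E ` X)" using E X_compact compact_continuous_image compact_imp_bounded by blast
  then show "bounded (range (\<lambda>n. E (x n)))" by (rule bounded_subset) (use x_in in auto)
  have uc: "uniformly_continuous_on X E" using E X_compact compact_uniformly_continuous by blast
  obtain B where B: "\<And>n. norm (d n) \<le> B" using d_bounded by (auto simp: bounded_iff)
  have "(\<lambda>n. h n *\<^sub>R d n) \<longlonglongrightarrow> 0"
  proof (rule Lim_null_comparison)
    show "\<forall>\<^sub>F n in sequentially. norm (h n *\<^sub>R d n) \<le> h n * B"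
      using B h_pos by (auto intro!: always_eventually mult_left_mono simp: less_imp_le)
    show "(\<lambda>n. h n * B) \<longlonglongrightarrow> 0" using tendsto_mult[OF h_lim tendsto_const[of B]] by simp
  qed
  then have "(\<lambda>n. dist (x (Suc n)) (x n)) \<longlonglongrightarrow> 0"
    using tendsto_norm_zero by (fastforce simp: dist_norm step)
  then have "(\<lambda>n. dist (E (x (Suc n))) (E (x n))) \<longlonglongrightarrow> 0"
    using uc x_in unfolding uniformly_continuous_on_sequentially by simp
  then show "(\<lambda>n. E (x (Suc n)) - E (x n)) \<longlonglongrightarrow> 0"
    by (simp add: dist_norm tendsto_rabs_zero_iff)
  fix s c assume s: "strict_mono s" "((\<lambda>n. E (x n)) \<circ> s) \<longlonglongrightarrow> c" "c \<notin> C"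
  obtain z p where z: "z \<in> X" and p0: "strict_mono (p :: nat \<Rightarrow> nat)" "((\<lambda>k. x (s k)) \<circ> p) \<longlonglongrightarrow> z"
    using X_compact[unfolded compact_def, rule_format, of "\<lambda>k. x (s k)"] x_in by blast
  then have p: "strict_mono p" "(\<lambda>k. x (s (p k))) \<longlonglongrightarrow> z" by (simp_all add: o_def)
  have "(\<lambda>k. E (x (s (p k)))) \<longlonglongrightarrow> E z"
    using continuous_on_tendsto_compose[OF E p(2) z] x_in by simp
  moreover have "(\<lambda>k. E (x (s (p k)))) \<longlonglongrightarrow> c" using LIMSEQ_subseq_LIMSEQ[OF s(2) p(1)] by (simp add: o_def)
  ultimately have Ez: "E z = c" using LIMSEQ_unique by blast
  have sp: "filterlim (\<lambda>k. s (p k)) at_top sequentially"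
    using filterlim_compose[OF filterlim_subseq[OF s(1)] filterlim_subseq[OF p(1)]] .
  have zl: "z \<in> limit_set" unfolding limit_set_def using sp p(2) by blast
  obtain T where T: "T > 0" "\<And>y. trajectory F limit_set T y \<Longrightarrow> y 0 = z \<Longrightarrow> E (y 1) < E (y 0)"
    using strict[OF zl] s(3) Ez by blast
  obtain r y N where r: "strict_mono (r :: nat \<Rightarrow> nat)" and y: "trajectory F limit_set T y"
    and y0: "(\<lambda>k. x (s (p (r k)))) \<longlonglongrightarrow> y 0"
    and lims: "\<And>u. u \<in> {0..1} \<Longrightarrow> \<exists>n. (\<forall>k. n k \<le> N k) \<and> (\<lambda>k. x (s (p (r k)) + n k)) \<longlonglongrightarrow> y u"
    and close: "\<And>\<epsilon>. \<epsilon> > 0 \<Longrightarrow> \<exists>k0. \<forall>k\<ge>k0. \<forall>n\<le>N k. \<exists>u\<in>{0..1}. norm (x (s (p (r k)) + n) - y u) < \<epsilon>"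
    by (rule limit_trajectory[OF T(1) sp]) blast
  have yz: "y 0 = z"
    using LIMSEQ_unique[OF y0] LIMSEQ_subseq_LIMSEQ[OF p(2) r] by (simp add: o_def)
  have yX: "y u \<in> X" if "u \<in> {0..1}" for u
    using y that limit_set_subset unfolding trajectory_def by blast
  \<comment> \<open>Intermediate times are endpoints of shortened trajectories, to which
    \<open>mono\<close> applies.\<close>
  have le: "E (y u) \<le> c" if u: "u \<in> {0..1}" for u
  proof (cases "u = 0")
    case False
    then have "0 < u" "u \<le> 1" using u by auto
    from mono[OF _ trajectory_restrict[OF y this]] show ?thesis using \<open>0 < u\<close> T yz Ez by simp
  qed (use yz Ez in simp)
  \<comment> \<open>Half of the drop along the curve; the other half pays for the distance between
    iterates and curve.\<close>
  define \<delta> where "\<delta> = (c - E (y 1)) / 2"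
  have \<delta>: "\<delta> > 0" using T(2)[OF y yz] yz Ez by (simp add: \<delta>_def)
  obtain n where n: "\<And>k. n k \<le> N k" "(\<lambda>k. x (s (p (r k)) + n k)) \<longlonglongrightarrow> y 1" using lims[of 1] by auto
  show "\<exists>\<delta>>0. \<forall>\<epsilon>>0. \<forall>k0. \<exists>k\<ge>k0. \<exists>n\<ge>s k. E (x n) \<le> c - \<delta> \<and> (\<forall>m. s k \<le> m \<and> m \<le> n \<longrightarrow> E (x m) \<le> c + \<epsilon>)"
  proof (intro exI[of _ \<delta>] conjI allI impI \<delta>)
    fix \<epsilon> :: real and k0 :: nat assume \<epsilon>: "\<epsilon> > 0"
    obtain \<rho> where \<rho>: "\<rho> > 0" "\<And>a b. a \<in> X \<Longrightarrow> b \<in> X \<Longrightarrow> dist a b < \<rho> \<Longrightarrow> dist (E a) (E b) < min \<epsilon> \<delta>"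
      using uc \<epsilon> \<delta> unfolding uniformly_continuous_on_def by (metis min_less_iff_conj)
    obtain k1 where k1: "\<And>k n. k \<ge> k1 \<Longrightarrow> n \<le> N k \<Longrightarrow> \<exists>u\<in>{0..1}. norm (x (s (p (r k)) + n) - y u) < \<rho>"
      using close[OF \<rho>(1)] by blast
    obtain k2 where k2: "\<And>k. k \<ge> k2 \<Longrightarrow> dist (x (s (p (r k)) + n k)) (y 1) < \<rho>"
      using n(2) \<rho>(1) unfolding lim_sequentially by blast
    define k where "k = max k0 (max k1 k2)"
    have "k0 \<le> p (r k)"
      using seq_suble[OF r, of k] seq_suble[OF p(1), of "r k"] by (simp add: k_def)
    moreover have "E (x (s (p (r k)) + n k)) \<le> c - \<delta>"
    proof -
      have "dist (E (x (s (p (r k)) + n k))) (E (y 1)) < min \<epsilon> \<delta>"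
        by (intro \<rho>(2) x_in yX k2) (auto simp: k_def)
      moreover have "c - \<delta> = E (y 1) + \<delta>" by (simp add: \<delta>_def field_simps)
      ultimately show ?thesis by (simp add: dist_real_def abs_less_iff)
    qed
    moreover have "E (x m) \<le> c + \<epsilon>" if m: "s (p (r k)) \<le> m" "m \<le> s (p (r k)) + n k" for m
    proof -
      define j where "j = m - s (p (r k))"
      have j: "m = s (p (r k)) + j" "j \<le> N k" using m n(1)[of k] by (auto simp: j_def)
      obtain u where u: "u \<in> {0..1}" "norm (x m - y u) < \<rho>"
      proof -
        have "k1 \<le> k" by (simp add: k_def)
        from k1[OF this j(2)] show ?thesis using that j(1) by auto
      qed
      have "dist (E (x m)) (E (y u)) < min \<epsilon> \<delta>"
        using u by (intro \<rho>(2) x_in yX) (auto simp: dist_norm)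
      then show ?thesis using le[OF u(1)] by (auto simp: dist_real_def abs_less_iff)
    qed
    ultimately show "\<exists>k\<ge>k0. \<exists>n\<ge>s k. E (x n) \<le> c - \<delta> \<and> (\<forall>m. s k \<le> m \<and> m \<le> n \<longrightarrow> E (x m) \<le> c + \<epsilon>)"
      by (intro exI[of _ "p (r k)"] conjI exI[of _ "s (p (r k)) + n k"]) auto
  qed
qed

lemma limit_set_trajectory:
  assumes z: "z \<in> limit_set" and T: "0 < T"
  obtains y where "trajectory F limit_set T y" "y 0 = z"
proof -
  obtain s where s: "filterlim s at_top sequentially" "(\<lambda>k. x (s k)) \<longlonglongrightarrow> z"
    using z by (auto simp: limit_set_def)
  obtain r y where r: "strict_mono (r :: nat \<Rightarrow> nat)" and y: "trajectory F limit_set T y"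
    and y0: "(\<lambda>k. x (s (r k))) \<longlonglongrightarrow> y 0"
    by (rule limit_trajectory[OF T s(1)]) blast
  have "y 0 = z"
    using LIMSEQ_unique[OF y0] LIMSEQ_subseq_LIMSEQ[OF s(2) r] by (simp add: o_def)
  then show ?thesis using that y by blast
qed

lemma cluster_point_extend:
  assumes s: "strict_mono s"
  obtains p z where "strict_mono (p :: nat \<Rightarrow> nat)" "(\<lambda>k. x (s (p k))) \<longlonglongrightarrow> z" "z \<in> limit_set"
proof -
  obtain z p where p: "strict_mono (p :: nat \<Rightarrow> nat)" "((\<lambda>k. x (s k)) \<circ> p) \<longlonglongrightarrow> z"
    using X_compact[unfolded compact_def, rule_format, of "\<lambda>k. x (s k)"] x_in by blast
  then have "(\<lambda>k. x (s (p k))) \<longlonglongrightarrow> z" by (simp add: o_def)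
  moreover have "filterlim (\<lambda>k. s (p k)) at_top sequentially"
    using filterlim_compose[OF filterlim_subseq[OF s] filterlim_subseq[OF p(1)]] .
  ultimately show ?thesis using that[of p z] p(1) unfolding limit_set_def by blast
qed

end

section \<open>The nuclear norm and inexact polar factors\<close>

text \<open>The unit ball of the operator norm, written as an intersection of closed half-spaces;
  closedness and convexity are immediate in this form.\<close>

definition spectral_ball :: "(real^'n^'m) set" where
  "spectral_ball = {Q. \<forall>x y. inner y (Q *v x) \<le> norm x * norm y}"

text \<open>By duality with the operator norm this is the sum of the singular values. As the support
  function of a compact set it has maximizers, which serve as its subgradients.\<close>

definition nuclear_norm :: "real^'n^'m \<Rightarrow> real" where
  "nuclear_norm X = (SUP Q\<in>spectral_ball. inner Q X)"

lemma norm_matrix_vector_le: "norm (A *v x) \<le> norm (A :: real^'n^'m) * norm x"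
proof -
  have "norm (A *v x) \<le> L2_set (\<lambda>i. norm (A $ i) * norm x) UNIV"
    unfolding norm_vec_def[of "A *v x"]
    by (intro L2_set_mono) (auto simp: matrix_vector_mul_component Cauchy_Schwarz_ineq2)
  also have "\<dots> = norm A * norm x" by (simp add: norm_vec_def L2_set_left_distrib)
  finally show ?thesis .
qed

lemma closed_spectral_ball: "closed spectral_ball"
  unfolding spectral_ball_def inner_vec_def matrix_vector_mult_def
  by (intro closed_Collect_all closed_Collect_le) (auto intro!: continuous_intros)

lemma convex_spectral_ball: "convex spectral_ball"
proof (rule convexI)
  fix P Q :: "real^'n^'m" and u v :: real
  assume PQ: "P \<in> spectral_ball" "Q \<in> spectral_ball" and uv: "0 \<le> u" "0 \<le> v" "u + v = 1"
  have "inner y ((u *\<^sub>R P + v *\<^sub>R Q) *v x) \<le> norm x * norm y" for x y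
  proof -
    have "inner y ((u *\<^sub>R P + v *\<^sub>R Q) *v x) = u * inner y (P *v x) + v * inner y (Q *v x)"
      by (simp add: matrix_vector_mult_add_rdistrib scaleR_matrix_vector_assoc[symmetric] inner_add_right)
    also have "\<dots> \<le> u * (norm x * norm y) + v * (norm x * norm y)"
      using PQ uv by (intro add_mono mult_left_mono) (auto simp: spectral_ball_def)
    also have "\<dots> = norm x * norm y" using uv(3) by (simp flip: distrib_right)
    finally show ?thesis .
  qed
  then show "u *\<^sub>R P + v *\<^sub>R Q \<in> spectral_ball" by (simp add: spectral_ball_def)
qed

text \<open>Coordinate vectors, one of them also with a minus sign, bound every entry by 1. The
  constant is crude, but it enters only through boundedness and Lipschitz continuity.\<close>

lemma norm_le_if_spectral_ball:
  fixes Q :: "real^'n^'m"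
  assumes "Q \<in> spectral_ball"
  shows "norm Q \<le> real CARD('m) * real CARD('n)"
proof -
  have entry: "\<bar>Q $ i $ j\<bar> \<le> 1" for i j
  proof -
    have eq: "Q $ i $ j = inner (axis i 1) (Q *v axis j 1)"
      by (simp add: inner_axis' matrix_vector_mult_basis column_def)
    have "inner (axis i 1) (Q *v axis j 1) \<le> 1"
      using assms by (auto simp: spectral_ball_def dest!: spec[of _ "axis j 1"] spec[of _ "axis i 1"])
    moreover have "- 1 \<le> inner (axis i 1) (Q *v axis j 1)"
      using assms by (auto simp: spectral_ball_def dest!: spec[of _ "axis j 1"] spec[of _ "- axis i 1"])
    ultimately show ?thesis unfolding eq by (simp add: abs_le_iff)
  qed
  have row: "norm (Q $ i) \<le> real CARD('n)" for i
  proof -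
    have "norm (Q $ i) \<le> (\<Sum>j\<in>UNIV. \<bar>Q $ i $ j\<bar>)" by (rule norm_le_l1_cart)
    also have "\<dots> \<le> (\<Sum>j\<in>(UNIV::'n set). 1)" by (intro sum_mono entry)
    finally show ?thesis by simp
  qed
  have "norm Q \<le> (\<Sum>i\<in>UNIV. norm (Q $ i))"
    unfolding norm_vec_def[of Q] by (rule L2_set_le_sum) simp
  also have "\<dots> \<le> (\<Sum>i\<in>(UNIV::'m set). real CARD('n))" by (intro sum_mono row)
  finally show ?thesis by simp
qed

lemma compact_spectral_ball: "compact (spectral_ball :: (real^'n^'m) set)"
proof -
  have "bounded (spectral_ball :: (real^'n^'m) set)"
    using norm_le_if_spectral_ball by (auto simp: bounded_iff)
  then show ?thesis using closed_spectral_ball compact_eq_bounded_closed by blast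
qed

lemma zero_in_spectral_ball: "0 \<in> spectral_ball"
  by (simp add: spectral_ball_def)

lemma nuclear_norm_upper: "Q \<in> spectral_ball \<Longrightarrow> inner Q X \<le> nuclear_norm X"
proof -
  assume Q: "Q \<in> spectral_ball"
  have "continuous_on spectral_ball (\<lambda>Q. inner Q X)" by (intro continuous_intros)
  then have "bdd_above ((\<lambda>Q. inner Q X) ` spectral_ball)"
    by (intro bounded_imp_bdd_above compact_imp_bounded compact_continuous_image compact_spectral_ball)
  then show ?thesis unfolding nuclear_norm_def using Q by (intro cSUP_upper)
qed

lemma nuclear_norm_attained:
  fixes X :: "real^'n^'m"
  obtains Q where "Q \<in> spectral_ball" "inner Q X = nuclear_norm X"
proof -
  obtain Q where Q: "Q \<in> spectral_ball" "\<And>P. P \<in> spectral_ball \<Longrightarrow> inner P X \<le> inner Q X"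
  proof -
    have "continuous_on spectral_ball (\<lambda>Q. inner Q X)" by (intro continuous_intros)
    moreover have "spectral_ball \<noteq> ({} :: (real^'n^'m) set)" using zero_in_spectral_ball by blast
    ultimately show ?thesis
      using continuous_attains_sup[OF compact_spectral_ball, of "\<lambda>Q. inner Q X"] that by blast
  qed
  have "nuclear_norm X \<le> inner Q X"
    unfolding nuclear_norm_def using Q zero_in_spectral_ball by (intro cSUP_least) auto
  with nuclear_norm_upper[OF Q(1), of X] show ?thesis using that[OF Q(1)] by simp
qed

text \<open>A maximizer for one matrix is a competitor for the other.\<close>

lemma nuclear_norm_lipschitz:
  fixes X Y :: "real^'n^'m"
  shows "\<bar>nuclear_norm X - nuclear_norm Y\<bar> \<le> real CARD('m) * real CARD('n) * norm (X - Y)"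
proof -
  have "nuclear_norm X - nuclear_norm Y \<le> real CARD('m) * real CARD('n) * norm (X - Y)" for X Y :: "real^'n^'m"
  proof -
    obtain Q where Q: "Q \<in> spectral_ball" "inner Q X = nuclear_norm X" by (rule nuclear_norm_attained)
    have "nuclear_norm X - nuclear_norm Y \<le> inner Q (X - Y)"
      using nuclear_norm_upper[OF Q(1), of Y] Q(2) by (simp add: inner_diff_right)
    also have "\<dots> \<le> norm Q * norm (X - Y)" by (rule norm_cauchy_schwarz)
    also have "\<dots> \<le> real CARD('m) * real CARD('n) * norm (X - Y)"
      using norm_le_if_spectral_ball[OF Q(1)] by (intro mult_right_mono) auto
    finally show ?thesis .
  qed
  from this[of X Y] this[of Y X] show ?thesis by (simp add: abs_le_iff norm_minus_commute)
qed

text \<open>The operator norm is at most the Frobenius norm, so the normalized matrix competes in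
  the supremum.\<close>

lemma norm_le_nuclear_norm: "norm X \<le> nuclear_norm X"
proof (cases "X = 0")
  case True
  then show ?thesis using nuclear_norm_upper[OF zero_in_spectral_ball, of X] by simp
next
  case False
  have "inner y ((X /\<^sub>R norm X) *v x) \<le> norm x * norm y" for x y
  proof -
    have "inner y ((X /\<^sub>R norm X) *v x) = inner y (X *v x) / norm X"
      by (simp add: scaleR_matrix_vector_assoc[symmetric] divide_inverse mult.commute)
    also have "inner y (X *v x) \<le> norm y * (norm X * norm x)"
      using norm_cauchy_schwarz[of y "X *v x"] norm_matrix_vector_le[of X x]
      by (meson mult_left_mono norm_ge_zero order_trans)
    then have "inner y (X *v x) / norm X \<le> norm y * (norm X * norm x) / norm X"
      by (intro divide_right_mono) auto
    also have "\<dots> = norm x * norm y" using False by simp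
    finally show ?thesis .
  qed
  then have "X /\<^sub>R norm X \<in> spectral_ball" by (simp add: spectral_ball_def)
  from nuclear_norm_upper[OF this, of X] show ?thesis
    using False by (simp add: dot_square_norm power2_eq_square) (simp add: field_simps)
qed

lemma nuclear_norm_nonneg: "0 \<le> nuclear_norm X"
  by (rule order_trans[OF norm_ge_zero norm_le_nuclear_norm])

lemma nuclear_norm_zero [simp]: "nuclear_norm 0 = 0"
  by (metis inner_zero_right nuclear_norm_attained)

section \<open>Factorizations with orthonormal columns and inexact polar factors\<close>

lemma usv_mult: "usv r U s V *v x = (\<Sum>j<r. (s j * inner (V j) x) *\<^sub>R U j)"
proof (rule vec_eq_iff[THEN iffD2, rule_format])
  fix i
  have "(usv r U s V *v x) $ i = (\<Sum>k\<in>UNIV. \<Sum>j<r. U j $ i * s j * V j $ k * x $ k)"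
    by (simp add: matrix_vector_mult_def usv_def sum_distrib_right)
  also have "\<dots> = (\<Sum>j<r. \<Sum>k\<in>UNIV. U j $ i * s j * V j $ k * x $ k)" by (rule sum.swap)
  also have "\<dots> = (\<Sum>j<r. (s j * inner (V j) x) *\<^sub>R U j) $ i"
    by (simp add: inner_vec_def sum_distrib_left sum_distrib_right mult_ac)
  finally show "(usv r U s V *v x) $ i = (\<Sum>j<r. (s j * inner (V j) x) *\<^sub>R U j) $ i" .
qed

lemma inner_usv: "inner Q (usv r U s V) = (\<Sum>j<r. s j * inner (U j) (Q *v V j))"
proof -
  have "inner Q (usv r U s V) = (\<Sum>i\<in>UNIV. \<Sum>k\<in>UNIV. \<Sum>j<r. Q $ i $ k * (U j $ i * s j * V j $ k))"
    by (simp add: inner_vec_def usv_def sum_distrib_left)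
  also have "\<dots> = (\<Sum>i\<in>UNIV. \<Sum>j<r. \<Sum>k\<in>UNIV. Q $ i $ k * (U j $ i * s j * V j $ k))"
    by (intro sum.cong refl sum.swap)
  also have "\<dots> = (\<Sum>j<r. \<Sum>i\<in>UNIV. \<Sum>k\<in>UNIV. Q $ i $ k * (U j $ i * s j * V j $ k))"
    by (rule sum.swap)
  also have "\<dots> = (\<Sum>j<r. s j * inner (U j) (Q *v V j))"
    by (simp add: inner_vec_def matrix_vector_mult_def sum_distrib_left mult_ac)
  finally show ?thesis .
qed

text \<open>\<open>p\<close> is the orthogonal projection of \<open>x\<close> onto the span of the
  columns, and x - p has nonnegative square length.\<close>

lemma bessel_inequality:
  assumes "orthonormal_cols r U"
  shows "(\<Sum>j<r. (inner (U j) x)\<^sup>2) \<le> (norm x)\<^sup>2"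
proof -
  define p where "p = (\<Sum>j<r. inner (U j) x *\<^sub>R U j)"
  have px: "inner p x = (\<Sum>j<r. (inner (U j) x)\<^sup>2)"
    by (simp add: p_def inner_sum_left power2_eq_square)
  have "inner (U i) p = inner (U i) x" if "i < r" for i
  proof -
    have "inner (U i) p = (\<Sum>j<r. inner (U j) x * (if i = j then 1 else 0))"
      unfolding p_def inner_sum_right using assms that
      by (intro sum.cong) (auto simp: orthonormal_cols_def)
    also have "\<dots> = (\<Sum>j<r. if i = j then inner (U j) x else 0)" by (intro sum.cong) auto
    also have "\<dots> = inner (U i) x" using that by (simp only: sum.delta' finite_lessThan) simp
    finally show ?thesis .
  qed
  then have pp: "inner p p = inner p x"
    by (simp add: px) (simp add: p_def inner_sum_left power2_eq_square)
  have "0 \<le> inner (x - p) (x - p)" by simp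
  also have "\<dots> = inner x x - inner p x" using pp by (simp add: inner_diff_left inner_diff_right inner_commute)
  finally show ?thesis using px by (simp add: power2_norm_eq_inner)
qed

text \<open>By Bessel the coefficient vectors of \<open>x\<close> and \<open>y\<close> in the two
  orthonormal systems are no longer than \<open>x\<close> and \<open>y\<close>; Cauchy-Schwarz then
  bounds the bilinear form by the upper bound 1 + \<delta> of the \<open>\<phi> j\<close>.\<close>

lemma inexact_polar_spectral_ball:
  assumes P: "P \<in> inexact_polar \<delta> Z" and \<delta>: "0 \<le> \<delta>"
  shows "P /\<^sub>R (1 + \<delta>) \<in> spectral_ball"
proof (cases "Z = 0")
  case True
  then show ?thesis using P zero_in_spectral_ball by (simp add: inexact_polar_def)
next
  case False
  define r where "r = rank Z"
  obtain U V \<phi> \<sigma> where P_eq: "P = usv r U \<phi> V" and svd: "compact_svd Z U \<sigma> V"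
    and \<phi>: "\<And>j. j < r \<Longrightarrow> 0 \<le> \<phi> j \<and> \<phi> j \<le> 1 + \<delta>"
    using P False by (auto simp: inexact_polar_def r_def)
  have on: "orthonormal_cols r U" "orthonormal_cols r V" using svd by (auto simp: compact_svd_def r_def)
  have "inner y (P *v x) \<le> (1 + \<delta>) * (norm x * norm y)" for x y
  proof -
    have "inner y (P *v x) = (\<Sum>j<r. \<phi> j * (inner (V j) x * inner (U j) y))"
      by (simp add: P_eq usv_mult inner_sum_right inner_commute mult_ac)
    also have "\<dots> \<le> (\<Sum>j<r. (1 + \<delta>) * (\<bar>inner (V j) x\<bar> * \<bar>inner (U j) y\<bar>))"
    proof (rule sum_mono)
      fix j assume "j \<in> {..<r}"
      then have "0 \<le> \<phi> j" "\<phi> j \<le> 1 + \<delta>" using \<phi> by auto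
      then have "\<phi> j * (inner (V j) x * inner (U j) y) \<le> \<phi> j * (\<bar>inner (V j) x\<bar> * \<bar>inner (U j) y\<bar>)"
        by (intro mult_left_mono) (auto simp flip: abs_mult)
      also have "\<dots> \<le> (1 + \<delta>) * (\<bar>inner (V j) x\<bar> * \<bar>inner (U j) y\<bar>)"
        using \<open>\<phi> j \<le> 1 + \<delta>\<close> by (intro mult_right_mono) auto
      finally show "\<phi> j * (inner (V j) x * inner (U j) y) \<le> (1 + \<delta>) * (\<bar>inner (V j) x\<bar> * \<bar>inner (U j) y\<bar>)" .
    qed
    also have "\<dots> = (1 + \<delta>) * (\<Sum>j<r. \<bar>inner (V j) x\<bar> * \<bar>inner (U j) y\<bar>)" by (simp add: sum_distrib_left)
    also have "\<dots> \<le> (1 + \<delta>) * (L2_set (\<lambda>j. inner (V j) x) {..<r} * L2_set (\<lambda>j. inner (U j) y) {..<r})"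
      using \<delta> by (intro mult_left_mono L2_set_mult_ineq) auto
    also have "\<dots> \<le> (1 + \<delta>) * (norm x * norm y)"
      using \<delta> bessel_inequality[OF on(2), of x] bessel_inequality[OF on(1), of y]
      by (intro mult_left_mono mult_mono) (auto simp: L2_set_def intro: real_le_lsqrt sum_nonneg)
    finally show ?thesis .
  qed
  then have "inner y ((P /\<^sub>R (1 + \<delta>)) *v x) \<le> norm x * norm y" for x y
    using \<delta> by (simp add: scaleR_matrix_vector_assoc[symmetric] field_simps)
  then show ?thesis by (simp add: spectral_ball_def)
qed

lemma nuclear_norm_le_sum:
  assumes "compact_svd Z U \<sigma> V"
  shows "nuclear_norm Z \<le> (\<Sum>j<rank Z. \<sigma> j)"
proof -
  obtain Q where Q: "Q \<in> spectral_ball" "inner Q Z = nuclear_norm Z" by (rule nuclear_norm_attained)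
  have "inner Q Z = (\<Sum>j<rank Z. \<sigma> j * inner (U j) (Q *v V j))"
    using assms inner_usv[of Q "rank Z" U \<sigma> V] by (simp add: compact_svd_def)
  also have "\<dots> \<le> (\<Sum>j<rank Z. \<sigma> j * 1)"
  proof (intro sum_mono mult_left_mono)
    fix j assume j: "j \<in> {..<rank Z}"
    have "inner (U j) (U j) = 1" "inner (V j) (V j) = 1"
      using assms j by (auto simp: compact_svd_def orthonormal_cols_def)
    then have "norm (U j) = 1" "norm (V j) = 1" by (simp_all add: norm_eq_sqrt_inner)
    then show "inner (U j) (Q *v V j) \<le> 1"
      using Q(1) by (auto simp: spectral_ball_def dest!: spec[of _ "V j"] spec[of _ "U j"])
    show "0 \<le> \<sigma> j" using assms j by (auto simp: compact_svd_def intro: less_imp_le)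
  qed
  finally show ?thesis using Q(2) by simp
qed

text \<open>Singular values at least \<open>\<delta>\<close> are paired with a factor at least 1 -
  \<delta>; each smaller one costs at most \<open>\<delta>\<close>, and there are at most
  \<open>CARD('m)\<close> of them. Undoing the normalization multiplies the cost by
  \<open>norm M + s\<close>, which is where the assumption that \<delta> \<sigma> tends to 0 comes
  in.\<close>

lemma inexact_polar_pairing:
  fixes M P :: "real^'n^'m"
  assumes P: "P \<in> inexact_polar \<delta> (M /\<^sub>R (norm M + s))" and \<delta>: "0 \<le> \<delta>" "\<delta> < 1" and s: "0 \<le> s"
  shows "(1 - \<delta>) * (nuclear_norm M - real CARD('m) * \<delta> * (norm M + s)) \<le> inner P M"
proof (cases "M = 0")
  case True
  then show ?thesis using P \<delta> s by (simp add: inexact_polar_def)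
next
  case False
  define c where "c = norm M + s"
  have c: "c > 0" using False s by (simp add: c_def add_pos_nonneg)
  define Z where "Z = M /\<^sub>R c"
  have MZ: "M = c *\<^sub>R Z" and Z0: "Z \<noteq> 0" using c False by (auto simp: Z_def)
  have PZ: "P \<in> inexact_polar \<delta> Z" using P by (simp add: Z_def c_def)
  define r where "r = rank Z"
  obtain U V \<phi> \<sigma> where P_eq: "P = usv r U \<phi> V" and svd: "compact_svd Z U \<sigma> V"
    and \<phi>: "\<And>j. j < r \<Longrightarrow> 0 \<le> \<phi> j" "\<And>j. j < r \<Longrightarrow> \<sigma> j \<ge> \<delta> \<Longrightarrow> \<phi> j \<ge> 1 - \<delta>"
    using PZ Z0 by (auto simp: inexact_polar_def r_def)
  have on: "orthonormal_cols r U" "orthonormal_cols r V" and \<sigma>: "\<And>j. j < r \<Longrightarrow> \<sigma> j > 0"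
    and Z_eq: "Z = usv r U \<sigma> V"
    using svd by (auto simp: compact_svd_def r_def)
  have r: "r \<le> CARD('m)" unfolding r_def using rank_bound[of Z] by simp
  have "(1 - \<delta>) * (nuclear_norm Z - real CARD('m) * \<delta>) \<le> (1 - \<delta>) * ((\<Sum>j<r. \<sigma> j) - real r * \<delta>)"
    using nuclear_norm_le_sum[OF svd] r \<delta>
    by (intro mult_left_mono diff_mono mult_right_mono) (auto simp: r_def)
  also have "\<dots> = (\<Sum>j<r. (1 - \<delta>) * (\<sigma> j - \<delta>))"
    by (simp add: sum_distrib_left sum_subtractf flip: sum_distrib_left)
  also have "\<dots> \<le> (\<Sum>j<r. \<phi> j * \<sigma> j)"
  proof (rule sum_mono)
    fix j assume "j \<in> {..<r}"
    then have j: "j < r" by simp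
    show "(1 - \<delta>) * (\<sigma> j - \<delta>) \<le> \<phi> j * \<sigma> j"
    proof (cases "\<sigma> j \<ge> \<delta>")
      case True
      then show ?thesis using \<phi>[OF j] \<delta> \<sigma>[OF j] by (intro mult_mono) auto
    next
      case False
      then have "(1 - \<delta>) * (\<sigma> j - \<delta>) \<le> 0" using \<delta> by (intro mult_nonneg_nonpos) auto
      also have "0 \<le> \<phi> j * \<sigma> j" using \<phi>(1)[OF j] \<sigma>[OF j] by simp
      finally show ?thesis .
    qed
  qed
  also have "\<dots> = inner Z P"
  proof -
    have "inner (U j) (Z *v V j) = \<sigma> j" if j: "j < r" for j
    proof -
      have "Z *v V j = (\<Sum>i<r. if i = j then \<sigma> j *\<^sub>R U j else 0)"
        unfolding Z_eq usv_mult using on(2) j by (intro sum.cong) (auto simp: orthonormal_cols_def)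
      also have "\<dots> = \<sigma> j *\<^sub>R U j" using j by simp
      finally show ?thesis using on(1) j by (simp add: orthonormal_cols_def)
    qed
    then show ?thesis unfolding P_eq inner_usv by simp
  qed
  finally have "(1 - \<delta>) * (nuclear_norm Z - real CARD('m) * \<delta>) \<le> inner P Z" by (simp add: inner_commute)
  then have "c * ((1 - \<delta>) * (nuclear_norm Z - real CARD('m) * \<delta>)) \<le> inner P M"
    using c by (simp add: MZ)
  moreover have "nuclear_norm M \<le> c * nuclear_norm Z"
  proof -
    obtain Q where Q: "Q \<in> spectral_ball" "inner Q M = nuclear_norm M" by (rule nuclear_norm_attained)
    have "nuclear_norm M = c * inner Q Z" using Q(2) by (simp add: MZ)
    then show ?thesis using nuclear_norm_upper[OF Q(1), of Z] c by simp
  qed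
  then have "(1 - \<delta>) * (nuclear_norm M - real CARD('m) * \<delta> * c) \<le> (1 - \<delta>) * (c * nuclear_norm Z - real CARD('m) * \<delta> * c)"
    using \<delta> by (intro mult_left_mono) auto
  ultimately show ?thesis by (simp add: c_def algebra_simps)
qed

section \<open>Chain rule and monotonicity along Lipschitz curves\<close>

lemma lipschitz_imp_abs_continuous_curve:
  assumes "L-lipschitz_on {a..b} g"
  shows "abs_continuous_curve a b g"
  unfolding abs_continuous_curve_def
proof (intro allI impI)
  fix \<epsilon> :: real assume \<epsilon>: "0 < \<epsilon>"
  have L: "L \<ge> 0" using assms lipschitz_on_nonneg by blast
  show "\<exists>\<delta>>0. \<forall>d. d division_of \<Union>d \<and> \<Union>d \<subseteq> {a..b} \<and> (\<Sum>k\<in>d. Sup k - Inf k) < \<delta> \<longrightarrow>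
        (\<Sum>k\<in>d. norm (g (Sup k) - g (Inf k))) < \<epsilon>"
  proof (intro exI[of _ "\<epsilon> / (L + 1)"] conjI allI impI)
    show "0 < \<epsilon> / (L + 1)" using L \<epsilon> by simp
    fix d assume d: "d division_of \<Union>d \<and> \<Union>d \<subseteq> {a..b} \<and> (\<Sum>k\<in>d. Sup k - Inf k) < \<epsilon> / (L + 1)"
    have k: "Inf k \<le> Sup k \<and> norm (g (Sup k) - g (Inf k)) \<le> L * (Sup k - Inf k)" if "k \<in> d" for k
    proof -
      have "k \<noteq> {}" "\<exists>u v. k = cbox u v" using division_ofD[of d "\<Union>d"] d that by auto
      then obtain u v where k: "k = {u..v}" "u \<le> v" by auto
      then have "k \<subseteq> {a..b}" using d that by blast
      then have "u \<in> {a..b}" "v \<in> {a..b}" using k by auto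
      then show ?thesis using lipschitz_on_normD[OF assms, of v u] k by simp
    qed
    have "(\<Sum>k\<in>d. norm (g (Sup k) - g (Inf k))) \<le> (\<Sum>k\<in>d. L * (Sup k - Inf k))"
      using k by (intro sum_mono) auto
    also have "\<dots> = L * (\<Sum>k\<in>d. Sup k - Inf k)" by (simp add: sum_distrib_left)
    also have "\<dots> \<le> (L + 1) * (\<Sum>k\<in>d. Sup k - Inf k)"
      using k by (intro mult_right_mono sum_nonneg) auto
    also have "\<dots> < (L + 1) * (\<epsilon> / (L + 1))" using d L by (intro mult_strict_left_mono) auto
    finally show "(\<Sum>k\<in>d. norm (g (Sup k) - g (Inf k))) < \<epsilon>" using L by simp
  qed
qed

text \<open>Replaces the derivative relative to \<open>{0..1}\<close> in the definition by a
  measurable function that agrees with the derivative almost everywhere and can be computed from the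
  dynamics.\<close>

lemma conservative_field_lipschitz_chain_rule:
  assumes D: "conservative_field f D" and g: "L-lipschitz_on {0..1} g"
    and w: "w \<in> borel_measurable (lebesgue_on {0..1})"
      "AE t in lebesgue_on {0..1}. 0 < t \<and> t < 1 \<and> (g has_vector_derivative w t) (at t)"
    and v: "v \<in> borel_measurable (lebesgue_on {0..1})" "AE t in lebesgue_on {0..1}. v t \<in> D (g t)"
  shows "has_bochner_integral (lebesgue_on {0..1}) (\<lambda>t. inner (w t) (v t)) (f (g 1) - f (g 0))"
proof -
  have i: "has_bochner_integral (lebesgue_on {0..1})
      (\<lambda>t. inner (vector_derivative g (at t within {0..1})) (v t)) (f (g 1) - f (g 0))"
    using D lipschitz_imp_abs_continuous_curve[OF g] v unfolding conservative_field_def by blast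
  have ae: "AE t in lebesgue_on {0..1}. inner (vector_derivative g (at t within {0..1})) (v t) = inner (w t) (v t)"
    using w(2)
  proof eventually_elim
    case (elim t)
    then have "(g has_vector_derivative w t) (at t within {0..1})"
      using has_vector_derivative_at_within by blast
    then have "vector_derivative g (at t within {0..1}) = w t"
      using elim vector_derivative_within_cbox[of 0 1 t g "w t"] by auto
    then show ?case by simp
  qed
  have "(\<lambda>t. inner (w t) (v t)) \<in> borel_measurable (lebesgue_on {0..1})"
    using w(1) v(1) by measurable
  then show ?thesis
    using i has_bochner_integral_cong_AE[OF _ _ ae] has_bochner_integral_iff borel_measurable_integrable by blast
qed

lemma lipschitz_nonincreasing:
  fixes g :: "real \<Rightarrow> real"
  assumes g: "L-lipschitz_on {0..1} g"
    and le: "AE t in lebesgue_on {0..1}. \<forall>D. (g has_vector_derivative D) (at t) \<longrightarrow> D \<le> 0"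
  shows "g 1 \<le> g 0"
proof -
  obtain w where w: "AE t in lebesgue_on {0..1}. 0 < t \<and> t < 1 \<and> (g has_vector_derivative w t) (at t)"
    "has_bochner_integral (lebesgue_on {0..1}) w (g 1 - g 0)"
    by (rule lipschitz_fundamental_theorem[OF g])
  have "AE t in lebesgue_on {0..1}. w t \<le> 0" using w(1) le by eventually_elim blast
  then have "integral\<^sup>L (lebesgue_on {0..1}) w \<le> integral\<^sup>L (lebesgue_on {0..1}) (\<lambda>_. 0)"
    using w(2) integral_mono_AE[of "lebesgue_on {0..1}" w "\<lambda>_. 0"] by (simp add: has_bochner_integral_iff)
  then show ?thesis using w(2) by (simp add: has_bochner_integral_iff)
qed

section \<open>Runs in a compact set\<close>

text \<open>The Taylor constant does not depend on \<open>z\<close>, since the logits may be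
  unbounded along a run. The second bound makes 1 - \<alpha> comparable at consecutive
  indices.\<close>

lemma logistic_step:
  fixes z \<zeta> :: real
  defines "a \<equiv> inverse (1 + exp (- z))" and "a' \<equiv> inverse (1 + exp (- (z + \<zeta>)))"
  assumes \<zeta>: "\<bar>\<zeta>\<bar> \<le> 1 / 2"
  shows "\<bar>a' - a - a * (1 - a) * \<zeta>\<bar> \<le> 8 * \<zeta>\<^sup>2" and "1 - a' \<le> 2 * (1 - a)"
proof -
  define E where "E = exp (- z)"
  define p where "p = exp \<zeta>"
  have E: "E > 0" and p0: "p > 0" by (simp_all add: E_def p_def)
  have p1: "1 + \<zeta> \<le> p" unfolding p_def by (rule exp_ge_add_one_self)
  have "1 - \<zeta> \<le> 1 / p" using exp_ge_add_one_self[of "- \<zeta>"] by (simp add: p_def exp_minus inverse_eq_divide)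
  then have p2: "p * (1 - \<zeta>) \<le> 1" using p0 by (simp add: field_simps)
  have p_half: "p \<ge> 1 / 2" using p1 \<zeta> by linarith
  have "(p - 1 - \<zeta>) * (1 - \<zeta>) \<le> \<zeta>\<^sup>2"
    using p2 by (simp add: algebra_simps power2_eq_square)
  moreover have "(p - 1 - \<zeta>) * (1 / 2) \<le> (p - 1 - \<zeta>) * (1 - \<zeta>)"
    using p1 \<zeta> by (intro mult_left_mono) auto
  ultimately have quad: "p - 1 - \<zeta> \<le> 2 * \<zeta>\<^sup>2" by simp
  have "\<bar>\<zeta>\<bar> * \<bar>\<zeta>\<bar> \<le> \<bar>\<zeta>\<bar> * (1/2)" using \<zeta> by (intro mult_left_mono) auto
  then have "\<zeta>\<^sup>2 \<le> \<bar>\<zeta>\<bar> * (1/2)" by (simp add: power2_eq_square)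
  then have lin: "\<bar>p - 1\<bar> \<le> 2 * \<bar>\<zeta>\<bar>" using quad p1 by (auto simp: abs_le_iff)
  have a: "a = 1 / (1 + E)" by (simp add: a_def E_def divide_inverse)
  have a': "a' = p / (p + E)"
    using p0 E by (simp add: a'_def p_def E_def exp_add exp_diff exp_minus field_simps)
  show "1 - a' \<le> 2 * (1 - a)"
  proof -
    have eqs: "1 - a' = E / (p + E)" "1 - a = E / (1 + E)" using E p0 by (auto simp: a a' field_simps)
    have "E / (p + E) \<le> 2 * (E / (1 + E))"
      using E p0 p_half by (simp add: divide_simps)
    then show ?thesis unfolding eqs .
  qed
  \<comment> \<open>The remainder carries the factor E / (1 + E), which is at most 1. Both terms in
    the bracket have numerators at most 2 \<zeta>^2 and denominators at least 1/2, whence 4 + 4 =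
    8.\<close>
  have eq: "a' - a - a * (1 - a) * \<zeta> = (E / (1 + E)) * ((p - 1 - \<zeta>) / (p + E) - \<zeta> * (p - 1) / ((p + E) * (1 + E)))"
    using E p0 by (simp add: a a' divide_simps) (simp add: algebra_simps power2_eq_square)
  have "\<bar>(p - 1 - \<zeta>) / (p + E) - \<zeta> * (p - 1) / ((p + E) * (1 + E))\<bar>
      \<le> \<bar>(p - 1 - \<zeta>) / (p + E)\<bar> + \<bar>\<zeta> * (p - 1) / ((p + E) * (1 + E))\<bar>" by (rule abs_triangle_ineq4)
  also have "\<dots> \<le> 2 * \<zeta>\<^sup>2 / (1/2) + 2 * \<zeta>\<^sup>2 / (1/2)"
  proof (rule add_mono)
    have "(p - 1 - \<zeta>) / (p + E) \<le> 2 * \<zeta>\<^sup>2 / (1 / 2)"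
      using quad p1 p_half E by (intro frac_le) auto
    moreover have "0 \<le> (p - 1 - \<zeta>) / (p + E)" using p1 p0 E by auto
    ultimately show "\<bar>(p - 1 - \<zeta>) / (p + E)\<bar> \<le> 2 * \<zeta>\<^sup>2 / (1/2)"
      by (simp only: abs_of_nonneg)
    have "\<bar>\<zeta> * (p - 1)\<bar> \<le> 2 * \<zeta>\<^sup>2"
      using mult_left_mono[OF lin, of "\<bar>\<zeta>\<bar>"] by (simp add: abs_mult power2_eq_square)
    moreover have "1 / 2 \<le> (p + E) * (1 + E)"
      using mult_mono[of "1/2" "p + E" 1 "1 + E"] p_half E by auto
    ultimately have "\<bar>\<zeta> * (p - 1)\<bar> / ((p + E) * (1 + E)) \<le> 2 * \<zeta>\<^sup>2 / (1/2)"
      by (intro frac_le) auto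
    then show "\<bar>\<zeta> * (p - 1) / ((p + E) * (1 + E))\<bar> \<le> 2 * \<zeta>\<^sup>2 / (1/2)"
      using p0 E by (simp add: abs_mult)
  qed
  also have "\<dots> = 8 * \<zeta>\<^sup>2" by simp
  finally have br: "\<bar>(p - 1 - \<zeta>) / (p + E) - \<zeta> * (p - 1) / ((p + E) * (1 + E))\<bar> \<le> 8 * \<zeta>\<^sup>2" .
  have "\<bar>a' - a - a * (1 - a) * \<zeta>\<bar> \<le> 1 * (8 * \<zeta>\<^sup>2)"
    unfolding eq abs_mult using E by (intro mult_mono br) auto
  then show "\<bar>a' - a - a * (1 - a) * \<zeta>\<bar> \<le> 8 * \<zeta>\<^sup>2" by simp
qed

lemma AE_lebesgue_on_open_ex:
  assumes ae: "AE t in lebesgue_on {0..1::real}. P t" and A: "open A" "A \<noteq> {}" "A \<subseteq> {0..1}"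
  shows "\<exists>t\<in>A. P t"
proof (rule ccontr)
  assume no: "\<not> ?thesis"
  have "AE t in lebesgue. t \<in> {0..1} \<longrightarrow> P t"
    using ae by (subst (asm) AE_restrict_space_iff) auto
  then have "AE t in lebesgue. t \<notin> A" by eventually_elim (use no A in auto)
  then have "A \<in> null_sets lebesgue"
    using A by (subst (asm) AE_iff_null_sets[symmetric]) auto
  then have "negligible A" by (simp add: negligible_iff_null_sets)
  then show False using open_not_negligible[OF A(1,2)] by simp
qed

lemma bounded_range_if_asymptotic:
  fixes d e :: "nat \<Rightarrow> 'a::real_normed_vector"
  assumes "(\<lambda>n. d n - e n) \<longlonglongrightarrow> 0" and "bounded (range e)"
  shows "bounded (range d)"
proof -
  have "bounded (range (\<lambda>n. d n - e n))" using assms(1) convergent_imp_bounded by blast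
  then have "bounded (range (\<lambda>n. (d n - e n) + e n))" using bounded_plus_comp[OF _ assms(2)] by blast
  then show ?thesis by simp
qed

locale magd_bounded_run =
  fixes f :: "real^'n^'m \<Rightarrow> real"
    and D :: "real^'n^'m \<Rightarrow> (real^'n^'m) set"
    and W0 c :: "real^'n^'m"
    and K :: "(real^'n^'m) set"
    and W G S M U :: "nat \<Rightarrow> real^'n^'m"
    and \<eta> \<beta>M \<eta>M \<delta>M \<sigma>M z \<alpha> :: "nat \<Rightarrow> real"
    and \<gamma> \<rho> rad LK R :: real
  assumes lip_f: "locally_lipschitz f"
    and cons: "conservative_field f D"
    and D_convex: "\<And>X. convex (D X)"
    and sard: "interior (f ` {X. 0 \<in> D X}) = {}"
    and inputs: "magd_inputs \<eta> \<gamma> \<rho> \<beta>M \<eta>M \<delta>M \<sigma>M"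
    and run: "magd_run D W0 \<eta> \<gamma> \<rho> \<beta>M \<eta>M \<delta>M \<sigma>M z \<alpha> W G S M U"
    and K_def: "K = cball c rad"
    and U_in: "range U \<subseteq> K"
    and S_in: "range S \<subseteq> K"
    and LK_def: "LK = Sup {norm Y | X Y. X \<in> K \<and> Y \<in> D X}"
    and R_def: "R = (SUP t. norm (S t - U t))"
begin

lemma alpha_eq: "\<alpha> t = inverse (1 + exp (- z t))"
  and W_eq: "W t = (1 - \<alpha> t) *\<^sub>R U t + \<alpha> t *\<^sub>R S t"
  and G_in: "G t \<in> D (W t)"
  and z_Suc: "z (Suc t) = z t - \<gamma> * \<eta> t * inner (G t) (S t - U t)"
  and S_Suc: "S (Suc t) = S t - \<eta> t *\<^sub>R G t"
  and M_Suc: "M (Suc t) = \<beta>M t *\<^sub>R M t + (1 - \<beta>M t) *\<^sub>R G t"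
  and M_0: "M 0 = 0"
  using run unfolding magd_run_def by blast+

lemma gamma_pos: "\<gamma> > 0" and eta_nonneg: "\<eta> t \<ge> 0" and etaM_nonneg: "\<eta>M t \<ge> 0"
  and delta_nonneg: "0 \<le> \<delta>M t" and delta_less: "\<delta>M t < 1" and sigma_nonneg: "0 \<le> \<sigma>M t"
  and beta_nonneg: "0 \<le> \<beta>M t" and beta_le: "\<beta>M t \<le> 1"
  using inputs unfolding magd_inputs_def by blast+

lemma alpha_pos: "0 < \<alpha> t" and alpha_less: "\<alpha> t < 1"
  unfolding alpha_eq by (auto simp: add_pos_pos inverse_less_1_iff)

lemma K_compact: "compact K" and K_closed: "closed K" and K_convex: "convex K"
  by (simp_all add: K_def)

lemma W_in: "W t \<in> K"
  unfolding W_eq using U_in S_in alpha_pos[of t] alpha_less[of t]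
  by (intro convexD[OF K_convex]) auto

lemma D_closed_graph:
  assumes "X \<longlonglongrightarrow> x" "Y \<longlonglongrightarrow> y" "\<And>k. Y k \<in> D (X k)"
  shows "y \<in> D x"
proof -
  have "closed {(X, Y). Y \<in> D X}" using cons by (simp add: conservative_field_def)
  moreover have "(\<lambda>k. (X k, Y k)) \<longlonglongrightarrow> (x, y)" using assms by (intro tendsto_Pair)
  ultimately have "(x, y) \<in> {(X, Y). Y \<in> D X}"
    using assms(3) by (intro Lim_in_closed_set[where f="\<lambda>k. (X k, Y k)" and F=sequentially]) auto
  then show ?thesis by simp
qed

lemma D_compact: "compact (D X)"
  using cons by (simp add: conservative_field_def)

text \<open>Finitely many neighbourhoods of local boundedness cover the compact ball; this makes the
  supremum \<open>LK\<close> an actual bound.\<close>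

lemma D_bdd: "bdd_above {norm Y | X Y. X \<in> K \<and> Y \<in> D X}"
proof -
  have "\<forall>X. \<exists>V. open V \<and> X \<in> V \<and> bounded (\<Union>Y\<in>V. D Y)"
    using cons by (simp add: conservative_field_def)
  then obtain V where V: "\<And>X. open (V X)" "\<And>X. X \<in> V X" "\<And>X. bounded (\<Union>Y\<in>V X. D Y)" by metis
  obtain C where C: "C \<subseteq> K" "finite C" "K \<subseteq> (\<Union>X\<in>C. V X)"
    by (rule compactE_image[OF K_compact, of K V]) (use V in auto)
  have "bounded (\<Union>X\<in>C. \<Union>Y\<in>V X. D Y)" using C V by (intro bounded_UN) auto
  then obtain B where B: "\<And>Y. Y \<in> (\<Union>X\<in>C. \<Union>Y\<in>V X. D Y) \<Longrightarrow> norm Y \<le> B"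
    unfolding bounded_iff by blast
  show ?thesis
  proof (rule bdd_aboveI[of _ B])
    fix s assume "s \<in> {norm Y | X Y. X \<in> K \<and> Y \<in> D X}"
    then show "s \<le> B" using B C(3) by blast
  qed
qed

lemma D_bound: "X \<in> K \<Longrightarrow> Y \<in> D X \<Longrightarrow> norm Y \<le> LK"
  unfolding LK_def by (rule cSup_upper[OF _ D_bdd]) blast

lemma G_bound: "norm (G t) \<le> LK"
  by (rule D_bound[OF W_in G_in])

lemma LK_nonneg: "0 \<le> LK"
  using G_bound[of 0] norm_ge_zero order_trans by blast

lemma gap_bound: "norm (S t - U t) \<le> R"
proof -
  have "bounded (range (\<lambda>t. S t - U t))"
    using U_in S_in compact_imp_bounded[OF K_compact]
    by (intro bounded_minus_comp) (auto intro: bounded_subset)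
  then have "bounded (range (\<lambda>t. norm (S t - U t)))"
    using bounded_norm_comp[of "\<lambda>t. S t - U t" UNIV] by simp
  then have "bdd_above (range (\<lambda>t. norm (S t - U t)))" by (rule bounded_imp_bdd_above)
  then show ?thesis unfolding R_def by (intro cSUP_upper) auto
qed

lemma R_nonneg: "0 \<le> R"
  using gap_bound[of 0] norm_ge_zero order_trans by blast

lemma gap_eq: "S t - W t = (1 - \<alpha> t) *\<^sub>R (S t - U t)"
  by (simp add: W_eq algebra_simps)

lemma pairing_bound: "\<bar>inner (G t) (S t - U t)\<bar> \<le> LK * R"
  using Cauchy_Schwarz_ineq2[of "G t" "S t - U t"] mult_mono[OF G_bound[of t] gap_bound[of t]] LK_nonneg
  by simp

lemma f_continuous: "continuous_on A f"
proof -
  have "isCont f x" for x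
  proof -
    obtain e L where "e > 0" "L-lipschitz_on (ball x e) f"
      using lip_f unfolding locally_lipschitz_def by blast
    then show ?thesis
      using lipschitz_on_continuous_on continuous_on_interior[of "ball x e" f x] by auto
  qed
  then show ?thesis by (simp add: continuous_at_imp_continuous_on)
qed

text \<open>The step \<open>h\<close> is generic because the two regimes measure time by
  \<open>\<eta>\<close> and by \<open>\<eta>M\<close>. The quadratic remainder divided by
  \<open>h t\<close> is of order \<open>h t\<close>, uniformly in the logit.\<close>

lemma alpha_increment:
  assumes h: "\<And>t. 0 < h t" "h \<longlonglongrightarrow> 0" and w: "\<And>t. - (\<gamma> * \<eta> t * inner (G t) (S t - U t)) = h t * w t"
    and C: "\<And>t. \<bar>w t\<bar> \<le> C"
  shows "(\<lambda>t. (\<alpha> (Suc t) - \<alpha> t) / h t - \<alpha> t * (1 - \<alpha> t) * w t) \<longlonglongrightarrow> 0"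
    and "\<forall>\<^sub>F t in sequentially. 1 - \<alpha> (Suc t) \<le> 2 * (1 - \<alpha> t)"
proof -
  have C0: "0 \<le> C" using C[of 0] by linarith
  have zS: "z (Suc t) = z t + h t * w t" for t using z_Suc[of t] w[of t] by linarith
  have "(\<lambda>t. h t * C) \<longlonglongrightarrow> 0" using tendsto_mult[OF h(2) tendsto_const[of C]] by simp
  then have "\<forall>\<^sub>F t in sequentially. h t * C < 1 / 2" by (rule order_tendstoD) simp
  then have small: "\<forall>\<^sub>F t in sequentially. \<bar>h t * w t\<bar> \<le> 1 / 2"
  proof eventually_elim
    case (elim t)
    have "\<bar>h t * w t\<bar> \<le> h t * C" using h(1)[of t] C[of t] by (simp add: abs_mult)
    then show ?case using elim by simp
  qed
  from small show "\<forall>\<^sub>F t in sequentially. 1 - \<alpha> (Suc t) \<le> 2 * (1 - \<alpha> t)"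
  proof eventually_elim
    case (elim t)
    then show ?case using logistic_step(2)[of "h t * w t" "z t"] by (simp add: alpha_eq zS)
  qed
  show "(\<lambda>t. (\<alpha> (Suc t) - \<alpha> t) / h t - \<alpha> t * (1 - \<alpha> t) * w t) \<longlonglongrightarrow> 0"
  proof (rule Lim_null_comparison)
    show "(\<lambda>t. 8 * C\<^sup>2 * h t) \<longlonglongrightarrow> 0" using tendsto_mult[OF tendsto_const[of "8 * C\<^sup>2"] h(2)] by simp
    from small show "\<forall>\<^sub>F t in sequentially. norm ((\<alpha> (Suc t) - \<alpha> t) / h t - \<alpha> t * (1 - \<alpha> t) * w t) \<le> 8 * C\<^sup>2 * h t"
    proof eventually_elim
      case (elim t)
      have "\<bar>\<alpha> (Suc t) - \<alpha> t - \<alpha> t * (1 - \<alpha> t) * (h t * w t)\<bar> \<le> 8 * (h t * w t)\<^sup>2"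
        using logistic_step(1)[OF elim, of "z t"] by (simp add: alpha_eq zS)
      also have "\<dots> \<le> 8 * (h t * C)\<^sup>2"
        using h(1)[of t] C[of t] C0 by (intro mult_left_mono) (simp_all add: power_mult_distrib abs_le_square_iff[symmetric])
      finally have "\<bar>\<alpha> (Suc t) - \<alpha> t - \<alpha> t * (1 - \<alpha> t) * (h t * w t)\<bar> / h t \<le> 8 * (h t * C)\<^sup>2 / h t"
        using h(1)[of t] by (intro divide_right_mono) auto
      also have "\<dots> = 8 * C\<^sup>2 * h t" using h(1)[of t] by (simp add: power2_eq_square)
      finally have "\<bar>(\<alpha> (Suc t) - \<alpha> t - \<alpha> t * (1 - \<alpha> t) * (h t * w t)) / h t\<bar> \<le> 8 * C\<^sup>2 * h t"
        using h(1)[of t] by simp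
      moreover have "(\<alpha> (Suc t) - \<alpha> t - \<alpha> t * (1 - \<alpha> t) * (h t * w t)) / h t
          = (\<alpha> (Suc t) - \<alpha> t) / h t - \<alpha> t * (1 - \<alpha> t) * w t"
        using h(1)[of t] by (simp add: diff_divide_distrib)
      ultimately show ?case by simp
    qed
  qed
qed

lemma polar_directions:
  obtains P where "\<And>t. U (Suc t) = U t - \<eta>M t *\<^sub>R P t"
    "\<And>t. P t /\<^sub>R (1 + \<delta>M t) \<in> spectral_ball"
    "\<And>t. (1 - \<delta>M t) * (nuclear_norm (M (Suc t)) - real CARD('m) * \<delta>M t * (norm (M (Suc t)) + \<sigma>M t))
      \<le> inner (P t) (M (Suc t))"
    "\<And>t. norm (P t) \<le> 2 * (real CARD('m) * real CARD('n))"
proof -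
  have "\<forall>t. \<exists>P. U (Suc t) = U t - \<eta>M t *\<^sub>R P \<and> P \<in> inexact_polar (\<delta>M t) (M (Suc t) /\<^sub>R (norm (M (Suc t)) + \<sigma>M t))"
    using run unfolding magd_run_def by blast
  then obtain P where P: "\<And>t. U (Suc t) = U t - \<eta>M t *\<^sub>R P t"
      "\<And>t. P t \<in> inexact_polar (\<delta>M t) (M (Suc t) /\<^sub>R (norm (M (Suc t)) + \<sigma>M t))" by metis
  have ball: "P t /\<^sub>R (1 + \<delta>M t) \<in> spectral_ball" for t
    by (rule inexact_polar_spectral_ball[OF P(2) delta_nonneg])
  have "norm (P t) \<le> 2 * (real CARD('m) * real CARD('n))" for t
  proof -
    have "norm (P t) = (1 + \<delta>M t) * norm (P t /\<^sub>R (1 + \<delta>M t))" using delta_nonneg[of t] by simp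
    also have "\<dots> \<le> 2 * (real CARD('m) * real CARD('n))"
      using delta_nonneg[of t] delta_less[of t] norm_le_if_spectral_ball[OF ball[of t]]
      by (intro mult_mono) auto
    finally show ?thesis .
  qed
  moreover have "(1 - \<delta>M t) * (nuclear_norm (M (Suc t)) - real CARD('m) * \<delta>M t * (norm (M (Suc t)) + \<sigma>M t))
      \<le> inner (P t) (M (Suc t))" for t
    by (rule inexact_polar_pairing[OF P(2) delta_nonneg delta_less sigma_nonneg])
  ultimately show ?thesis using that[OF P(1) ball] by blast
qed

text \<open>A property that holds almost everywhere holds at times arbitrarily close to 0, and the
  closed graph carries criticality to time 0.\<close>

lemma critical_if_AE:
  assumes g: "continuous_on {0..1} g" and e: "0 < e"
    and crit: "AE t in lebesgue_on {0..1}. t < e \<longrightarrow> 0 \<in> D (g t)"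
  shows "0 \<in> D (g (0::real))"
proof -
  have "\<exists>t. 0 < t \<and> t < inverse (real (Suc k)) \<and> t < 1 \<and> 0 \<in> D (g t)" for k
  proof -
    define A where "A = {0<..<min e (min 1 (inverse (real (Suc k))))}"
    have "open A" "A \<noteq> {}" "A \<subseteq> {0..1}"
      using e by (auto simp: A_def not_le simp del: of_nat_Suc)
    then obtain t where "t \<in> A" "t < e \<longrightarrow> 0 \<in> D (g t)"
      using AE_lebesgue_on_open_ex[OF crit] by blast
    then show ?thesis by (intro exI[of _ t]) (simp add: A_def)
  qed
  then obtain t where t: "\<And>k. 0 < t k" "\<And>k. t k < inverse (real (Suc k))" "\<And>k. t k < 1" "\<And>k. 0 \<in> D (g (t k))"
    by metis
  have "t \<longlonglongrightarrow> 0"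
    by (rule tendsto_sandwich[OF _ _ tendsto_const LIMSEQ_inverse_real_of_nat])
      (use t in \<open>auto intro!: always_eventually less_imp_le\<close>)
  then have "(\<lambda>k. g (t k)) \<longlonglongrightarrow> g 0"
    using t by (intro continuous_on_tendsto_compose[OF g]) (auto intro!: always_eventually less_imp_le)
  then show ?thesis using t(4) by (rule D_closed_graph[OF _ tendsto_const])
qed

end

section \<open>Regime (i)\<close>

lemma lipschitz_fst: "L-lipschitz_on A y \<Longrightarrow> L-lipschitz_on A (\<lambda>t. fst (y t))"
  and lipschitz_snd: "L-lipschitz_on A y \<Longrightarrow> L-lipschitz_on A (\<lambda>t. snd (y t))"
  unfolding lipschitz_on_def by (meson dist_fst_le dist_snd_le order_trans)+

lemma lipschitz_scaleR:
  fixes a :: "real \<Rightarrow> real" and y :: "real \<Rightarrow> 'a::real_normed_vector"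
  assumes a: "L-lipschitz_on {0..1} a" and y: "L'-lipschitz_on {0..1} y"
  obtains C where "C-lipschitz_on {0..1} (\<lambda>t. a t *\<^sub>R y t)"
proof -
  have "bounded (a ` {0..1})" "bounded (y ` {0..1})"
    using a y by (auto intro!: compact_imp_bounded compact_continuous_image lipschitz_on_continuous_on)
  then obtain A B where A: "\<And>t. t \<in> {0..1} \<Longrightarrow> \<bar>a t\<bar> \<le> A" and B: "\<And>t. t \<in> {0..1} \<Longrightarrow> norm (y t) \<le> B"
    unfolding bounded_iff by fastforce
  have A0: "0 \<le> A" and B0: "0 \<le> B" using A[of 0] B[of 0] abs_ge_zero[of "a 0"] norm_ge_zero[of "y 0"]
    by (simp_all add: order_trans[rotated] del: abs_ge_zero norm_ge_zero)
  have L: "0 \<le> L" "0 \<le> L'" using a y lipschitz_on_nonneg by blast+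
  have "(A * L' + L * B)-lipschitz_on {0..1} (\<lambda>t. a t *\<^sub>R y t)"
  proof (rule lipschitz_onI)
    fix s t :: real assume st: "s \<in> {0..1}" "t \<in> {0..1}"
    have "a s *\<^sub>R y s - a t *\<^sub>R y t = a s *\<^sub>R (y s - y t) + (a s - a t) *\<^sub>R y t"
      by (simp add: algebra_simps)
    then have "norm (a s *\<^sub>R y s - a t *\<^sub>R y t) \<le> \<bar>a s\<bar> * norm (y s - y t) + \<bar>a s - a t\<bar> * norm (y t)"
      by (metis norm_scaleR norm_triangle_ineq)
    also have "\<dots> \<le> A * (L' * dist s t) + (L * dist s t) * B"
      using A[OF st(1)] B[OF st(2)] lipschitz_onD[OF a st] lipschitz_onD[OF y st] A0 L
      by (intro add_mono mult_mono) (auto simp: dist_norm)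
    also have "\<dots> = (A * L' + L * B) * dist s t" by (simp add: algebra_simps)
    finally show "dist (a s *\<^sub>R y s) (a t *\<^sub>R y t) \<le> (A * L' + L * B) * dist s t" by (simp add: dist_norm)
  qed (use A0 B0 L in simp)
  then show ?thesis by (rule that)
qed

lemma lipschitz_exp: obtains C where "C-lipschitz_on {0..1} (\<lambda>t::real. exp (k * t))"
proof -
  have "(\<bar>k\<bar> * exp \<bar>k\<bar>)-lipschitz_on {0..1} (\<lambda>t::real. exp (k * t))"
  proof (rule lipschitz_onI)
    fix s t :: real assume "s \<in> {0..1}" "t \<in> {0..1}"
    then have "norm (exp (k * s) - exp (k * t)) \<le> (\<bar>k\<bar> * exp \<bar>k\<bar>) * norm (s - t)"
    proof (rule field_differentiable_bound[rotated 3, where f' = "\<lambda>t. k * exp (k * t)"])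
      fix u :: real assume u: "u \<in> {0..1}"
      show "((\<lambda>t. exp (k * t)) has_field_derivative k * exp (k * u)) (at u within {0..1})"
        by (rule derivative_eq_intros refl)+ simp
      have "k * u \<le> \<bar>k\<bar> * u" using u by (intro mult_right_mono) auto
      also have "\<dots> \<le> \<bar>k\<bar> * 1" using u by (intro mult_left_mono) auto
      finally have "k * u \<le> \<bar>k\<bar>" by simp
      then show "norm (k * exp (k * u)) \<le> \<bar>k\<bar> * exp \<bar>k\<bar>"
        by (simp add: abs_mult mult_left_mono)
    qed simp
    then show "dist (exp (k * s)) (exp (k * t)) \<le> (\<bar>k\<bar> * exp \<bar>k\<bar>) * dist s t" by (simp add: dist_norm)
  qed simp
  then show ?thesis by (rule that)
qed

text \<open>The weight exp (- k t) turns the differential inequality into monotonicity.\<close>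

lemma lipschitz_gronwall:
  fixes g :: "real \<Rightarrow> real"
  assumes g: "L-lipschitz_on {0..1} g"
    and le: "AE t in lebesgue_on {0..1}. \<forall>D. (g has_vector_derivative D) (at t) \<longrightarrow> D \<le> k * g t"
  shows "g 1 \<le> exp k * g 0"
proof -
  obtain C where C: "C-lipschitz_on {0..1} (\<lambda>t. exp (- k * t))" by (rule lipschitz_exp)
  obtain C' where C': "C'-lipschitz_on {0..1} (\<lambda>t. exp (- k * t) *\<^sub>R g t)" by (rule lipschitz_scaleR[OF C g])
  have "exp (- k * 1) *\<^sub>R g 1 \<le> exp (- k * 0) *\<^sub>R g 0"
  proof (rule lipschitz_nonincreasing[OF C'])
    show "AE t in lebesgue_on {0..1}. \<forall>D. ((\<lambda>t. exp (- k * t) *\<^sub>R g t) has_vector_derivative D) (at t) \<longrightarrow> D \<le> 0"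
      using le
    proof (eventually_elim, intro allI impI)
      fix t D assume le: "\<forall>D. (g has_vector_derivative D) (at t) \<longrightarrow> D \<le> k * g t"
        and D: "((\<lambda>t. exp (- k * t) *\<^sub>R g t) has_vector_derivative D) (at t)"
      \<comment> \<open>The monotonicity criterion quantifies over derivatives of the weighted
        product, so the derivative of \<open>g\<close> is recovered by multiplying back.\<close>
      have "((\<lambda>t. exp (k * t) *\<^sub>R (exp (- k * t) *\<^sub>R g t)) has_vector_derivative
          (exp (k * t) *\<^sub>R D + (k * exp (k * t)) *\<^sub>R (exp (- k * t) *\<^sub>R g t))) (at t)"
        by (rule has_vector_derivative_scaleR[OF _ D]) (auto intro!: derivative_eq_intros)
      moreover have "(\<lambda>t. exp (k * t) *\<^sub>R (exp (- k * t) *\<^sub>R g t)) = g"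
        by (simp add: exp_minus fun_eq_iff)
      ultimately have "exp (k * t) *\<^sub>R D + (k * exp (k * t)) *\<^sub>R (exp (- k * t) *\<^sub>R g t) \<le> k * g t"
        using le by metis
      moreover have "(k * exp (k * t)) *\<^sub>R (exp (- k * t) *\<^sub>R g t) = k * g t"
        by (simp add: exp_minus)
      ultimately have "exp (k * t) *\<^sub>R D \<le> 0" by linarith
      then show "D \<le> 0" by (simp add: mult_le_0_iff)
    qed
  qed
  then show ?thesis by (simp add: exp_minus field_simps)
qed

lemma has_vector_derivative_unique:
  "(f has_vector_derivative D) (at t) \<Longrightarrow> (f has_vector_derivative E) (at t) \<Longrightarrow> D = E"
  using vector_derivative_at by blast

lemma lipschitz_constant:
  fixes y :: "real \<Rightarrow> 'a::euclidean_space"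
  assumes y: "L-lipschitz_on {0..1} y"
    and zero: "AE t in lebesgue_on {0..1}. \<forall>D. (y has_vector_derivative D) (at t) \<longrightarrow> D = 0"
  shows "y 1 = y 0"
proof -
  obtain w where w: "w \<in> borel_measurable (lebesgue_on {0..1})"
    "AE t in lebesgue_on {0..1}. 0 < t \<and> t < 1 \<and> (y has_vector_derivative w t) (at t)"
    "has_bochner_integral (lebesgue_on {0..1}) w (y 1 - y 0)"
    by (rule lipschitz_fundamental_theorem[OF y])
  have "AE t in lebesgue_on {0..1}. w t = 0" using w(2) zero by eventually_elim blast
  then have "integral\<^sup>L (lebesgue_on {0..1}) w = 0" by (rule integral_eq_zero_AE)
  then show ?thesis using w(3) by (simp add: has_bochner_integral_iff)
qed

lemma lipschitz_inner:
  assumes "L-lipschitz_on A y"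
  shows "(norm q * L)-lipschitz_on A (\<lambda>t. inner q (y t))"
proof (rule lipschitz_onI)
  fix s t assume st: "s \<in> A" "t \<in> A"
  have "\<bar>inner q (y s) - inner q (y t)\<bar> \<le> norm q * norm (y s - y t)"
    using Cauchy_Schwarz_ineq2[of q "y s - y t"] by (simp add: inner_diff_right)
  also have "\<dots> \<le> norm q * (L * dist s t)"
    using lipschitz_onD[OF assms st] by (intro mult_left_mono) (auto simp: dist_norm)
  finally show "dist (inner q (y s)) (inner q (y t)) \<le> norm q * L * dist s t"
    by (simp add: dist_real_def mult.assoc)
qed (rule mult_nonneg_nonneg[OF norm_ge_zero lipschitz_on_nonneg[OF assms]])

lemma has_bochner_integral_nonpos:
  fixes g :: "'a \<Rightarrow> real"
  assumes i: "has_bochner_integral M g I" and le: "AE t in M. g t \<le> 0"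
  shows "I \<le> 0" and "I = 0 \<Longrightarrow> AE t in M. g t = 0"
proof -
  have n: "AE t in M. 0 \<le> - g t" using le by eventually_elim simp
  have i': "integrable M (\<lambda>t. - g t)" "integral\<^sup>L M (\<lambda>t. - g t) = - I"
    using i by (auto simp: has_bochner_integral_iff)
  show "I \<le> 0" using integral_nonneg_AE[OF n] i'(2) by simp
  assume "I = 0"
  then have "AE t in M. - g t = 0"
    using integral_nonneg_eq_0_iff_AE[OF i'(1) n] i'(2) by simp
  then show "AE t in M. g t = 0" by eventually_elim simp
qed

section \<open>Limit curves in regime (i)\<close>

context magd_bounded_run
begin

text \<open>In regime (i) the state is \<open>(W, S, \<alpha>)\<close>. Since \<open>S - W = (1 - \<alpha>) (S - U)\<close>, the term
  \<open>(1 - \<alpha>) \<langle>G, S - U\<rangle> (S - U)\<close> is \<open>\<langle>G, S - W\<rangle> (S - W) / (1 - \<alpha>)\<close>; it vanishes in the limit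
  \<open>\<alpha> \<rightarrow> 1\<close>, in agreement with the convention \<open>x / 0 = 0\<close>.\<close>

definition velocity1 :: "(real^'n^'m) \<times> (real^'n^'m) \<times> real \<Rightarrow> real^'n^'m \<Rightarrow> (real^'n^'m) \<times> (real^'n^'m) \<times> real" where
  "velocity1 = (\<lambda>(w, s, a) g. (- (a *\<^sub>R g + (\<gamma> * a * inner g (s - w) / (1 - a)) *\<^sub>R (s - w)), - g, - (\<gamma> * a * inner g (s - w))))"

definition field1 :: "(real^'n^'m) \<times> (real^'n^'m) \<times> real \<Rightarrow> ((real^'n^'m) \<times> (real^'n^'m) \<times> real) set" where
  "field1 p = velocity1 p ` D (fst p)"

text \<open>The last condition is the closed trace of S - W = (1 - \<alpha>) (S - U) that can be
  expressed without U; it forces s = w at a = 1.\<close>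

definition states1 :: "((real^'n^'m) \<times> (real^'n^'m) \<times> real) set" where
  "states1 = {(w, s, a). w \<in> K \<and> s \<in> K \<and> 0 \<le> a \<and> a \<le> 1 \<and> norm (s - w) \<le> R * (1 - a)}"

abbreviation selection1 :: "real \<Rightarrow> (real \<Rightarrow> (real^'n^'m) \<times> (real^'n^'m) \<times> real) \<Rightarrow> (real \<Rightarrow> real^'n^'m) \<Rightarrow> real \<Rightarrow> bool" where
  "selection1 T y v t \<equiv> 0 < t \<and> t < 1 \<and> v t \<in> D (fst (y t)) \<and>
     (y has_vector_derivative T *\<^sub>R velocity1 (y t) (v t)) (at t)"

text \<open>For a fixed state the quotient by 1 - a is a scalar factor, also at a = 1. The field
  values thus are linear images of compact convex sets.\<close>

lemma linear_velocity1: "linear (velocity1 p)"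
proof -
  have "linear (\<lambda>g. (- (a *\<^sub>R g + (k * inner g e / m) *\<^sub>R e), - g, - (k * inner g e)))"
    for a k m :: real and e :: "real^'n^'m"
    by (rule linearI) (simp_all add: inner_add_left distrib_left add_divide_distrib
        scaleR_add_left scaleR_add_right scaleR_diff_right mult_ac)
  then show ?thesis by (cases p) (simp add: velocity1_def)
qed

lemma field1_compact: "compact (field1 p)" and field1_convex: "convex (field1 p)"
  unfolding field1_def
  by (intro compact_continuous_image D_compact linear_continuous_on linear_conv_bounded_linear[THEN iffD1] linear_velocity1)
     (intro convex_linear_image linear_velocity1 D_convex)

lemma states1_compact: "compact states1"
proof -
  have "closed {p :: (real^'n^'m) \<times> (real^'n^'m) \<times> real. 0 \<le> snd (snd p) \<and> snd (snd p) \<le> 1 \<and>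
      norm (fst (snd p) - fst p) \<le> R * (1 - snd (snd p))}"
    by (intro closed_Collect_conj closed_Collect_le continuous_intros)
  moreover have "compact (K \<times> K \<times> {0..1::real})" by (intro compact_Times K_compact compact_Icc)
  moreover have "states1 = (K \<times> K \<times> {0..1}) \<inter> {p. 0 \<le> snd (snd p) \<and> snd (snd p) \<le> 1 \<and>
      norm (fst (snd p) - fst p) \<le> R * (1 - snd (snd p))}"
    by (auto simp: states1_def)
  ultimately show ?thesis by (simp add: compact_Int_closed)
qed

text \<open>The S-component has velocity - T v, so \<open>v\<close> is a scalar multiple of the
  measurable derivative and inherits its measurability.\<close>

lemma trajectory1_velocity:
  assumes y: "trajectory field1 X T y" and T: "0 < T"
  obtains v where "v \<in> borel_measurable (lebesgue_on {0..1})"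
    "AE t in lebesgue_on {0..1}. selection1 T y v t"
proof -
  obtain L where L: "L-lipschitz_on {0..1} y" using y by (auto simp: trajectory_def)
  obtain w where w: "w \<in> borel_measurable (lebesgue_on {0..1})"
    "AE t in lebesgue_on {0..1}. 0 < t \<and> t < 1 \<and> (y has_vector_derivative w t) (at t)"
    "has_bochner_integral (lebesgue_on {0..1}) w (y 1 - y 0)"
    by (rule lipschitz_fundamental_theorem[OF L])
  define v where "v t = (- 1 / T) *\<^sub>R fst (snd (w t))" for t
  have "v \<in> borel_measurable (lebesgue_on {0..1})"
    unfolding v_def using w(1) by (intro borel_measurable_scaleR borel_measurable_const
        borel_measurable_continuous_on[where f="\<lambda>p. fst (snd p)"] continuous_intros)
  moreover have "AE t in lebesgue_on {0..1}. selection1 T y v t"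
    using w(2)
  proof eventually_elim
    case (elim t)
    then have "w t \<in> (*\<^sub>R) T ` field1 (y t)" using y unfolding trajectory_def by blast
    then obtain g where g: "g \<in> D (fst (y t))" "w t = T *\<^sub>R velocity1 (y t) g" by (auto simp: field1_def)
    have "v t = g" using T by (simp add: v_def g(2) velocity1_def case_prod_beta)
    then show ?case using g elim by auto
  qed
  ultimately show ?thesis by (rule that)
qed

text \<open>The motion of the mixing weight contributes the square of the pairing of
  \<open>v\<close> with s - w, times - \<gamma> a / (1 - a), so it only helps the descent. The
  convention x / 0 = 0 keeps the sign at a = 1.\<close>

lemma trajectory1_descent:
  assumes y: "trajectory field1 X T y" and X: "X \<subseteq> states1" and T: "0 < T"
  obtains v where "v \<in> borel_measurable (lebesgue_on {0..1})"
    "AE t in lebesgue_on {0..1}. selection1 T y v t"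
    "f (fst (y 1)) \<le> f (fst (y 0))"
    "f (fst (y 1)) = f (fst (y 0)) \<longrightarrow> (AE t in lebesgue_on {0..1}. snd (snd (y t)) = 0 \<or> v t = 0)"
proof -
  obtain v where v: "v \<in> borel_measurable (lebesgue_on {0..1})"
    and ae: "AE t in lebesgue_on {0..1}. selection1 T y v t"
    by (rule trajectory1_velocity[OF y T])
  obtain L where L: "L-lipschitz_on {0..1} y" using y by (auto simp: trajectory_def)
  obtain w where w: "w \<in> borel_measurable (lebesgue_on {0..1})"
    "AE t in lebesgue_on {0..1}. 0 < t \<and> t < 1 \<and> ((\<lambda>t. fst (y t)) has_vector_derivative w t) (at t)"
    "has_bochner_integral (lebesgue_on {0..1}) w (fst (y 1) - fst (y 0))"
    by (rule lipschitz_fundamental_theorem[OF lipschitz_fst[OF L]])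
  have vD: "AE t in lebesgue_on {0..1}. v t \<in> D (fst (y t))" using ae by eventually_elim blast
  have int: "has_bochner_integral (lebesgue_on {0..1}) (\<lambda>t. inner (w t) (v t)) (f (fst (y 1)) - f (fst (y 0)))"
    by (rule conservative_field_lipschitz_chain_rule[OF cons lipschitz_fst[OF L] w(1,2) v vD])
  have le: "AE t in lebesgue_on {0..1}. inner (w t) (v t) \<le> - (T * (snd (snd (y t)) * (norm (v t))\<^sup>2)) \<and> 0 \<le> snd (snd (y t))"
    using ae w(2)
  proof eventually_elim
    case (elim t)
    then have "y t \<in> states1" using y X by (fastforce simp: trajectory_def)
    then obtain p s a where yt: "y t = (p, s, a)" and a: "0 \<le> a" "a \<le> 1" by (auto simp: states1_def)
    have "((\<lambda>t. fst (y t)) has_vector_derivative fst (T *\<^sub>R velocity1 (y t) (v t))) (at t)"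
      using elim(1) by (intro bounded_linear.has_vector_derivative[OF bounded_linear_fst]) auto
    then have wt: "w t = fst (T *\<^sub>R velocity1 (y t) (v t))"
      using elim(2) has_vector_derivative_unique by blast
    define e where "e = s - p"
    have "w t = T *\<^sub>R (- (a *\<^sub>R v t + (\<gamma> * a * inner (v t) e / (1 - a)) *\<^sub>R e))"
      by (simp add: wt yt velocity1_def e_def)
    then have "inner (w t) (v t) = - (T * (a * (norm (v t))\<^sup>2)) - T * (\<gamma> * a * (inner (v t) e)\<^sup>2 / (1 - a))"
      by (simp add: inner_diff_left dot_square_norm power2_eq_square inner_commute[of e] right_diff_distrib mult_ac)
    moreover have "0 \<le> T * (\<gamma> * a * (inner (v t) e)\<^sup>2 / (1 - a))"
      using T gamma_pos a by (intro mult_nonneg_nonneg divide_nonneg_nonneg) auto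
    ultimately show ?case using a by (simp add: yt)
  qed
  have "AE t in lebesgue_on {0..1}. inner (w t) (v t) \<le> 0"
    using le
  proof eventually_elim
    case (elim t)
    have "0 \<le> T * (snd (snd (y t)) * (norm (v t))\<^sup>2)" using T elim by (intro mult_nonneg_nonneg) auto
    then show ?case using elim by linarith
  qed
  note nonpos = has_bochner_integral_nonpos[OF int this]
  have "f (fst (y 1)) \<le> f (fst (y 0))" using nonpos(1) by simp
  moreover have "AE t in lebesgue_on {0..1}. snd (snd (y t)) = 0 \<or> v t = 0"
    if "f (fst (y 1)) = f (fst (y 0))"
  proof -
    have "AE t in lebesgue_on {0..1}. inner (w t) (v t) = 0" using nonpos(2) that by simp
    with le show ?thesis
    proof eventually_elim
      case (elim t)
      then have le0: "T * (snd (snd (y t)) * (norm (v t))\<^sup>2) \<le> 0" by linarith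
      show ?case
      proof (rule ccontr)
        assume "\<not> ?case"
        then have "0 < T * (snd (snd (y t)) * (norm (v t))\<^sup>2)"
          using elim T by (intro mult_pos_pos) auto
        then show False using le0 by simp
      qed
    qed
  qed
  ultimately show ?thesis using that[OF v ae] by blast
qed

text \<open>The derivative of \<alpha> is at most a constant times \<alpha>, so Gronwall keeps a
  zero initial value at zero. The estimate is made at the endpoint; shortened trajectories give the
  other times.\<close>

lemma trajectory1_alpha_zero:
  assumes y: "trajectory field1 X T y" and X: "X \<subseteq> states1" and T: "0 < T" and zero: "snd (snd (y 0)) = 0"
    and t: "t \<in> {0..1}"
  shows "snd (snd (y t)) = 0"
proof -
  have one: "snd (snd (y 1)) = 0"
    if y: "trajectory field1 X T y" and T: "0 < T" and zero: "snd (snd (y 0)) = 0" for y T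
  proof -
    obtain v where "v \<in> borel_measurable (lebesgue_on {0..1})"
      and ae: "AE t in lebesgue_on {0..1}. selection1 T y v t"
      by (rule trajectory1_velocity[OF y T])
    obtain L where L: "L-lipschitz_on {0..1} y" using y by (auto simp: trajectory_def)
    have "snd (snd (y 1)) \<le> exp (T * \<gamma> * (LK * R)) * snd (snd (y 0))"
    proof (rule lipschitz_gronwall[OF lipschitz_snd[OF lipschitz_snd[OF L]]])
      show "AE t in lebesgue_on {0..1}. \<forall>D. ((\<lambda>t. snd (snd (y t))) has_vector_derivative D) (at t) \<longrightarrow>
          D \<le> T * \<gamma> * (LK * R) * snd (snd (y t))"
        using ae
      proof (eventually_elim, intro allI impI)
        fix t d assume elim: "selection1 T y v t"
          and d: "((\<lambda>t. snd (snd (y t))) has_vector_derivative d) (at t)"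
        have "y t \<in> states1" using y X elim by (fastforce simp: trajectory_def)
        then obtain p s a where yt: "y t = (p, s, a)" and a: "0 \<le> a" "a \<le> 1"
          and p: "p \<in> K" and gap: "norm (s - p) \<le> R * (1 - a)" by (auto simp: states1_def)
        have "((\<lambda>t. snd (snd (y t))) has_vector_derivative snd (snd (T *\<^sub>R velocity1 (y t) (v t)))) (at t)"
          using elim by (intro bounded_linear.has_vector_derivative[OF bounded_linear_snd]) auto
        then have "d = snd (snd (T *\<^sub>R velocity1 (y t) (v t)))" using d has_vector_derivative_unique by blast
        then have d_eq: "d = (T * \<gamma> * a) * (- inner (v t) (s - p))" by (simp add: yt velocity1_def)
        have "R * (1 - a) \<le> R" using R_nonneg a by (simp add: mult_left_le)
        then have "norm (v t) * norm (s - p) \<le> LK * R"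
          using D_bound[OF p, of "v t"] elim yt gap LK_nonneg by (intro mult_mono) auto
        then have "- inner (v t) (s - p) \<le> LK * R"
          using Cauchy_Schwarz_ineq2[of "v t" "s - p"] by linarith
        then have "d \<le> (T * \<gamma> * a) * (LK * R)"
          unfolding d_eq using T gamma_pos a by (intro mult_left_mono) auto
        then show "d \<le> T * \<gamma> * (LK * R) * snd (snd (y t))" by (simp add: yt mult_ac)
      qed
    qed
    moreover have "y 1 \<in> states1" using y X by (fastforce simp: trajectory_def)
    ultimately show ?thesis using zero by (auto simp: states1_def)
  qed
  show ?thesis
  proof (cases "t = 0")
    case False
    then have "0 < t" "t \<le> 1" using t by auto
    from one[OF trajectory_restrict[OF y this]] show ?thesis using \<open>0 < t\<close> T zero by simp
  qed (use zero in simp)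
qed

text \<open>Every term in the velocity of W carries the factor \<alpha>, which stays zero.\<close>

lemma trajectory1_W_const:
  assumes y: "trajectory field1 X T y" and X: "X \<subseteq> states1" and T: "0 < T" and zero: "snd (snd (y 0)) = 0"
    and t: "t \<in> {0..1}"
  shows "fst (y t) = fst (y 0)"
proof -
  have one: "fst (y 1) = fst (y 0)"
    if y: "trajectory field1 X T y" and T: "0 < T" and zero: "snd (snd (y 0)) = 0" for y T
  proof -
    obtain v where "v \<in> borel_measurable (lebesgue_on {0..1})"
      and ae: "AE t in lebesgue_on {0..1}. selection1 T y v t"
      by (rule trajectory1_velocity[OF y T])
    obtain L where L: "L-lipschitz_on {0..1} y" using y by (auto simp: trajectory_def)
    show ?thesis
    proof (rule lipschitz_constant[OF lipschitz_fst[OF L]])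
      show "AE t in lebesgue_on {0..1}. \<forall>d. ((\<lambda>t. fst (y t)) has_vector_derivative d) (at t) \<longrightarrow> d = 0"
        using ae
      proof (eventually_elim, intro allI impI)
        fix t d assume elim: "selection1 T y v t"
          and d: "((\<lambda>t. fst (y t)) has_vector_derivative d) (at t)"
        have "((\<lambda>t. fst (y t)) has_vector_derivative fst (T *\<^sub>R velocity1 (y t) (v t))) (at t)"
          using elim by (intro bounded_linear.has_vector_derivative[OF bounded_linear_fst]) auto
        then have "d = fst (T *\<^sub>R velocity1 (y t) (v t))" using d has_vector_derivative_unique by blast
        then show "d = 0"
          using trajectory1_alpha_zero[OF y X T zero, of t] elim by (simp add: velocity1_def case_prod_beta)
      qed
    qed
  qed
  show ?thesis
  proof (cases "t = 0")
    case False
    then have "0 < t" "t \<le> 1" using t by auto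
    from one[OF trajectory_restrict[OF y this]] show ?thesis using \<open>0 < t\<close> T zero by simp
  qed simp
qed

text \<open>Without descent, \<alpha> > 0 at the start forces v = 0 near time 0, so the start would
  be critical. If \<alpha> = 0 at the start, the energy is blind to the motion; W is frozen, and
  \<open>q\<close> separates \<open>D (fst p)\<close> from 0, so S moves against \<open>q\<close> at
  a definite rate and would leave the ball. The duration is chosen for this second case.\<close>

lemma trajectory1_strict:
  assumes X: "X \<subseteq> states1" and zX: "p \<in> X" and noncrit: "0 \<notin> D (fst p)"
  shows "\<exists>T>0. \<forall>y. trajectory field1 X T y \<longrightarrow> y 0 = p \<longrightarrow> f (fst (y 1)) < f (fst (y 0))"
proof -
  obtain q b where q: "q \<noteq> 0" "0 < b" "\<And>g. g \<in> D (fst p) \<Longrightarrow> b < inner q g"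
    using separating_hyperplane_closed_0[OF D_convex compact_imp_closed[OF D_compact] noncrit] by blast
  obtain B where B: "\<And>s. s \<in> K \<Longrightarrow> norm s \<le> B"
    using compact_imp_bounded[OF K_compact] by (auto simp: bounded_iff)
  \<comment> \<open>The drift T b in direction \<open>q\<close> exceeds by 1 the bound 2 |q| |B| on
    the oscillation of \<open>inner q\<close> over \<open>K\<close>.\<close>
  define T where "T = (2 * norm q * \<bar>B\<bar> + 1) / b"
  have T: "0 < T" "T * b = 2 * norm q * \<bar>B\<bar> + 1" using q(2) by (auto simp: T_def add_nonneg_pos)
  have "f (fst (y 1)) < f (fst (y 0))" if y: "trajectory field1 X T y" and y0: "y 0 = p" for y
  proof (rule ccontr)
    assume not: "\<not> f (fst (y 1)) < f (fst (y 0))"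
    obtain v where "v \<in> borel_measurable (lebesgue_on {0..1})"
      and ae: "AE t in lebesgue_on {0..1}. selection1 T y v t"
      and le: "f (fst (y 1)) \<le> f (fst (y 0))"
      and eq: "f (fst (y 1)) = f (fst (y 0)) \<longrightarrow> (AE t in lebesgue_on {0..1}. snd (snd (y t)) = 0 \<or> v t = 0)"
      by (rule trajectory1_descent[OF y X T(1)])
    have ae0: "AE t in lebesgue_on {0..1}. snd (snd (y t)) = 0 \<or> v t = 0" using eq le not by simp
    obtain L where L: "L-lipschitz_on {0..1} y" using y by (auto simp: trajectory_def)
    have y_states: "y t \<in> states1" if "t \<in> {0..1}" for t using y X that by (fastforce simp: trajectory_def)
    have contW: "continuous_on {0..1} (\<lambda>t. fst (y t))"
      using lipschitz_on_continuous_on[OF lipschitz_fst[OF L]] .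
    have conta: "continuous_on {0..1} (\<lambda>t. snd (snd (y t)))"
      using lipschitz_on_continuous_on[OF lipschitz_snd[OF lipschitz_snd[OF L]]] .
    show False
    proof (cases "snd (snd (y 0)) = 0")
      case False
      then have pos: "snd (snd (y 0)) > 0" using y_states[of 0] by (auto simp: states1_def)
      obtain e where e: "e > 0" "\<And>t. t \<in> {0..1} \<Longrightarrow> dist t 0 < e \<Longrightarrow> dist (snd (snd (y t))) (snd (snd (y 0))) < snd (snd (y 0))"
        using conta pos unfolding continuous_on_iff by (metis atLeastAtMost_iff order_refl zero_le_one)
      \<comment> \<open>Up to time \<open>e\<close> the weight \<alpha> stays positive by
        continuity, so vanishing dissipation leaves only v = 0.\<close>
      have "AE t in lebesgue_on {0..1}. t < e \<longrightarrow> 0 \<in> D (fst (y t))"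
        using ae ae0
      proof (eventually_elim, intro impI)
        fix t assume h1: "selection1 T y v t"
          and h2: "snd (snd (y t)) = 0 \<or> v t = 0" and "t < e"
        then have "snd (snd (y t)) \<noteq> 0" using e(2)[of t] by (auto simp: dist_real_def)
        then show "0 \<in> D (fst (y t))" using h1 h2 by auto
      qed
      then have "0 \<in> D (fst (y 0))" using critical_if_AE[OF contW e(1)] by blast
      then show False using noncrit y0 by simp
    next
      case True
      have a0: "snd (snd (y t)) = 0" if "t \<in> {0..1}" for t
        by (rule trajectory1_alpha_zero[OF y X T(1) True that])
      \<comment> \<open>Adding T b t compensates the guaranteed drift, so that plain monotonicity
        yields its size.\<close>
      have "inner q (fst (snd (y 1))) + (T * b) * 1 \<le> inner q (fst (snd (y 0))) + (T * b) * 0"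
      proof (rule lipschitz_nonincreasing)
        show "(norm q * L + \<bar>T * b\<bar> * 1)-lipschitz_on {0..1} (\<lambda>t. inner q (fst (snd (y t))) + (T * b) * t)"
          by (intro lipschitz_on_add lipschitz_inner lipschitz_fst lipschitz_snd L lipschitz_on_cmult_real lipschitz_on_id)
        show "AE t in lebesgue_on {0..1}. \<forall>d. ((\<lambda>t. inner q (fst (snd (y t))) + (T * b) * t) has_vector_derivative d) (at t) \<longrightarrow> d \<le> 0"
          using ae
        proof (eventually_elim, intro allI impI)
          fix t d assume elim: "selection1 T y v t"
            and d: "((\<lambda>t. inner q (fst (snd (y t))) + (T * b) * t) has_vector_derivative d) (at t)"
          have "((\<lambda>t. inner q (fst (snd (y t))) + t *\<^sub>R (T * b)) has_vector_derivative
              inner q (fst (snd (T *\<^sub>R velocity1 (y t) (v t)))) + 1 *\<^sub>R (T * b)) (at t)"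
            using elim by (intro has_vector_derivative_add bounded_linear.has_vector_derivative[OF bounded_linear_inner_right]
                bounded_linear.has_vector_derivative[OF bounded_linear_fst]
                bounded_linear.has_vector_derivative[OF bounded_linear_snd]
                bounded_linear.has_vector_derivative[OF bounded_linear_scaleR_left] has_vector_derivative_id) auto
          then have "d = inner q (fst (snd (T *\<^sub>R velocity1 (y t) (v t)))) + T * b"
            using d has_vector_derivative_unique by (force simp: mult.commute)
          also have "\<dots> = T * (b - inner q (v t))"
            by (simp add: velocity1_def case_prod_beta right_diff_distrib)
          also have "\<dots> \<le> 0"
          proof -
            have "v t \<in> D (fst p)" using elim trajectory1_W_const[OF y X T(1) True, of t] y0 by simp
            then show ?thesis using q(3) T(1) by (intro mult_nonneg_nonpos) (auto simp: less_imp_le)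
          qed
          finally show "d \<le> 0" .
        qed
      qed
      moreover have S_bound: "\<bar>inner q (fst (snd (y t)))\<bar> \<le> norm q * \<bar>B\<bar>" if "t \<in> {0..1}" for t
      proof -
        have "fst (snd (y t)) \<in> K" using y_states[OF that] by (auto simp: states1_def)
        then have "norm (fst (snd (y t))) \<le> \<bar>B\<bar>" using B by fastforce
        then have "norm q * norm (fst (snd (y t))) \<le> norm q * \<bar>B\<bar>" by (rule mult_left_mono) simp
        then show ?thesis using Cauchy_Schwarz_ineq2[of q "fst (snd (y t))"] by linarith
      qed
      have "\<bar>inner q (fst (snd (y 0)))\<bar> \<le> norm q * \<bar>B\<bar>" "\<bar>inner q (fst (snd (y 1)))\<bar> \<le> norm q * \<bar>B\<bar>"
        by (rule S_bound, simp)+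
      ultimately show False using T(2) by (simp add: abs_le_iff)
    qed
  qed
  then show ?thesis using T(1) by blast
qed

end

section \<open>The run as a perturbed Euler scheme in regime (i)\<close>

context magd_bounded_run
begin

lemma W_increment:
  "W (Suc t) - W t = (1 - \<alpha> (Suc t)) *\<^sub>R (U (Suc t) - U t) + \<alpha> (Suc t) *\<^sub>R (S (Suc t) - S t)
     + (\<alpha> (Suc t) - \<alpha> t) *\<^sub>R (S t - U t)"
  by (simp add: W_eq algebra_simps)

lemma velocity1_run:
  "velocity1 (W t, S t, \<alpha> t) (G t) =
    (- (\<alpha> t *\<^sub>R G t + (\<gamma> * \<alpha> t * (1 - \<alpha> t) * inner (G t) (S t - U t)) *\<^sub>R (S t - U t)), - G t,
     \<alpha> t * (1 - \<alpha> t) * - (\<gamma> * inner (G t) (S t - U t)))"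
  unfolding velocity1_def prod.case gap_eq inner_scaleR_right scaleR_scaleR
  using alpha_less[of t] by simp

text \<open>At a = 1 the formula divides by 0. Along the run, the product of the pairing and S - W
  contains two factors 1 - \<alpha>, of which the quotient cancels one; the term is of order 1 -
  \<alpha> and tends to the value 0 of the convention.\<close>

lemma velocity1_tendsto:
  assumes W: "(\<lambda>k. W (m k)) \<longlonglongrightarrow> w" and S: "(\<lambda>k. S (m k)) \<longlonglongrightarrow> s" and a: "(\<lambda>k. \<alpha> (m k)) \<longlonglongrightarrow> a"
    and G: "(\<lambda>k. G (m k)) \<longlonglongrightarrow> g"
  shows "(\<lambda>k. velocity1 (W (m k), S (m k), \<alpha> (m k)) (G (m k))) \<longlonglongrightarrow> velocity1 (w, s, a) g"
proof (cases "a = 1")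
  case False
  then show ?thesis unfolding velocity1_def prod.case
    by (intro tendsto_intros W S a G) auto
next
  case True
  define b where "b k = \<gamma> * \<alpha> (m k) * (1 - \<alpha> (m k)) * inner (G (m k)) (S (m k) - U (m k))" for k
  have b0: "(\<lambda>k. b k *\<^sub>R (S (m k) - U (m k))) \<longlonglongrightarrow> 0"
  proof (rule Lim_null_comparison)
    show "(\<lambda>k. (1 - \<alpha> (m k)) * (\<gamma> * (LK * R) * R)) \<longlonglongrightarrow> 0"
      using tendsto_mult[OF tendsto_diff[OF tendsto_const[of 1] a] tendsto_const[of "\<gamma> * (LK * R) * R"]] True by simp
    have "norm (b k *\<^sub>R (S (m k) - U (m k))) \<le> (1 - \<alpha> (m k)) * (\<gamma> * (LK * R) * R)" for k
    proof -
      have "\<bar>b k\<bar> = \<alpha> (m k) * (1 - \<alpha> (m k)) * (\<gamma> * \<bar>inner (G (m k)) (S (m k) - U (m k))\<bar>)"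
        using gamma_pos alpha_pos[of "m k"] alpha_less[of "m k"] by (simp add: b_def abs_mult)
      also have "\<dots> \<le> 1 * (1 - \<alpha> (m k)) * (\<gamma> * (LK * R))"
        using gamma_pos alpha_pos[of "m k"] alpha_less[of "m k"] pairing_bound[of "m k"]
        by (intro mult_mono) auto
      finally have "\<bar>b k\<bar> * norm (S (m k) - U (m k)) \<le> 1 * (1 - \<alpha> (m k)) * (\<gamma> * (LK * R)) * R"
        using gap_bound[of "m k"] gamma_pos LK_nonneg R_nonneg alpha_less[of "m k"]
        by (intro mult_mono) auto
      then show ?thesis by (simp add: mult_ac)
    qed
    then show "\<forall>\<^sub>F k in sequentially. norm (b k *\<^sub>R (S (m k) - U (m k))) \<le> (1 - \<alpha> (m k)) * (\<gamma> * (LK * R) * R)"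
      by (intro always_eventually) blast
  qed
  have c: "velocity1 (W (m k), S (m k), \<alpha> (m k)) (G (m k)) =
      (- (\<alpha> (m k) *\<^sub>R G (m k) + b k *\<^sub>R (S (m k) - U (m k))), - G (m k),
       - (\<gamma> * \<alpha> (m k) * inner (G (m k)) (S (m k) - W (m k))))" for k
    unfolding velocity1_run b_def gap_eq by simp
  have d: "velocity1 (w, s, a) g = (- (a *\<^sub>R g + 0), - g, - (\<gamma> * a * inner g (s - w)))"
    using True by (simp add: velocity1_def)
  show ?thesis unfolding c d by (intro tendsto_intros W S a G b0)
qed

lemma regime_i_conclusion:
  assumes reg: "regime_i \<eta> \<eta>M \<alpha>"
  shows "convergent (\<lambda>t. f (W t))"
    and "strict_mono s \<Longrightarrow> (W \<circ> s) \<longlonglongrightarrow> X \<Longrightarrow> 0 \<in> D X"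
proof -
  have eta: "\<And>t. 0 < \<eta> t" "\<eta> \<longlonglongrightarrow> 0" "filterlim (\<lambda>n. sum \<eta> {..<n}) at_top sequentially"
    and ratio: "(\<lambda>t. (1 - \<alpha> t) * \<eta>M t / \<eta> t) \<longlonglongrightarrow> 0"
    using reg by (simp_all add: regime_i_def)
  define w where "w t = - (\<gamma> * inner (G t) (S t - U t))" for t
  have w: "\<bar>w t\<bar> \<le> \<gamma> * (LK * R)" for t
    using pairing_bound[of t] gamma_pos by (simp add: w_def abs_mult)
  define \<epsilon> where "\<epsilon> t = (\<alpha> (Suc t) - \<alpha> t) / \<eta> t - \<alpha> t * (1 - \<alpha> t) * w t" for t
  have "- (\<gamma> * \<eta> t * inner (G t) (S t - U t)) = \<eta> t * w t" for t by (simp add: w_def)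
  note inc = alpha_increment[OF eta(1,2) this w]
  have \<epsilon>0: "\<epsilon> \<longlonglongrightarrow> 0" unfolding \<epsilon>_def by (rule inc(1))
  obtain P where P: "\<And>t. U (Suc t) = U t - \<eta>M t *\<^sub>R P t" "\<And>t. norm (P t) \<le> 2 * (real CARD('m) * real CARD('n))"
    by (rule polar_directions) blast
  define CP where "CP = 2 * (real CARD('m) * real CARD('n))"
  \<comment> \<open>The Muon step enters with the weight at t + 1, the hypothesis with the weight at
    t; the factor 2 bridges the two.\<close>
  have ratio': "(\<lambda>t. ((1 - \<alpha> (Suc t)) * \<eta>M t / \<eta> t) *\<^sub>R P t) \<longlonglongrightarrow> 0"
  proof (rule Lim_null_comparison)
    show "(\<lambda>t. 2 * ((1 - \<alpha> t) * \<eta>M t / \<eta> t) * CP) \<longlonglongrightarrow> 0"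
      using tendsto_mult[OF tendsto_mult[OF tendsto_const[of 2] ratio] tendsto_const[of CP]] by simp
    from inc(2) show "\<forall>\<^sub>F t in sequentially. norm (((1 - \<alpha> (Suc t)) * \<eta>M t / \<eta> t) *\<^sub>R P t) \<le> 2 * ((1 - \<alpha> t) * \<eta>M t / \<eta> t) * CP"
    proof eventually_elim
      case (elim t)
      have step: "(1 - \<alpha> (Suc t)) * (\<eta>M t / \<eta> t) \<le> 2 * (1 - \<alpha> t) * (\<eta>M t / \<eta> t)"
        using elim eta(1)[of t] etaM_nonneg[of t] by (intro mult_right_mono) auto
      have "norm (((1 - \<alpha> (Suc t)) * \<eta>M t / \<eta> t) *\<^sub>R P t) = (1 - \<alpha> (Suc t)) * (\<eta>M t / \<eta> t) * norm (P t)"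
        using eta(1)[of t] etaM_nonneg[of t] alpha_less[of "Suc t"] by simp
      also have "\<dots> \<le> 2 * (1 - \<alpha> t) * (\<eta>M t / \<eta> t) * CP"
        using elim eta(1)[of t] etaM_nonneg[of t] alpha_less[of t] P(2)[of t]
        by (intro mult_mono step) (auto simp: CP_def)
      also have "\<dots> = 2 * ((1 - \<alpha> t) * \<eta>M t / \<eta> t) * CP"
        by (simp only: times_divide_eq_right times_divide_eq_left mult.assoc)
      finally show ?case .
    qed
  qed
  have small: "(\<lambda>t. (\<alpha> (Suc t) - \<alpha> t) *\<^sub>R G t) \<longlonglongrightarrow> 0"
  proof (rule Lim_null_comparison)
    show "(\<lambda>t. \<eta> t * (\<bar>\<epsilon> t\<bar> + \<gamma> * (LK * R)) * LK) \<longlonglongrightarrow> 0"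
      using tendsto_mult[OF tendsto_mult[OF eta(2) tendsto_add[OF tendsto_rabs[OF \<epsilon>0] tendsto_const[of "\<gamma> * (LK * R)"]]]
          tendsto_const[of LK]] by simp
    have "norm ((\<alpha> (Suc t) - \<alpha> t) *\<^sub>R G t) \<le> \<eta> t * (\<bar>\<epsilon> t\<bar> + \<gamma> * (LK * R)) * LK" for t
    proof -
      have "\<alpha> (Suc t) - \<alpha> t = \<eta> t * (\<epsilon> t + \<alpha> t * (1 - \<alpha> t) * w t)"
        using eta(1)[of t] by (simp add: \<epsilon>_def)
      moreover have "\<bar>\<epsilon> t + \<alpha> t * (1 - \<alpha> t) * w t\<bar> \<le> \<bar>\<epsilon> t\<bar> + \<gamma> * (LK * R)"
      proof -
        have "\<bar>\<alpha> t * (1 - \<alpha> t) * w t\<bar> \<le> 1 * 1 * (\<gamma> * (LK * R))"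
          unfolding abs_mult using alpha_pos[of t] alpha_less[of t] w[of t] by (intro mult_mono) auto
        then show ?thesis using abs_triangle_ineq[of "\<epsilon> t" "\<alpha> t * (1 - \<alpha> t) * w t"] by linarith
      qed
      ultimately have "\<bar>\<alpha> (Suc t) - \<alpha> t\<bar> \<le> \<eta> t * (\<bar>\<epsilon> t\<bar> + \<gamma> * (LK * R))"
        using eta(1)[of t] by (simp add: abs_mult)
      then have "\<bar>\<alpha> (Suc t) - \<alpha> t\<bar> * norm (G t) \<le> \<eta> t * (\<bar>\<epsilon> t\<bar> + \<gamma> * (LK * R)) * LK"
        using G_bound[of t] by (rule mult_mono) (use eta(1)[of t] gamma_pos LK_nonneg R_nonneg in auto)
      then show ?thesis by simp
    qed
    then show "\<forall>\<^sub>F t in sequentially. norm ((\<alpha> (Suc t) - \<alpha> t) *\<^sub>R G t) \<le> \<eta> t * (\<bar>\<epsilon> t\<bar> + \<gamma> * (LK * R)) * LK"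
      by (intro always_eventually) blast
  qed
  have small2: "(\<lambda>t. \<epsilon> t *\<^sub>R (S t - U t)) \<longlonglongrightarrow> 0"
  proof (rule Lim_null_comparison)
    show "(\<lambda>t. \<bar>\<epsilon> t\<bar> * R) \<longlonglongrightarrow> 0" using tendsto_mult[OF tendsto_rabs[OF \<epsilon>0] tendsto_const[of R]] by simp
    show "\<forall>\<^sub>F t in sequentially. norm (\<epsilon> t *\<^sub>R (S t - U t)) \<le> \<bar>\<epsilon> t\<bar> * R"
      by (intro always_eventually allI) (simp add: mult_left_mono gap_bound)
  qed
  define x where "x t = (W t, S t, \<alpha> t)" for t
  define d where "d t = ((W (Suc t) - W t) /\<^sub>R \<eta> t, - G t, (\<alpha> (Suc t) - \<alpha> t) / \<eta> t)" for t
  \<comment> \<open>The errors are the Muon step, the change of the weight in front of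
    \<open>G t\<close>, and the linearization error of \<alpha>; each tends to 0.\<close>
  have close: "(\<lambda>t. d t - velocity1 (x t) (G t)) \<longlonglongrightarrow> 0"
  proof -
    have "d t - velocity1 (x t) (G t) =
        (- (((1 - \<alpha> (Suc t)) * \<eta>M t / \<eta> t) *\<^sub>R P t) - (\<alpha> (Suc t) - \<alpha> t) *\<^sub>R G t + \<epsilon> t *\<^sub>R (S t - U t), 0, \<epsilon> t)" for t
    proof -
      have "(W (Suc t) - W t) /\<^sub>R \<eta> t = - (((1 - \<alpha> (Suc t)) * \<eta>M t / \<eta> t) *\<^sub>R P t) - \<alpha> (Suc t) *\<^sub>R G t
          + ((\<alpha> (Suc t) - \<alpha> t) / \<eta> t) *\<^sub>R (S t - U t)"
        unfolding W_increment P(1) S_Suc using eta(1)[of t]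
        by (simp add: scaleR_add_right scaleR_diff_right divide_inverse mult_ac)
      moreover have "(\<alpha> (Suc t) - \<alpha> t) / \<eta> t = \<epsilon> t + \<alpha> t * (1 - \<alpha> t) * w t" by (simp add: \<epsilon>_def)
      ultimately show ?thesis
        by (simp add: d_def x_def velocity1_run w_def scaleR_add_left scaleR_diff_left mult_ac)
    qed
    moreover have "(\<lambda>t. (- (((1 - \<alpha> (Suc t)) * \<eta>M t / \<eta> t) *\<^sub>R P t) - (\<alpha> (Suc t) - \<alpha> t) *\<^sub>R G t + \<epsilon> t *\<^sub>R (S t - U t), 0, \<epsilon> t))
        \<longlonglongrightarrow> (- 0 - 0 + 0, 0, 0)"
      by (intro tendsto_intros ratio' small small2 \<epsilon>0)
    ultimately show ?thesis by (simp add: zero_prod_def)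
  qed
  interpret asymptotic_inclusion x d \<eta> field1 states1
  proof
    show "x (Suc n) = x n + \<eta> n *\<^sub>R d n" for n
      using eta(1)[of n] by (simp add: x_def d_def S_Suc)
    show "compact states1" by (rule states1_compact)
    show "x n \<in> states1" for n
      using W_in[of n] S_in alpha_pos[of n] alpha_less[of n] gap_bound[of n]
      unfolding x_def states1_def mem_Collect_eq prod.case gap_eq by (auto simp: mult.commute mult_right_mono)
    show "closed (field1 z)" "convex (field1 z)" for z
      using field1_compact field1_convex compact_imp_closed by blast+
    show "bounded (range d)"
    proof (rule bounded_range_if_asymptotic[OF close])
      have "norm (velocity1 (x t) (G t)) \<le> (LK + \<gamma> * (LK * R) * R) + (LK + \<gamma> * (LK * R))" for t
      proof -
        have b: "\<bar>\<gamma> * \<alpha> t * (1 - \<alpha> t) * inner (G t) (S t - U t)\<bar> \<le> \<gamma> * (LK * R)"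
        proof -
          have "\<bar>\<gamma> * \<alpha> t * (1 - \<alpha> t) * inner (G t) (S t - U t)\<bar> \<le> \<gamma> * 1 * 1 * (LK * R)"
            unfolding abs_mult using gamma_pos alpha_pos[of t] alpha_less[of t] pairing_bound[of t]
            by (intro mult_mono) auto
          then show ?thesis by simp
        qed
        have "norm (velocity1 (x t) (G t)) \<le>
            norm (- (\<alpha> t *\<^sub>R G t + (\<gamma> * \<alpha> t * (1 - \<alpha> t) * inner (G t) (S t - U t)) *\<^sub>R (S t - U t)))
            + (norm (- G t) + norm (\<alpha> t * (1 - \<alpha> t) * - (\<gamma> * inner (G t) (S t - U t))))"
          unfolding x_def velocity1_run by (rule order_trans[OF norm_Pair_le add_left_mono[OF norm_Pair_le]])
        also have "\<dots> \<le> (1 * LK + \<gamma> * (LK * R) * R) + (LK + \<gamma> * (LK * R))"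
        proof (intro add_mono)
          have "norm (\<alpha> t *\<^sub>R G t) \<le> 1 * LK"
            unfolding norm_scaleR using alpha_pos[of t] alpha_less[of t] G_bound[of t] by (intro mult_mono) auto
          moreover have "norm ((\<gamma> * \<alpha> t * (1 - \<alpha> t) * inner (G t) (S t - U t)) *\<^sub>R (S t - U t)) \<le> \<gamma> * (LK * R) * R"
            unfolding norm_scaleR by (rule mult_mono[OF b gap_bound]) (use gamma_pos LK_nonneg R_nonneg in auto)
          ultimately show "norm (- (\<alpha> t *\<^sub>R G t + (\<gamma> * \<alpha> t * (1 - \<alpha> t) * inner (G t) (S t - U t)) *\<^sub>R (S t - U t)))
              \<le> 1 * LK + \<gamma> * (LK * R) * R"
            unfolding norm_minus_cancel by (rule norm_triangle_mono)
          show "norm (- G t) \<le> LK" using G_bound by simp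
          show "norm (\<alpha> t * (1 - \<alpha> t) * - (\<gamma> * inner (G t) (S t - U t))) \<le> \<gamma> * (LK * R)"
            using b by (simp add: mult_ac)
        qed
        finally show ?thesis by simp
      qed
      then show "bounded (range (\<lambda>t. velocity1 (x t) (G t)))" by (auto simp: bounded_iff)
    qed
    fix m p v assume m: "filterlim m at_top sequentially" and x: "(\<lambda>k. x (m k)) \<longlonglongrightarrow> p" and d: "(\<lambda>k. d (m k)) \<longlonglongrightarrow> v"
    obtain w s a where p: "p = (w, s, a)" by (cases p)
    have "bounded (range (\<lambda>k. G (m k)))" using G_bound by (auto simp: bounded_iff)
    then obtain g r where r: "strict_mono (r :: nat \<Rightarrow> nat)" "((\<lambda>k. G (m k)) \<circ> r) \<longlonglongrightarrow> g"
      using bounded_imp_convergent_subsequence by blast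
    have xr: "(\<lambda>k. x (m (r k))) \<longlonglongrightarrow> p" using LIMSEQ_subseq_LIMSEQ[OF x r(1)] by (simp add: o_def)
    have W: "(\<lambda>k. W (m (r k))) \<longlonglongrightarrow> w" and S: "(\<lambda>k. S (m (r k))) \<longlonglongrightarrow> s" and a: "(\<lambda>k. \<alpha> (m (r k))) \<longlonglongrightarrow> a"
      using tendsto_fst[OF xr] tendsto_fst[OF tendsto_snd[OF xr]] tendsto_snd[OF tendsto_snd[OF xr]]
      by (simp_all add: x_def p)
    have G: "(\<lambda>k. G (m (r k))) \<longlonglongrightarrow> g" using r(2) by (simp add: o_def)
    have g: "g \<in> D w" by (rule D_closed_graph[OF W G G_in])
    have vel: "(\<lambda>k. velocity1 (x (m (r k))) (G (m (r k)))) \<longlonglongrightarrow> velocity1 p g"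
      unfolding x_def p by (rule velocity1_tendsto[OF W S a G])
    have "(\<lambda>k. d (m (r k)) - velocity1 (x (m (r k))) (G (m (r k)))) \<longlonglongrightarrow> 0"
      by (rule filterlim_compose[OF close filterlim_compose[OF m filterlim_subseq[OF r(1)]]])
    from tendsto_add[OF this vel] have "(\<lambda>k. d (m (r k))) \<longlonglongrightarrow> velocity1 p g" by simp
    moreover have "(\<lambda>k. d (m (r k))) \<longlonglongrightarrow> v" using LIMSEQ_subseq_LIMSEQ[OF d r(1)] by (simp add: o_def)
    ultimately have "v = velocity1 p g" using LIMSEQ_unique by blast
    then show "v \<in> field1 p" using g by (auto simp: field1_def p)
  qed (use eta in auto)
  have E: "continuous_on states1 (\<lambda>p. f (fst p))"
    by (rule continuous_on_compose2[OF f_continuous]) (auto intro!: continuous_intros)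
  have "\<exists>c\<in>f ` {X. 0 \<in> D X}. (\<lambda>n. f (fst (x n))) \<longlonglongrightarrow> c"
  proof (rule lyapunov_convergence[OF E sard])
    show "f (fst (y 1)) \<le> f (fst (y 0))" if "0 < T" "trajectory field1 limit_set T y" for T y
      by (rule trajectory1_descent[OF that(2) limit_set_subset that(1)])
    show "\<exists>T>0. \<forall>y. trajectory field1 limit_set T y \<longrightarrow> y 0 = p \<longrightarrow> f (fst (y 1)) < f (fst (y 0))"
      if "p \<in> limit_set" "f (fst p) \<notin> f ` {X. 0 \<in> D X}" for p
      using that by (intro trajectory1_strict[OF limit_set_subset]) auto
  qed
  then obtain c where lim: "(\<lambda>n. f (fst (x n))) \<longlonglongrightarrow> c" by blast
  then show "convergent (\<lambda>t. f (W t))" by (auto simp: x_def convergent_def)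
  assume s: "strict_mono s" "(W \<circ> s) \<longlonglongrightarrow> X"
  obtain p q where p: "strict_mono (p :: nat \<Rightarrow> nat)" "(\<lambda>k. x (s (p k))) \<longlonglongrightarrow> q" "q \<in> limit_set"
    by (rule cluster_point_extend[OF s(1)])
  have "(\<lambda>k. W (s (p k))) \<longlonglongrightarrow> fst q" using tendsto_fst[OF p(2)] by (simp add: x_def)
  then have q: "fst q = X" using LIMSEQ_subseq_LIMSEQ[OF s(2) p(1)] LIMSEQ_unique by (fastforce simp: o_def)
  show "0 \<in> D X"
  proof (rule ccontr)
    assume "0 \<notin> D X"
    then obtain T where T: "T > 0" "\<And>y. trajectory field1 limit_set T y \<Longrightarrow> y 0 = q \<Longrightarrow> f (fst (y 1)) < f (fst (y 0))"
      using trajectory1_strict[OF limit_set_subset p(3)] q by blast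
    \<comment> \<open>A noncritical cluster point would start a strictly descending curve inside
      \<open>limit_set\<close>, where the Lyapunov function is constant.\<close>
    obtain y where y: "trajectory field1 limit_set T y" "y 0 = q" by (rule limit_set_trajectory[OF p(3) T(1)])
    have "y 0 \<in> limit_set" "y 1 \<in> limit_set" using y(1) by (auto simp: trajectory_def)
    then have "f (fst (y 1)) = f (fst (y 0))" using limit_set_level[OF E lim] by simp
    then show False using T(2)[OF y] by simp
  qed
qed

end

section \<open>Regime (ii)\<close>

lemma nuclear_norm_lipschitz_on:
  "(real CARD('m) * real CARD('n))-lipschitz_on A (nuclear_norm :: real^'n^'m \<Rightarrow> real)"
  using nuclear_norm_lipschitz by (intro lipschitz_onI) (auto simp: dist_real_def dist_norm)

lemma continuous_on_nuclear_norm: "continuous_on A (nuclear_norm :: real^'n^'m \<Rightarrow> real)"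
  by (rule lipschitz_on_continuous_on[OF nuclear_norm_lipschitz_on])

text \<open>The subdifferential of the nuclear norm in dual form. At X = 0 it is the whole ball,
  which leaves the limit direction free where the momentum vanishes.\<close>

definition nuclear_subgradients :: "real^'n^'m \<Rightarrow> (real^'n^'m) set" where
  "nuclear_subgradients X = {P \<in> spectral_ball. inner P X = nuclear_norm X}"

lemma nuclear_subgradients_compact: "compact (nuclear_subgradients X)"
proof -
  have "closed {P. inner P X = nuclear_norm X}" by (intro closed_Collect_eq continuous_intros)
  then have "compact (spectral_ball \<inter> {P. inner P X = nuclear_norm X})"
    by (rule compact_Int_closed[OF compact_spectral_ball])
  then show ?thesis by (simp add: nuclear_subgradients_def Collect_conj_eq)
qed

lemma nuclear_subgradients_convex: "convex (nuclear_subgradients X)"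
proof -
  have "convex (spectral_ball \<inter> {P. inner X P = nuclear_norm X})"
    by (intro convex_Int convex_spectral_ball convex_hyperplane)
  moreover have "nuclear_subgradients X = spectral_ball \<inter> {P. inner X P = nuclear_norm X}"
    by (auto simp: nuclear_subgradients_def inner_commute)
  ultimately show ?thesis by simp
qed

text \<open>The difference \<open>nuclear_norm (m s) - P \<bullet> m s\<close> is nonnegative and vanishes at \<open>s = t\<close>.\<close>

lemma nuclear_norm_chain_rule:
  assumes P: "P \<in> nuclear_subgradients (m t)" and m: "(m has_vector_derivative D) (at t)"
    and n: "((\<lambda>s. nuclear_norm (m s)) has_vector_derivative E) (at t)"
  shows "E = inner P D"
proof -
  have "((\<lambda>s. nuclear_norm (m s) - inner P (m s)) has_vector_derivative E - inner P D) (at t)"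
    by (intro has_vector_derivative_diff n bounded_linear.has_vector_derivative[OF bounded_linear_inner_right] m)
  then have "DERIV (\<lambda>s. nuclear_norm (m s) - inner P (m s)) t :> E - inner P D"
    by (simp add: has_real_derivative_iff_has_vector_derivative)
  moreover have "nuclear_norm (m t) - inner P (m t) \<le> nuclear_norm (m s) - inner P (m s)" for s
    using P nuclear_norm_upper[of P "m s"] by (simp add: nuclear_subgradients_def)
  ultimately have "E - inner P D = 0" by (intro DERIV_local_min[of _ _ _ 1]) auto
  then show ?thesis by simp
qed

lemma continuous_zero_if_AE:
  fixes g :: "real \<Rightarrow> real"
  assumes g: "continuous_on {0..1} g" and ae: "AE t in lebesgue_on {0..1}. g t = 0" and t: "t \<in> {0..1}"
  shows "g t = 0"
proof (rule ccontr)
  assume "g t \<noteq> 0"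
  then obtain e where e: "e > 0" "\<And>s. s \<in> {0..1} \<Longrightarrow> dist s t < e \<Longrightarrow> dist (g s) (g t) < \<bar>g t\<bar>"
    using g t unfolding continuous_on_iff by (metis zero_less_abs_iff)
  define A where "A = {max 0 (t - e)<..<min 1 (t + e)}"
  have "max 0 (t - e) < min 1 (t + e)" using t e(1) by auto
  then have "open A" "A \<noteq> {}" "A \<subseteq> {0..1}" by (auto simp: A_def)
  then obtain s where "s \<in> A" and s: "g s = 0"
    using AE_lebesgue_on_open_ex[OF ae] by blast
  then have "dist (g s) (g t) < \<bar>g t\<bar>" by (intro e(2)) (auto simp: dist_real_def A_def)
  then show False using s by (simp add: dist_real_def)
qed

section \<open>Limit curves in regime (ii)\<close>

locale magd_momentum_run = magd_bounded_run f D W0 c K W G S M U \<eta> \<beta>M \<eta>M \<delta>M \<sigma>M z \<alpha> \<gamma> \<rho> rad LK R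
  for f :: "real^'n^'m \<Rightarrow> real"
    and D :: "real^'n^'m \<Rightarrow> (real^'n^'m) set"
    and W0 c :: "real^'n^'m"
    and K :: "(real^'n^'m) set"
    and W G S M U :: "nat \<Rightarrow> real^'n^'m"
    and \<eta> \<beta>M \<eta>M \<delta>M \<sigma>M z \<alpha> :: "nat \<Rightarrow> real"
    and \<gamma> \<rho> rad LK R :: real +
  fixes \<tau> r :: real
  assumes tau_pos: "\<tau> > 0" and r_nonneg: "r \<ge> 0"
    and delta_lim: "\<delta>M \<longlonglongrightarrow> 0" and delta_sigma_lim: "(\<lambda>t. \<delta>M t * \<sigma>M t) \<longlonglongrightarrow> 0"
    and beta_eq: "\<And>t. \<beta>M t = 1 - \<tau> * \<eta>M t"
    and etaM_pos: "\<And>t. \<eta>M t > 0" and etaM_lim: "\<eta>M \<longlonglongrightarrow> 0"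
    and etaM_sum: "filterlim (\<lambda>n. \<Sum>t<n. \<eta>M t) at_top sequentially"
    and ratio_lim: "(\<lambda>t. \<eta> t / \<eta>M t) \<longlonglongrightarrow> r"
    and coupling: "\<gamma> * r * LK * R \<le> \<tau>"
    and alpha_limsup: "r = 0 \<Longrightarrow> limsup (\<lambda>t. ereal (\<alpha> t)) < 1"
begin

text \<open>The limsup bounds \<alpha> only eventually, but the finitely many earlier values are
  below 1 as well. A closed bound valid from the start passes to all limit states.\<close>

definition alpha_max :: real where
  "alpha_max = (SOME b. b \<le> 1 \<and> (\<forall>t. \<alpha> t \<le> b) \<and> (r = 0 \<longrightarrow> b < 1))"

lemma alpha_max: "alpha_max \<le> 1" "\<alpha> t \<le> alpha_max" "r = 0 \<Longrightarrow> alpha_max < 1"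
proof -
  have "\<exists>b\<le>1. (\<forall>t. \<alpha> t \<le> b) \<and> (r = 0 \<longrightarrow> b < 1)"
  proof (cases "r = 0")
    case False
    then show ?thesis using alpha_less less_imp_le by (intro exI[of _ 1]) auto
  next
    case True
    obtain b where b: "limsup (\<lambda>t. ereal (\<alpha> t)) < ereal b" "b < 1"
      using ereal_dense2[OF alpha_limsup[OF True]] by (auto simp: one_ereal_def)
    then have "\<forall>\<^sub>F t in sequentially. ereal (\<alpha> t) < ereal b" by (intro Limsup_lessD)
    then obtain N where N: "\<And>t. t \<ge> N \<Longrightarrow> \<alpha> t < b" by (auto simp: eventually_sequentially)
    define B where "B = Max (insert b (\<alpha> ` {..<N}))"
    have "\<alpha> t \<le> B" for t
    proof (cases "t < N")
      case True
      then show ?thesis unfolding B_def by (intro Max_ge) auto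
    next
      case False
      then have "\<alpha> t \<le> b" using N[of t] by simp
      also have "b \<le> B" unfolding B_def by (intro Max_ge) auto
      finally show ?thesis .
    qed
    moreover have "B < 1" unfolding B_def using b(2) alpha_less by (subst Max_less_iff) auto
    ultimately show ?thesis by (intro exI[of _ B]) auto
  qed
  then have *: "alpha_max \<le> 1 \<and> (\<forall>t. \<alpha> t \<le> alpha_max) \<and> (r = 0 \<longrightarrow> alpha_max < 1)"
    unfolding alpha_max_def by (rule someI_ex)
  show "alpha_max \<le> 1" "\<alpha> t \<le> alpha_max" "r = 0 \<Longrightarrow> alpha_max < 1" using * by blast+
qed

definition position :: "(real^'n^'m) \<times> (real^'n^'m) \<times> (real^'n^'m) \<times> real \<Rightarrow> real^'n^'m" where
  "position p = (1 - snd (snd (snd p))) *\<^sub>R fst p + snd (snd (snd p)) *\<^sub>R fst (snd p)"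

text \<open>\<open>q\<close> pairs a subgradient of the nuclear norm with an element of
  \<open>D\<close>. For a fixed state the dependence on \<open>q\<close> is affine, so convexity
  survives.\<close>

definition velocity2 :: "(real^'n^'m) \<times> (real^'n^'m) \<times> (real^'n^'m) \<times> real \<Rightarrow> (real^'n^'m) \<times> (real^'n^'m) \<Rightarrow>
    (real^'n^'m) \<times> (real^'n^'m) \<times> (real^'n^'m) \<times> real" where
  "velocity2 = (\<lambda>(u, s, m, a) q. (- fst q, - (r *\<^sub>R snd q), \<tau> *\<^sub>R (snd q - m), - (\<gamma> * r * a * (1 - a) * inner (snd q) (s - u))))"

definition field2 :: "(real^'n^'m) \<times> (real^'n^'m) \<times> (real^'n^'m) \<times> real \<Rightarrow>
    ((real^'n^'m) \<times> (real^'n^'m) \<times> (real^'n^'m) \<times> real) set" where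
  "field2 p = velocity2 p ` (nuclear_subgradients (fst (snd (snd p))) \<times> D (position p))"

definition states2 :: "((real^'n^'m) \<times> (real^'n^'m) \<times> (real^'n^'m) \<times> real) set" where
  "states2 = {(u, s, m, a). u \<in> K \<and> s \<in> K \<and> norm m \<le> LK \<and> 0 \<le> a \<and> a \<le> alpha_max \<and> norm (s - u) \<le> R}"

text \<open>W contributes - (1 - \<alpha>) times the pairing of the subgradient P with v, while the
  nuclear norm of M changes at \<tau> times that pairing minus \<tau> times the norm. The weight (1
  - \<alpha>) / \<tau> makes the pairings, which have no sign, cancel.\<close>

definition energy :: "(real^'n^'m) \<times> (real^'n^'m) \<times> (real^'n^'m) \<times> real \<Rightarrow> real" where
  "energy p = f (position p) + (1 - snd (snd (snd p))) * nuclear_norm (fst (snd (snd p))) / \<tau>"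

abbreviation selection2 :: "real \<Rightarrow> (real \<Rightarrow> (real^'n^'m) \<times> (real^'n^'m) \<times> (real^'n^'m) \<times> real) \<Rightarrow>
    (real \<Rightarrow> real^'n^'m) \<Rightarrow> real \<Rightarrow> bool" where
  "selection2 T y v t \<equiv> 0 < t \<and> t < 1 \<and> v t \<in> D (position (y t)) \<and>
     (\<exists>P\<in>nuclear_subgradients (fst (snd (snd (y t)))).
       (y has_vector_derivative T *\<^sub>R velocity2 (y t) (P, v t)) (at t))"

lemma field2_compact: "compact (field2 p)"
proof -
  have "continuous_on A (velocity2 p)" for A
    by (cases p) (auto simp: velocity2_def intro!: continuous_intros)
  then show ?thesis unfolding field2_def
    by (intro compact_continuous_image compact_Times nuclear_subgradients_compact D_compact)
qed

lemma field2_convex: "convex (field2 p)"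
proof -
  obtain u s m a where p: "p = (u, s, m, a)" by (cases p)
  define l :: "(real^'n^'m) \<times> (real^'n^'m) \<Rightarrow> (real^'n^'m) \<times> (real^'n^'m) \<times> (real^'n^'m) \<times> real"
    where "l q = (- fst q, - (r *\<^sub>R snd q), \<tau> *\<^sub>R snd q, - (\<gamma> * r * a * (1 - a) * inner (snd q) (s - u)))" for q
  have "linear l"
    by (rule linearI) (simp_all add: l_def inner_add_left distrib_left scaleR_add_right mult_ac)
  then have "convex ((+) (0, 0, - (\<tau> *\<^sub>R m), 0) ` l ` (nuclear_subgradients m \<times> D (position p)))"
    by (intro convex_translation convex_linear_image convex_Times nuclear_subgradients_convex D_convex)
  moreover have "field2 p = (+) (0, 0, - (\<tau> *\<^sub>R m), 0) ` l ` (nuclear_subgradients m \<times> D (position p))"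
    unfolding field2_def image_image
    by (intro image_cong) (auto simp: p velocity2_def l_def scaleR_diff_right)
  ultimately show ?thesis by simp
qed

lemma states2_compact: "compact states2"
proof -
  have "closed {p :: (real^'n^'m) \<times> (real^'n^'m) \<times> (real^'n^'m) \<times> real. norm (fst (snd p) - fst p) \<le> R}"
    by (intro closed_Collect_le continuous_intros)
  moreover have "compact (K \<times> K \<times> cball (0 :: real^'n^'m) LK \<times> {0..alpha_max})"
    by (intro compact_Times K_compact compact_Icc compact_cball)
  moreover have "states2 = (K \<times> K \<times> cball 0 LK \<times> {0..alpha_max}) \<inter> {p. norm (fst (snd p) - fst p) \<le> R}"
    by (auto simp: states2_def)
  ultimately show ?thesis by (simp add: compact_Int_closed)
qed

lemma continuous_on_position: "continuous_on A position"
  unfolding position_def by (intro continuous_intros)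

lemma continuous_on_energy: "continuous_on A energy"
  unfolding energy_def using tau_pos
  by (intro continuous_intros continuous_on_compose2[OF f_continuous[of UNIV] continuous_on_position]
      continuous_on_compose2[OF continuous_on_nuclear_norm[of UNIV]]) auto

lemma position_in: "p \<in> states2 \<Longrightarrow> position p \<in> K"
  using alpha_max(1) by (auto simp: states2_def position_def intro!: convexD[OF K_convex])

text \<open>As r may be 0, the motion of S need not determine \<open>v\<close>; the momentum
  velocity T \<tau> (v - m) does, since \<tau> > 0.\<close>

lemma trajectory2_velocity:
  assumes y: "trajectory field2 X T y" and T: "0 < T"
  obtains v where "v \<in> borel_measurable (lebesgue_on {0..1})"
    "AE t in lebesgue_on {0..1}. selection2 T y v t"
proof -
  obtain L where L: "L-lipschitz_on {0..1} y" using y by (auto simp: trajectory_def)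
  obtain w where w: "w \<in> borel_measurable (lebesgue_on {0..1})"
    "AE t in lebesgue_on {0..1}. 0 < t \<and> t < 1 \<and> (y has_vector_derivative w t) (at t)"
    "has_bochner_integral (lebesgue_on {0..1}) w (y 1 - y 0)"
    by (rule lipschitz_fundamental_theorem[OF L])
  define v where "v t = fst (snd (snd (y t))) + (1 / (T * \<tau>)) *\<^sub>R fst (snd (snd (w t)))" for t
  have "v \<in> borel_measurable (lebesgue_on {0..1})"
    unfolding v_def
  proof (intro borel_measurable_add borel_measurable_scaleR borel_measurable_const)
    have "continuous_on {0..1} (\<lambda>t. fst (snd (snd (y t))))"
      by (intro continuous_intros lipschitz_on_continuous_on[OF L])
    then show "(\<lambda>t. fst (snd (snd (y t)))) \<in> borel_measurable (lebesgue_on {0..1})"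
      by (intro continuous_imp_measurable_on_sets_lebesgue) auto
    show "(\<lambda>t. fst (snd (snd (w t)))) \<in> borel_measurable (lebesgue_on {0..1})"
      by (rule borel_measurable_continuous_on[where f="\<lambda>p. fst (snd (snd p))", OF _ w(1)]) (intro continuous_intros)
  qed
  moreover have "AE t in lebesgue_on {0..1}. selection2 T y v t"
    using w(2)
  proof eventually_elim
    case (elim t)
    then have "w t \<in> (*\<^sub>R) T ` field2 (y t)" using y unfolding trajectory_def by blast
    then obtain P g where g: "P \<in> nuclear_subgradients (fst (snd (snd (y t))))" "g \<in> D (position (y t))"
        "w t = T *\<^sub>R velocity2 (y t) (P, g)" by (auto simp: field2_def)
    have "fst (snd (snd (w t))) = (T * \<tau>) *\<^sub>R (g - fst (snd (snd (y t))))"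
      by (simp add: g(3) velocity2_def case_prod_beta)
    then have "v t = g" using T tau_pos by (simp add: v_def)
    then show ?case using g elim by auto
  qed
  ultimately show ?thesis by (rule that)
qed

lemma trajectory2_descent:
  assumes y: "trajectory field2 X T y" and X: "X \<subseteq> states2" and T: "0 < T"
  obtains v where "v \<in> borel_measurable (lebesgue_on {0..1})"
    "AE t in lebesgue_on {0..1}. selection2 T y v t"
    "energy (y 1) \<le> energy (y 0)"
    "energy (y 1) = energy (y 0) \<longrightarrow> (AE t in lebesgue_on {0..1}.
      (1 - snd (snd (snd (y t))))\<^sup>2 * nuclear_norm (fst (snd (snd (y t)))) = 0 \<and>
      snd (snd (snd (y t))) * r * (norm (v t))\<^sup>2 = 0)"
proof -
  obtain v where v: "v \<in> borel_measurable (lebesgue_on {0..1})"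
    and ae: "AE t in lebesgue_on {0..1}. selection2 T y v t"
    by (rule trajectory2_velocity[OF y T])
  obtain L where L: "L-lipschitz_on {0..1} y" using y by (auto simp: trajectory_def)
  define a where "a t = snd (snd (snd (y t)))" for t
  define m where "m t = fst (snd (snd (y t)))" for t
  have La: "L-lipschitz_on {0..1} a" and Lm: "L-lipschitz_on {0..1} m"
    and Lu: "L-lipschitz_on {0..1} (\<lambda>t. fst (y t))" and Ls: "L-lipschitz_on {0..1} (\<lambda>t. fst (snd (y t)))"
    unfolding a_def m_def by (intro lipschitz_fst lipschitz_snd L)+
  have La': "(0 + L)-lipschitz_on {0..1} (\<lambda>t. 1 - a t)"
    by (intro lipschitz_on_diff lipschitz_on_constant La)
  obtain Lp where Lp: "Lp-lipschitz_on {0..1} (\<lambda>t. position (y t))"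
  proof -
    obtain C1 where C1: "C1-lipschitz_on {0..1} (\<lambda>t. (1 - a t) *\<^sub>R fst (y t))"
      by (rule lipschitz_scaleR[OF La' Lu])
    obtain C2 where C2: "C2-lipschitz_on {0..1} (\<lambda>t. a t *\<^sub>R fst (snd (y t)))"
      by (rule lipschitz_scaleR[OF La Ls])
    have "(C1 + C2)-lipschitz_on {0..1} (\<lambda>t. position (y t))"
      using lipschitz_on_add[OF C1 C2] by (simp add: position_def a_def)
    then show ?thesis by (rule that)
  qed
  have Ln: "(real CARD('m) * real CARD('n) * L)-lipschitz_on {0..1} (\<lambda>t. nuclear_norm (m t))"
    by (rule lipschitz_on_compose2[OF Lm nuclear_norm_lipschitz_on])
  obtain Lq where Lq: "Lq-lipschitz_on {0..1} (\<lambda>t. (1 - a t) *\<^sub>R nuclear_norm (m t))"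
    by (rule lipschitz_scaleR[OF La' Ln])
  obtain wp where wp: "wp \<in> borel_measurable (lebesgue_on {0..1})"
    "AE t in lebesgue_on {0..1}. 0 < t \<and> t < 1 \<and> ((\<lambda>t. position (y t)) has_vector_derivative wp t) (at t)"
    "has_bochner_integral (lebesgue_on {0..1}) wp (position (y 1) - position (y 0))"
    by (rule lipschitz_fundamental_theorem[OF Lp])
  \<comment> \<open>The chain rule for subgradients concerns the nuclear norm alone, whose
    differentiability does not follow from that of the product with 1 - a where a = 1.\<close>
  obtain wn where wn: "wn \<in> borel_measurable (lebesgue_on {0..1})"
    "AE t in lebesgue_on {0..1}. 0 < t \<and> t < 1 \<and> ((\<lambda>t. nuclear_norm (m t)) has_vector_derivative wn t) (at t)"
    "has_bochner_integral (lebesgue_on {0..1}) wn (nuclear_norm (m 1) - nuclear_norm (m 0))"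
    by (rule lipschitz_fundamental_theorem[OF Ln])
  obtain wq where wq: "wq \<in> borel_measurable (lebesgue_on {0..1})"
    "AE t in lebesgue_on {0..1}. 0 < t \<and> t < 1 \<and> ((\<lambda>t. (1 - a t) *\<^sub>R nuclear_norm (m t)) has_vector_derivative wq t) (at t)"
    "has_bochner_integral (lebesgue_on {0..1}) wq ((1 - a 1) *\<^sub>R nuclear_norm (m 1) - (1 - a 0) *\<^sub>R nuclear_norm (m 0))"
    by (rule lipschitz_fundamental_theorem[OF Lq])
  have vD: "AE t in lebesgue_on {0..1}. v t \<in> D (position (y t))" using ae by eventually_elim blast
  have "has_bochner_integral (lebesgue_on {0..1}) (\<lambda>t. inner (wp t) (v t)) (f (position (y 1)) - f (position (y 0)))"
    by (rule conservative_field_lipschitz_chain_rule[OF cons Lp wp(1,2) v vD])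
  from has_bochner_integral_add[OF this has_bochner_integral_mult_right[OF wq(3), of "1 / \<tau>"]]
  have int: "has_bochner_integral (lebesgue_on {0..1}) (\<lambda>t. inner (wp t) (v t) + 1 / \<tau> * wq t) (energy (y 1) - energy (y 0))"
    by (simp add: energy_def a_def m_def diff_divide_distrib algebra_simps)
  define q where "q t = (1 - a t)\<^sup>2 * nuclear_norm (m t) + a t * r * (norm (v t))\<^sup>2" for t
  have le: "AE t in lebesgue_on {0..1}. inner (wp t) (v t) + 1 / \<tau> * wq t \<le> - (T * q t) \<and> 0 \<le> a t"
    using ae wp(2) wn(2) wq(2)
  proof eventually_elim
    case (elim t)
    then have yX: "y t \<in> states2" using y X by (fastforce simp: trajectory_def)
    then obtain u s where yt: "y t = (u, s, m t, a t)" by (cases "y t") (auto simp: a_def m_def)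
    have u: "fst (y t) = u" and s: "fst (snd (y t)) = s" by (simp_all add: yt)
    have at: "0 \<le> a t" "a t \<le> 1" and gap: "norm (s - u) \<le> R"
      using yX alpha_max(1) by (auto simp: states2_def yt)
    obtain P where P: "P \<in> nuclear_subgradients (m t)"
      and yd: "(y has_vector_derivative T *\<^sub>R velocity2 (y t) (P, v t)) (at t)"
      using elim(1) by (auto simp: m_def)
    define e where "e = s - u"
    define x where "x = inner (v t) e"
    have vel: "velocity2 (y t) (P, v t) = (- P, - (r *\<^sub>R v t), \<tau> *\<^sub>R (v t - m t), - (\<gamma> * r * a t * (1 - a t) * x))"
      by (simp add: yt velocity2_def x_def e_def)
    have m_fun: "m = (\<lambda>t. fst (snd (snd (y t))))" and a_fun: "a = (\<lambda>t. snd (snd (snd (y t))))"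
      by (simp_all add: fun_eq_iff m_def a_def)
    note d1 = bounded_linear.has_vector_derivative[OF bounded_linear_fst]
      and d2 = bounded_linear.has_vector_derivative[OF bounded_linear_snd]
    have ud: "((\<lambda>t. fst (y t)) has_vector_derivative T *\<^sub>R (- P)) (at t)"
      using d1[OF yd] by (simp add: vel)
    have sd: "((\<lambda>t. fst (snd (y t))) has_vector_derivative T *\<^sub>R (- (r *\<^sub>R v t))) (at t)"
      using d1[OF d2[OF yd]] by (simp add: vel)
    have "((\<lambda>t. fst (snd (snd (y t)))) has_vector_derivative T *\<^sub>R (\<tau> *\<^sub>R (v t - m t))) (at t)"
      using d1[OF d2[OF d2[OF yd]]] by (simp add: vel)
    then have md: "(m has_vector_derivative T *\<^sub>R (\<tau> *\<^sub>R (v t - m t))) (at t)"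
      by (simp only: m_fun[symmetric])
    have "((\<lambda>t. snd (snd (snd (y t)))) has_vector_derivative T * - (\<gamma> * r * a t * (1 - a t) * x)) (at t)"
      using d2[OF d2[OF d2[OF yd]]] by (simp add: vel)
    then have ad: "(a has_vector_derivative T * - (\<gamma> * r * a t * (1 - a t) * x)) (at t)"
      by (simp only: a_fun[symmetric])
    then have ad': "(a has_real_derivative T * - (\<gamma> * r * a t * (1 - a t) * x)) (at t)"
      by (simp add: has_real_derivative_iff_has_vector_derivative)
    then have ad'': "((\<lambda>t. 1 - a t) has_real_derivative - (T * - (\<gamma> * r * a t * (1 - a t) * x))) (at t)"
      by (auto intro!: derivative_eq_intros)
    \<comment> \<open>\<open>P\<close> is chosen separately at each time. Its measurability does not
      arise, because the integrand is expressed by \<open>wp\<close>, \<open>wq\<close> and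
      \<open>v\<close>.\<close>
    have n: "wn t = inner P (T *\<^sub>R (\<tau> *\<^sub>R (v t - m t)))"
      using nuclear_norm_chain_rule[OF P md] elim(3) by blast
    have Pm: "inner P (m t) = nuclear_norm (m t)" using P by (simp add: nuclear_subgradients_def)
    have "((\<lambda>t. (1 - a t) *\<^sub>R nuclear_norm (m t)) has_vector_derivative
        ((1 - a t) *\<^sub>R wn t + (- (T * - (\<gamma> * r * a t * (1 - a t) * x))) *\<^sub>R nuclear_norm (m t))) (at t)"
      using elim(3) by (intro has_vector_derivative_scaleR ad'') auto
    then have q_eq: "wq t = (1 - a t) *\<^sub>R wn t + (- (T * - (\<gamma> * r * a t * (1 - a t) * x))) *\<^sub>R nuclear_norm (m t)"
      using elim(4) has_vector_derivative_unique by blast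
    have "((\<lambda>t. (1 - a t) *\<^sub>R fst (y t) + a t *\<^sub>R fst (snd (y t))) has_vector_derivative
        ((1 - a t) *\<^sub>R (T *\<^sub>R (- P)) + (- (T * - (\<gamma> * r * a t * (1 - a t) * x))) *\<^sub>R fst (y t))
        + (a t *\<^sub>R (T *\<^sub>R (- (r *\<^sub>R v t))) + (T * - (\<gamma> * r * a t * (1 - a t) * x)) *\<^sub>R fst (snd (y t)))) (at t)"
      by (intro has_vector_derivative_add has_vector_derivative_scaleR ad' ad'' ud sd)
    moreover have "(\<lambda>t. (1 - a t) *\<^sub>R fst (y t) + a t *\<^sub>R fst (snd (y t))) = (\<lambda>t. position (y t))"
      by (simp add: position_def a_def)
    ultimately have "((\<lambda>t. position (y t)) has_vector_derivative
        ((1 - a t) *\<^sub>R (T *\<^sub>R (- P)) + (- (T * - (\<gamma> * r * a t * (1 - a t) * x))) *\<^sub>R u)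
        + (a t *\<^sub>R (T *\<^sub>R (- (r *\<^sub>R v t))) + (T * - (\<gamma> * r * a t * (1 - a t) * x)) *\<^sub>R s)) (at t)"
      by (simp only: u s)
    then have p_eq: "wp t = ((1 - a t) *\<^sub>R (T *\<^sub>R (- P)) + (- (T * - (\<gamma> * r * a t * (1 - a t) * x))) *\<^sub>R u)
        + (a t *\<^sub>R (T *\<^sub>R (- (r *\<^sub>R v t))) + (T * - (\<gamma> * r * a t * (1 - a t) * x)) *\<^sub>R s)"
      using elim(2) has_vector_derivative_unique by blast
    also have "\<dots> = T *\<^sub>R (- ((1 - a t) *\<^sub>R P) - (a t * r) *\<^sub>R v t - (\<gamma> * r * a t * (1 - a t) * x) *\<^sub>R e)"
      by (simp add: e_def scaleR_diff_right scaleR_add_right mult_ac)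
    finally have p_eq: "wp t = T *\<^sub>R (- ((1 - a t) *\<^sub>R P) - (a t * r) *\<^sub>R v t - (\<gamma> * r * a t * (1 - a t) * x) *\<^sub>R e)" .
    have ip: "inner (wp t) (v t) = T * (- ((1 - a t) * inner P (v t)) - a t * r * (norm (v t))\<^sup>2 - \<gamma> * r * a t * (1 - a t) * x\<^sup>2)"
      unfolding p_eq by (simp add: inner_diff_left dot_square_norm power2_eq_square inner_commute[of e] x_def)
    have iq: "1 / \<tau> * wq t = T * ((1 - a t) * (inner P (v t) - nuclear_norm (m t))
        + (\<gamma> * r * x / \<tau>) * (a t * (1 - a t) * nuclear_norm (m t)))"
      unfolding q_eq n using tau_pos by (simp add: inner_diff_right Pm field_simps)
    \<comment> \<open>The derivative of \<alpha> adds at most this ratio to \<tau> times a (1 - a)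
      |m|_*; the coupling assumption caps the ratio at 1.\<close>
    have "\<gamma> * r * x \<le> \<tau>"
    proof -
      have "norm (v t) \<le> LK" using elim(1) position_in[OF yX] D_bound by blast
      then have "norm (v t) * norm e \<le> LK * R" using gap LK_nonneg unfolding e_def by (intro mult_mono) auto
      then have "x \<le> LK * R" unfolding x_def using Cauchy_Schwarz_ineq2[of "v t" e] by linarith
      then have "\<gamma> * r * x \<le> \<gamma> * r * (LK * R)" using gamma_pos r_nonneg by (intro mult_left_mono) auto
      then show ?thesis using coupling by (simp add: mult.assoc)
    qed
    then have "\<gamma> * r * x / \<tau> \<le> 1" using tau_pos by simp
    then have "(\<gamma> * r * x / \<tau>) * (a t * (1 - a t) * nuclear_norm (m t)) \<le> 1 * (a t * (1 - a t) * nuclear_norm (m t))"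
      using at nuclear_norm_nonneg[of "m t"] by (intro mult_right_mono) auto
    moreover have "0 \<le> \<gamma> * r * a t * (1 - a t) * x\<^sup>2"
      using at gamma_pos r_nonneg by (intro mult_nonneg_nonneg) auto
    \<comment> \<open>The pairings of \<open>P\<close> with \<open>v\<close> cancel, and (1 - a) - a
      (1 - a) = (1 - a)^2.\<close>
    ultimately have "(- ((1 - a t) * inner P (v t)) - a t * r * (norm (v t))\<^sup>2 - \<gamma> * r * a t * (1 - a t) * x\<^sup>2)
        + ((1 - a t) * (inner P (v t) - nuclear_norm (m t)) + (\<gamma> * r * x / \<tau>) * (a t * (1 - a t) * nuclear_norm (m t)))
        \<le> - q t"
      unfolding q_def power2_eq_square[of "1 - a t"] by (simp add: algebra_simps)
    then have "T * ((- ((1 - a t) * inner P (v t)) - a t * r * (norm (v t))\<^sup>2 - \<gamma> * r * a t * (1 - a t) * x\<^sup>2)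
        + ((1 - a t) * (inner P (v t) - nuclear_norm (m t)) + (\<gamma> * r * x / \<tau>) * (a t * (1 - a t) * nuclear_norm (m t))))
        \<le> T * (- q t)"
      using T by (intro mult_left_mono) auto
    then show ?case unfolding ip iq using at by (simp add: distrib_left)
  qed
  have q0: "AE t in lebesgue_on {0..1}. 0 \<le> T * q t"
    using le
  proof eventually_elim
    case (elim t)
    then show ?case unfolding q_def using T r_nonneg nuclear_norm_nonneg[of "m t"]
      by (intro mult_nonneg_nonneg add_nonneg_nonneg) auto
  qed
  have "AE t in lebesgue_on {0..1}. inner (wp t) (v t) + 1 / \<tau> * wq t \<le> 0"
    using le q0 by eventually_elim linarith
  note nonpos = has_bochner_integral_nonpos[OF int this]
  have "energy (y 1) \<le> energy (y 0)" using nonpos(1) by simp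
  moreover have "AE t in lebesgue_on {0..1}. (1 - a t)\<^sup>2 * nuclear_norm (m t) = 0 \<and> a t * r * (norm (v t))\<^sup>2 = 0"
    if "energy (y 1) = energy (y 0)"
  proof -
    have "AE t in lebesgue_on {0..1}. inner (wp t) (v t) + 1 / \<tau> * wq t = 0" using nonpos(2) that by simp
    with le show ?thesis
    proof eventually_elim
      case (elim t)
      then have "T * q t \<le> 0" by linarith
      then have "q t \<le> 0" using T by (simp add: mult_le_0_iff)
      moreover have "0 \<le> (1 - a t)\<^sup>2 * nuclear_norm (m t)" using nuclear_norm_nonneg[of "m t"] by simp
      moreover have "0 \<le> a t * r * (norm (v t))\<^sup>2" using elim r_nonneg by simp
      ultimately show ?case unfolding q_def by linarith
    qed
  qed
  ultimately show ?thesis using that[OF v ae] unfolding a_def m_def by blast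
qed

text \<open>Constant energy makes both dissipation terms vanish, and either of them yields v = 0:
  where a = 1 through the gradient term, elsewhere because m is locally zero and so is its
  derivative. Criticality follows from v = 0. At a = 1 the momentum may be nonzero, but with v = 0
  it obeys m' = - T \<tau> m and decays exponentially.\<close>

lemma trajectory2_stationary:
  assumes y: "trajectory field2 X T y" and X: "X \<subseteq> states2" and T: "0 < T"
    and eq: "energy (y 1) = energy (y 0)"
  shows "0 \<in> D (position (y 0))" and "energy (y 0) = f (position (y 0))"
    and "(norm (fst (snd (snd (y 1)))))\<^sup>2 \<le> exp (- (2 * T * \<tau>)) * (norm (fst (snd (snd (y 0)))))\<^sup>2"
proof -
  obtain v where v: "v \<in> borel_measurable (lebesgue_on {0..1})"
    and ae: "AE t in lebesgue_on {0..1}. selection2 T y v t"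
    and "energy (y 1) \<le> energy (y 0)"
    and zero: "energy (y 1) = energy (y 0) \<longrightarrow> (AE t in lebesgue_on {0..1}.
      (1 - snd (snd (snd (y t))))\<^sup>2 * nuclear_norm (fst (snd (snd (y t)))) = 0 \<and>
      snd (snd (snd (y t))) * r * (norm (v t))\<^sup>2 = 0)"
    by (rule trajectory2_descent[OF y X T])
  define a where "a t = snd (snd (snd (y t)))" for t
  define m where "m t = fst (snd (snd (y t)))" for t
  have m_fun: "m = (\<lambda>t. fst (snd (snd (y t))))" by (simp add: fun_eq_iff m_def)
  have ae0: "AE t in lebesgue_on {0..1}. (1 - a t)\<^sup>2 * nuclear_norm (m t) = 0 \<and> a t * r * (norm (v t))\<^sup>2 = 0"
    using zero eq by (simp add: a_def m_def)
  obtain L where L: "L-lipschitz_on {0..1} y" using y by (auto simp: trajectory_def)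
  have y_cont: "continuous_on {0..1} y" by (rule lipschitz_on_continuous_on[OF L])
  have Lm: "L-lipschitz_on {0..1} m" unfolding m_fun by (intro lipschitz_fst lipschitz_snd L)
  have m_cont: "continuous_on {0..1} m" by (rule lipschitz_on_continuous_on[OF Lm])
  have a_cont: "continuous_on {0..1} a" unfolding a_def by (intro continuous_intros y_cont)
  have n_cont: "continuous_on {0..1} (\<lambda>t. nuclear_norm (m t))"
    by (rule continuous_on_compose2[OF continuous_on_nuclear_norm[of UNIV] m_cont]) simp
  have y_states: "y t \<in> states2" if "t \<in> {0..1}" for t using y X that by (fastforce simp: trajectory_def)
  \<comment> \<open>Continuity upgrades the identity to all times; differentiating m = 0 requires it
    on an open set.\<close>
  have prod_zero: "(1 - a t)\<^sup>2 * nuclear_norm (m t) = 0" if "t \<in> {0..1}" for t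
  proof (rule continuous_zero_if_AE[OF _ _ that])
    show "continuous_on {0..1} (\<lambda>t. (1 - a t)\<^sup>2 * nuclear_norm (m t))"
      by (intro continuous_intros a_cont n_cont)
    show "AE t in lebesgue_on {0..1}. (1 - a t)\<^sup>2 * nuclear_norm (m t) = 0"
      using ae0 by eventually_elim blast
  qed
  have m_zero: "m t = 0" if t: "t \<in> {0..1}" and a: "a t \<noteq> 1" for t
  proof -
    have "nuclear_norm (m t) = 0" using prod_zero[OF t] a by simp
    then show ?thesis using norm_le_nuclear_norm[of "m t"] by simp
  qed
  have dm: "((m has_vector_derivative T *\<^sub>R (\<tau> *\<^sub>R (v t - m t))) (at t))"
    if "(y has_vector_derivative T *\<^sub>R velocity2 (y t) (P, v t)) (at t)" for t P
  proof -
    have vel: "fst (snd (snd (velocity2 (y t) (P, v t)))) = \<tau> *\<^sub>R (v t - m t)"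
      by (simp add: velocity2_def case_prod_beta m_def)
    have "((\<lambda>t. fst (snd (snd (y t)))) has_vector_derivative T *\<^sub>R (\<tau> *\<^sub>R (v t - m t))) (at t)"
      using bounded_linear.has_vector_derivative[OF bounded_linear_fst
          bounded_linear.has_vector_derivative[OF bounded_linear_snd
          bounded_linear.has_vector_derivative[OF bounded_linear_snd that]]] by (simp add: vel)
    then show ?thesis by (simp only: m_fun[symmetric])
  qed
  have v_zero: "AE t in lebesgue_on {0..1}. v t = 0"
    using ae ae0
  proof eventually_elim
    case (elim t)
    then have t: "t \<in> {0..1}" "t \<in> {0<..<1}" by auto
    obtain P where "(y has_vector_derivative T *\<^sub>R velocity2 (y t) (P, v t)) (at t)" using elim(1) by blast
    note md = dm[OF this]
    show ?case
    proof (cases "a t = 1")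
      case True
      \<comment> \<open>Reaching a = 1 excludes r = 0, the case in which \<open>alpha_max\<close> is
        below 1.\<close>
      have "alpha_max \<ge> 1" using y_states[OF t(1)] True by (auto simp: states2_def a_def)
      then have "r \<noteq> 0" using alpha_max(3) by force
      then show ?thesis using elim(2) True by simp
    next
      case False
      define A where "A = {0<..<1} \<inter> a -` (- {1})"
      have A: "open A" unfolding A_def
        using a_cont by (intro continuous_open_preimage) (auto intro: continuous_on_subset)
      have tA: "t \<in> A" using t False by (simp add: A_def)
      have "m s = 0" if "s \<in> A" for s
        using that by (intro m_zero) (auto simp: A_def)
      then have "((\<lambda>_. 0) has_vector_derivative T *\<^sub>R (\<tau> *\<^sub>R (v t - m t))) (at t)"
        by (rule has_vector_derivative_transform_within_open[OF md A tA])
      then have "T *\<^sub>R (\<tau> *\<^sub>R (v t - m t)) = 0"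
        using has_vector_derivative_unique has_vector_derivative_const by blast
      then show ?thesis using T tau_pos m_zero[OF t(1) False] by simp
    qed
  qed
  have "AE t in lebesgue_on {0..1}. t < 1 \<longrightarrow> 0 \<in> D (position (y t))"
    using ae v_zero by eventually_elim auto
  moreover have "continuous_on {0..1} (\<lambda>t. position (y t))"
    by (rule continuous_on_compose2[OF continuous_on_position[of UNIV] y_cont]) simp
  ultimately show "0 \<in> D (position (y 0))"
    using critical_if_AE[of "\<lambda>t. position (y t)" 1] by simp
  have "(1 - a 0) * nuclear_norm (m 0) = 0" using prod_zero[of 0] by simp
  then show "energy (y 0) = f (position (y 0))" by (simp add: energy_def a_def m_def)
  \<comment> \<open>The squared norm is used because it is differentiable also where m = 0.\<close>
  have "(norm (m 1))\<^sup>2 \<le> exp (- (2 * T * \<tau>)) * (norm (m 0))\<^sup>2"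
  proof -
    obtain B where B: "\<And>t. t \<in> {0..1} \<Longrightarrow> norm (m t) \<le> B"
    proof -
      have "bounded (m ` {0..1})" by (intro compact_imp_bounded compact_continuous_image m_cont compact_Icc)
      then show ?thesis using that unfolding bounded_iff by blast
    qed
    have B0: "0 \<le> B" using B[of 0] norm_ge_zero[of "m 0"] by (simp add: order_trans[rotated] del: norm_ge_zero)
    have L0: "0 \<le> L" using L lipschitz_on_nonneg by blast
    have "(2 * B * L)-lipschitz_on {0..1} (\<lambda>t. inner (m t) (m t))"
    proof (rule lipschitz_onI)
      fix s t :: real assume st: "s \<in> {0..1}" "t \<in> {0..1}"
      have "inner (m s) (m s) - inner (m t) (m t) = inner (m s + m t) (m s - m t)"
        by (simp add: inner_add_left inner_diff_right inner_commute[of "m t" "m s"])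
      then have "\<bar>inner (m s) (m s) - inner (m t) (m t)\<bar> \<le> norm (m s + m t) * norm (m s - m t)"
        using Cauchy_Schwarz_ineq2 by metis
      also have "\<dots> \<le> (2 * B) * (L * dist s t)"
        using norm_triangle_le[of "m s" "m t" "2 * B"] B[OF st(1)] B[OF st(2)] lipschitz_onD[OF Lm st] B0
        by (intro mult_mono) (auto simp: dist_norm)
      finally show "dist (inner (m s) (m s)) (inner (m t) (m t)) \<le> 2 * B * L * dist s t"
        by (simp add: dist_real_def mult_ac)
    qed (use B0 L0 in simp)
    then have "inner (m 1) (m 1) \<le> exp (- (2 * T * \<tau>)) * inner (m 0) (m 0)"
    proof (rule lipschitz_gronwall)
      show "AE t in lebesgue_on {0..1}. \<forall>E. ((\<lambda>t. inner (m t) (m t)) has_vector_derivative E) (at t) \<longrightarrow>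
          E \<le> - (2 * T * \<tau>) * inner (m t) (m t)"
        using ae v_zero
      proof (eventually_elim, intro allI impI)
        fix t E assume h: "selection2 T y v t"
          and v: "v t = 0" and E: "((\<lambda>t. inner (m t) (m t)) has_vector_derivative E) (at t)"
        obtain P where "(y has_vector_derivative T *\<^sub>R velocity2 (y t) (P, v t)) (at t)" using h by blast
        note md = dm[OF this]
        have "E = inner (m t) (T *\<^sub>R (\<tau> *\<^sub>R (v t - m t))) + inner (T *\<^sub>R (\<tau> *\<^sub>R (v t - m t))) (m t)"
          by (rule has_vector_derivative_unique[OF E bounded_bilinear.has_vector_derivative[OF bounded_bilinear_inner md md]])
        also have "\<dots> = - (2 * T * \<tau>) * inner (m t) (m t)" by (simp add: v)
        finally show "E \<le> - (2 * T * \<tau>) * inner (m t) (m t)" by simp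
      qed
    qed
    then show ?thesis by (simp add: power2_norm_eq_inner)
  qed
  then show "(norm (fst (snd (snd (y 1)))))\<^sup>2 \<le> exp (- (2 * T * \<tau>)) * (norm (fst (snd (snd (y 0)))))\<^sup>2"
    by (simp only: m_fun)
qed

section \<open>The run as a perturbed Euler scheme in regime (ii)\<close>

lemma momentum_bound: "norm (M t) \<le> LK"
proof (induction t)
  case 0
  then show ?case using LK_nonneg by (simp add: M_0)
next
  case (Suc t)
  have "norm (M (Suc t)) \<le> \<beta>M t * norm (M t) + (1 - \<beta>M t) * norm (G t)"
    unfolding M_Suc using norm_triangle_ineq[of "\<beta>M t *\<^sub>R M t" "(1 - \<beta>M t) *\<^sub>R G t"] beta_nonneg[of t] beta_le[of t]
    by simp
  also have "\<dots> \<le> \<beta>M t * LK + (1 - \<beta>M t) * LK"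
    using Suc G_bound[of t] beta_nonneg[of t] beta_le[of t] by (intro add_mono mult_left_mono) auto
  finally show ?case by (simp add: algebra_simps)
qed

lemma regime_ii_conclusion:
  shows "convergent (\<lambda>t. f (W t))"
    and "strict_mono s \<Longrightarrow> (W \<circ> s) \<longlonglongrightarrow> X \<Longrightarrow> 0 \<in> D X"
    and "M \<longlonglongrightarrow> 0"
proof -
  obtain P where U_Suc: "\<And>t. U (Suc t) = U t - \<eta>M t *\<^sub>R P t"
    and P_ball: "\<And>t. P t /\<^sub>R (1 + \<delta>M t) \<in> spectral_ball"
    and P_pair: "\<And>t. (1 - \<delta>M t) * (nuclear_norm (M (Suc t)) - real CARD('m) * \<delta>M t * (norm (M (Suc t)) + \<sigma>M t))
      \<le> inner (P t) (M (Suc t))"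
    and P_bound: "\<And>t. norm (P t) \<le> 2 * (real CARD('m) * real CARD('n))"
    by (rule polar_directions) blast
  \<comment> \<open>With \<open>\<eta>M\<close> as time step, the gradient step becomes
    \<open>\<kappa> t\<close> times \<open>G t\<close>, whose factor tends to r.\<close>
  define \<kappa> where "\<kappa> t = \<eta> t / \<eta>M t" for t
  have \<kappa>: "\<kappa> \<longlonglongrightarrow> r" using ratio_lim by (simp add: \<kappa>_def[abs_def])
  have \<kappa>0: "0 \<le> \<kappa> t" for t using eta_nonneg etaM_nonneg by (simp add: \<kappa>_def)
  have eta_eq: "\<eta> t = \<eta>M t * \<kappa> t" for t using etaM_pos[of t] by (simp add: \<kappa>_def)
  obtain B where B: "\<And>t. \<bar>\<kappa> t\<bar> \<le> B"
    using convergent_imp_bounded[OF \<kappa>] by (auto simp: bounded_iff)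
  have B0: "0 \<le> B" using B[of 0] by linarith
  define w where "w t = - (\<gamma> * \<kappa> t * inner (G t) (S t - U t))" for t
  have w: "\<bar>w t\<bar> \<le> \<gamma> * B * (LK * R)" for t
    unfolding w_def abs_minus_cancel abs_mult using gamma_pos B[of t] B0 pairing_bound[of t]
    by (intro mult_mono) auto
  have "- (\<gamma> * \<eta> t * inner (G t) (S t - U t)) = \<eta>M t * w t" for t by (simp add: w_def eta_eq)
  note inc = alpha_increment(1)[OF etaM_pos etaM_lim this w]
  define x where "x t = (U t, S t, M t, \<alpha> t)" for t
  define d where "d t = (- P t, - (\<kappa> t *\<^sub>R G t), \<tau> *\<^sub>R (G t - M t), (\<alpha> (Suc t) - \<alpha> t) / \<eta>M t)" for t
  have M_step: "M (Suc t) = M t + \<eta>M t *\<^sub>R (\<tau> *\<^sub>R (G t - M t))" for t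
    by (simp add: M_Suc beta_eq algebra_simps)
  interpret asymptotic_inclusion x d \<eta>M field2 states2
  proof
    show "x (Suc n) = x n + \<eta>M n *\<^sub>R d n" for n
      using etaM_pos[of n] by (simp add: x_def d_def S_Suc U_Suc M_step eta_eq)
    show "compact states2" by (rule states2_compact)
    show "x n \<in> states2" for n
      using U_in S_in alpha_pos[of n] alpha_max(2)[of n] gap_bound[of n] momentum_bound[of n]
      by (auto simp: x_def states2_def)
    show "closed (field2 p)" "convex (field2 p)" for p
      using field2_compact field2_convex compact_imp_closed by blast+
    show "bounded (range d)"
    proof -
      define e where "e t = (- P t, - (\<kappa> t *\<^sub>R G t), \<tau> *\<^sub>R (G t - M t), \<alpha> t * (1 - \<alpha> t) * w t)" for t
      have "d t - e t = (0, 0, 0, (\<alpha> (Suc t) - \<alpha> t) / \<eta>M t - \<alpha> t * (1 - \<alpha> t) * w t)" for t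
        by (simp add: d_def e_def)
      then have "(\<lambda>t. d t - e t) \<longlonglongrightarrow> (0, 0, 0, 0)" by (simp only:) (intro tendsto_Pair tendsto_const inc)
      then have close: "(\<lambda>t. d t - e t) \<longlonglongrightarrow> 0" by (simp add: zero_prod_def)
      show ?thesis
      proof (rule bounded_range_if_asymptotic[OF close])
        have "norm (e t) \<le> 2 * (real CARD('m) * real CARD('n)) + (B * LK + (\<tau> * (LK + LK) + \<gamma> * B * (LK * R)))" for t
        proof -
          have "norm (\<kappa> t *\<^sub>R G t) \<le> B * LK"
            unfolding norm_scaleR using B[of t] B0 G_bound[of t] by (intro mult_mono) auto
          moreover have "norm (\<tau> *\<^sub>R (G t - M t)) \<le> \<tau> * (LK + LK)"
            using tau_pos norm_triangle_ineq4[of "G t" "M t"] G_bound[of t] momentum_bound[of t]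
            by (simp add: order_trans[OF _ add_mono])
          moreover have "norm (\<alpha> t * (1 - \<alpha> t) * w t) \<le> 1 * 1 * (\<gamma> * B * (LK * R))"
            unfolding real_norm_def abs_mult[of _ "w t"] abs_mult[of "\<alpha> t"]
            using alpha_pos[of t] alpha_less[of t] w[of t] by (intro mult_mono) auto
          moreover have "norm (e t) \<le> norm (- P t) + (norm (- (\<kappa> t *\<^sub>R G t)) + (norm (\<tau> *\<^sub>R (G t - M t)) + norm (\<alpha> t * (1 - \<alpha> t) * w t)))"
            unfolding e_def by (meson add_left_mono norm_Pair_le order_trans)
          ultimately show ?thesis using P_bound[of t] by simp
        qed
        then show "bounded (range e)" by (auto simp: bounded_iff)
      qed
    qed
    fix mm p v assume mm: "filterlim mm at_top sequentially" and x: "(\<lambda>k. x (mm k)) \<longlonglongrightarrow> p" and d: "(\<lambda>k. d (mm k)) \<longlonglongrightarrow> v"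
    obtain u s m a where p: "p = (u, s, m, a)" by (cases p)
    have "bounded (range (\<lambda>k. G (mm k)))" using G_bound by (auto simp: bounded_iff)
    then obtain g q where q: "strict_mono (q :: nat \<Rightarrow> nat)" "((\<lambda>k. G (mm k)) \<circ> q) \<longlonglongrightarrow> g"
      using bounded_imp_convergent_subsequence by blast
    define l where "l k = mm (q k)" for k
    have l: "filterlim l at_top sequentially"
      unfolding l_def by (rule filterlim_compose[OF mm filterlim_subseq[OF q(1)]])
    have xl: "(\<lambda>k. x (l k)) \<longlonglongrightarrow> p" using LIMSEQ_subseq_LIMSEQ[OF x q(1)] by (simp add: o_def l_def)
    have dl: "(\<lambda>k. d (l k)) \<longlonglongrightarrow> v" using LIMSEQ_subseq_LIMSEQ[OF d q(1)] by (simp add: o_def l_def)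
    have U: "(\<lambda>k. U (l k)) \<longlonglongrightarrow> u" and S: "(\<lambda>k. S (l k)) \<longlonglongrightarrow> s" and M: "(\<lambda>k. M (l k)) \<longlonglongrightarrow> m"
      and a: "(\<lambda>k. \<alpha> (l k)) \<longlonglongrightarrow> a"
      using tendsto_fst[OF xl] tendsto_fst[OF tendsto_snd[OF xl]] tendsto_fst[OF tendsto_snd[OF tendsto_snd[OF xl]]]
        tendsto_snd[OF tendsto_snd[OF tendsto_snd[OF xl]]]
      by (simp_all add: x_def p)
    have G: "(\<lambda>k. G (l k)) \<longlonglongrightarrow> g" using q(2) by (simp add: o_def l_def)
    have W: "(\<lambda>k. W (l k)) \<longlonglongrightarrow> position p"
      unfolding W_eq position_def p by (simp, intro tendsto_intros U S a)
    have g: "g \<in> D (position p)" by (rule D_closed_graph[OF W G G_in])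
    note along = filterlim_compose[OF _ l]
    define Q where "Q = - fst v"
    have Q: "(\<lambda>k. P (l k)) \<longlonglongrightarrow> Q"
      using tendsto_minus[OF tendsto_fst[OF dl]] by (simp add: d_def Q_def)
    \<comment> \<open>The polar factor is taken at the updated momentum, whose limit is the same
      because the update is \<open>\<eta>M\<close> times a bounded vector.\<close>
    have M': "(\<lambda>k. M (Suc (l k))) \<longlonglongrightarrow> m"
    proof -
      have "(\<lambda>k. M (l k) + \<eta>M (l k) *\<^sub>R (\<tau> *\<^sub>R (G (l k) - M (l k)))) \<longlonglongrightarrow> m + 0 *\<^sub>R (\<tau> *\<^sub>R (g - m))"
        by (intro tendsto_intros M G along[OF etaM_lim])
      then show ?thesis by (simp add: M_step)
    qed
    \<comment> \<open>Rescaled directions lie in the closed ball. In the pairing inequality the loss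
      contains \<delta> |M| and \<delta> \<sigma>, which both vanish, so the limit direction attains
      the nuclear norm.\<close>
    have "Q \<in> nuclear_subgradients m"
    proof -
      have "(\<lambda>k. P (l k) /\<^sub>R (1 + \<delta>M (l k))) \<longlonglongrightarrow> Q /\<^sub>R (1 + 0)"
        by (intro tendsto_intros Q along[OF delta_lim]) simp
      from Lim_in_closed_set[OF closed_spectral_ball always_eventually[OF allI[OF P_ball]] sequentially_bot this]
      have ball: "Q \<in> spectral_ball" by simp
      have n: "(\<lambda>k. nuclear_norm (M (Suc (l k)))) \<longlonglongrightarrow> nuclear_norm m"
        using continuous_on_tendsto_compose[OF continuous_on_nuclear_norm[of UNIV] M'] by simp
      have "(\<lambda>k. (1 - \<delta>M (l k)) * (nuclear_norm (M (Suc (l k))) -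
            real CARD('m) * (\<delta>M (l k) * norm (M (Suc (l k))) + \<delta>M (l k) * \<sigma>M (l k))))
          \<longlonglongrightarrow> (1 - 0) * (nuclear_norm m - real CARD('m) * (0 * norm m + 0))"
        by (intro tendsto_intros n M' along[OF delta_lim] along[OF delta_sigma_lim])
      moreover have "(\<lambda>k. inner (P (l k)) (M (Suc (l k)))) \<longlonglongrightarrow> inner Q m" by (intro tendsto_intros Q M')
      moreover have "(1 - \<delta>M t) * (nuclear_norm (M (Suc t)) - real CARD('m) * (\<delta>M t * norm (M (Suc t)) + \<delta>M t * \<sigma>M t))
          \<le> inner (P t) (M (Suc t))" for t
        using P_pair[of t] by (simp add: distrib_left mult.assoc)
      ultimately have "(1 - 0) * (nuclear_norm m - real CARD('m) * (0 * norm m + 0)) \<le> inner Q m"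
        by (intro LIMSEQ_le) auto
      then show ?thesis using ball nuclear_norm_upper[OF ball, of m] by (simp add: nuclear_subgradients_def)
    qed
    moreover have "v = velocity2 p (Q, g)"
    proof -
      have "(\<lambda>k. (\<alpha> (Suc (l k)) - \<alpha> (l k)) / \<eta>M (l k)) \<longlonglongrightarrow> a * (1 - a) * - (\<gamma> * r * inner g (s - u))"
      proof -
        have "(\<lambda>k. \<alpha> (l k) * (1 - \<alpha> (l k)) * w (l k)) \<longlonglongrightarrow> a * (1 - a) * - (\<gamma> * r * inner g (s - u))"
          unfolding w_def by (intro tendsto_intros a G S U along[OF \<kappa>])
        from tendsto_add[OF along[OF inc] this] show ?thesis by simp
      qed
      then have "(\<lambda>k. d (l k)) \<longlonglongrightarrow> (- Q, - (r *\<^sub>R g), \<tau> *\<^sub>R (g - m), a * (1 - a) * - (\<gamma> * r * inner g (s - u)))"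
        unfolding d_def by (intro tendsto_intros Q G M along[OF \<kappa>])
      with dl have "v = (- Q, - (r *\<^sub>R g), \<tau> *\<^sub>R (g - m), a * (1 - a) * - (\<gamma> * r * inner g (s - u)))"
        using LIMSEQ_unique by blast
      then show ?thesis by (simp add: p velocity2_def mult_ac)
    qed
    ultimately show "v \<in> field2 p" using g by (auto simp: field2_def p)
  qed (use etaM_pos etaM_lim etaM_sum in auto)
  have E: "continuous_on states2 energy" by (rule continuous_on_energy)
  have "\<exists>c\<in>f ` {X. 0 \<in> D X}. (\<lambda>n. energy (x n)) \<longlonglongrightarrow> c"
  proof (rule lyapunov_convergence[OF E sard])
    show mono: "energy (y 1) \<le> energy (y 0)" if "0 < T" "trajectory field2 limit_set T y" for T y
      by (rule trajectory2_descent[OF that(2) limit_set_subset that(1)])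
    fix p assume "energy p \<notin> f ` {X. 0 \<in> D X}"
    \<comment> \<open>Without descent the start is stationary, so its energy equals \<open>f\<close>
      at a critical point and is a critical value. Here every duration works, and 1 is
      taken.\<close>
    then have "energy (y 1) < energy (y 0)" if "trajectory field2 limit_set 1 y" "y 0 = p" for y
      using trajectory2_stationary(1,2)[OF that(1) limit_set_subset] mono[OF _ that(1)] that(2)
      by (smt (verit) imageI mem_Collect_eq)
    then show "\<exists>T>0. \<forall>y. trajectory field2 limit_set T y \<longrightarrow> y 0 = p \<longrightarrow> energy (y 1) < energy (y 0)"
      by (intro exI[of _ 1]) auto
  qed
  then obtain c where lim: "(\<lambda>n. energy (x n)) \<longlonglongrightarrow> c" by blast
  have level: "energy (y 1) = energy (y 0)" if "trajectory field2 limit_set T y" for T y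
  proof -
    have "y 0 \<in> limit_set" "y 1 \<in> limit_set" using that by (auto simp: trajectory_def)
    then show ?thesis using limit_set_level[OF E lim] by simp
  qed
  \<comment> \<open>A second use of the convergence principle, with the norm of the momentum as
    Lyapunov function and 0 as its only exceptional value. Its decay along limit curves is available
    because the energy is now known to be constant there.\<close>
  have "\<exists>c\<in>{0}. (\<lambda>n. norm (fst (snd (snd (x n))))) \<longlonglongrightarrow> c"
  proof (rule lyapunov_convergence)
    show "continuous_on states2 (\<lambda>p. norm (fst (snd (snd p))))" by (intro continuous_intros)
    show "interior {0::real} = {}" by simp
    have decay: "(norm (fst (snd (snd (y 1)))))\<^sup>2 \<le> exp (- (2 * T * \<tau>)) * (norm (fst (snd (snd (y 0)))))\<^sup>2"
      if "0 < T" "trajectory field2 limit_set T y" for T y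
      by (rule trajectory2_stationary(3)[OF that(2) limit_set_subset that(1) level[OF that(2)]])
    have contr: "exp (- (2 * T * \<tau>)) < 1" if "0 < T" for T using that tau_pos by simp
    show "norm (fst (snd (snd (y 1)))) \<le> norm (fst (snd (snd (y 0))))"
      if "0 < T" "trajectory field2 limit_set T y" for T y
    proof (rule power2_le_imp_le)
      have "exp (- (2 * T * \<tau>)) * (norm (fst (snd (snd (y 0)))))\<^sup>2 \<le> 1 * (norm (fst (snd (snd (y 0)))))\<^sup>2"
        using contr[OF that(1)] by (intro mult_right_mono) auto
      then show "(norm (fst (snd (snd (y 1)))))\<^sup>2 \<le> (norm (fst (snd (snd (y 0)))))\<^sup>2"
        using decay[OF that] by linarith
    qed simp
    fix p :: "(real^'n^'m) \<times> (real^'n^'m) \<times> (real^'n^'m) \<times> real"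
    assume p: "norm (fst (snd (snd p))) \<notin> {0::real}"
    have "norm (fst (snd (snd (y 1)))) < norm (fst (snd (snd (y 0))))"
      if y: "trajectory field2 limit_set 1 y" "y 0 = p" for y
    proof (rule power2_less_imp_less)
      have "exp (- (2 * 1 * \<tau>)) * (norm (fst (snd (snd (y 0)))))\<^sup>2 < 1 * (norm (fst (snd (snd (y 0)))))\<^sup>2"
        using contr[of 1] p y(2) by (intro mult_strict_right_mono) auto
      then show "(norm (fst (snd (snd (y 1)))))\<^sup>2 < (norm (fst (snd (snd (y 0)))))\<^sup>2"
        using decay[OF zero_less_one y(1)] by linarith
    qed simp
    then show "\<exists>T>0. \<forall>y. trajectory field2 limit_set T y \<longrightarrow> y 0 = p \<longrightarrow>
        norm (fst (snd (snd (y 1)))) < norm (fst (snd (snd (y 0))))"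
      by (intro exI[of _ 1]) auto
  qed
  then have "(\<lambda>n. norm (M n)) \<longlonglongrightarrow> 0" by (simp add: x_def)
  then show M0: "M \<longlonglongrightarrow> 0" by (rule tendsto_norm_zero_cancel)
  have crit: "0 \<in> D (position p)" if p: "p \<in> limit_set" for p
  proof -
    obtain y where y: "trajectory field2 limit_set 1 y" "y 0 = p"
      by (rule limit_set_trajectory[OF p zero_less_one])
    then show ?thesis using trajectory2_stationary(1)[OF y(1) limit_set_subset _ level[OF y(1)]] by simp
  qed
  have W_pos: "position (x t) = W t" for t by (simp add: x_def position_def W_eq)
  have "(\<lambda>t. (1 - \<alpha> t) * nuclear_norm (M t) / \<tau>) \<longlonglongrightarrow> 0"
  proof (rule Lim_null_comparison)
    have "(\<lambda>t. nuclear_norm (M t)) \<longlonglongrightarrow> 0"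
      using continuous_on_tendsto_compose[OF continuous_on_nuclear_norm[of UNIV] M0] by simp
    from tendsto_divide[OF this tendsto_const[of \<tau>]] show "(\<lambda>t. nuclear_norm (M t) / \<tau>) \<longlonglongrightarrow> 0"
      using tau_pos by simp
    have "norm ((1 - \<alpha> t) * nuclear_norm (M t) / \<tau>) \<le> nuclear_norm (M t) / \<tau>" for t
      using alpha_pos[of t] alpha_less[of t] tau_pos nuclear_norm_nonneg[of "M t"]
      by (simp add: abs_mult mult_left_le_one_le divide_right_mono)
    then show "\<forall>\<^sub>F t in sequentially. norm ((1 - \<alpha> t) * nuclear_norm (M t) / \<tau>) \<le> nuclear_norm (M t) / \<tau>"
      by (intro always_eventually) blast
  qed
  from tendsto_diff[OF lim this] have "(\<lambda>t. f (W t)) \<longlonglongrightarrow> c"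
    unfolding energy_def W_pos by (simp add: x_def)
  then show "convergent (\<lambda>t. f (W t))" by (auto simp: convergent_def)
  assume s: "strict_mono s" "(W \<circ> s) \<longlonglongrightarrow> X"
  obtain p q where p: "strict_mono (p :: nat \<Rightarrow> nat)" "(\<lambda>k. x (s (p k))) \<longlonglongrightarrow> q" "q \<in> limit_set"
    by (rule cluster_point_extend[OF s(1)])
  have "(\<lambda>k. position (x (s (p k)))) \<longlonglongrightarrow> position q"
    using continuous_on_tendsto_compose[OF continuous_on_position[of UNIV] p(2)] by simp
  moreover have "(\<lambda>k. W (s (p k))) \<longlonglongrightarrow> X" using LIMSEQ_subseq_LIMSEQ[OF s(2) p(1)] by (simp add: o_def)
  ultimately have "position q = X" unfolding W_pos using LIMSEQ_unique by blast
  then show "0 \<in> D X" using crit[OF p(3)] by simp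
qed

end

theorem theorem3p4:
  fixes f :: "real^'n^'m \<Rightarrow> real"
    and D :: "real^'n^'m \<Rightarrow> (real^'n^'m) set"
    and W0 c :: "real^'n^'m"
    and K :: "(real^'n^'m) set"
    and W G S M U :: "nat \<Rightarrow> real^'n^'m"
    and \<eta> \<beta>M \<eta>M \<delta>M \<sigma>M z \<alpha> :: "nat \<Rightarrow> real"
    and \<gamma> \<rho> rad LK R :: real
  assumes "locally_lipschitz f"
    and "conservative_field f D"
    and "\<And>X. convex (D X)"
    and "interior (f ` {X. 0 \<in> D X}) = {}"
    and "magd_inputs \<eta> \<gamma> \<rho> \<beta>M \<eta>M \<delta>M \<sigma>M"
    and "magd_run D W0 \<eta> \<gamma> \<rho> \<beta>M \<eta>M \<delta>M \<sigma>M z \<alpha> W G S M U"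
    and "K = cball c rad"
    and "range U \<subseteq> K"
    and "range S \<subseteq> K"
    and "LK = Sup {norm Y | X Y. X \<in> K \<and> Y \<in> D X}"
    and "R = (SUP t. norm (S t - U t))"
    and "regime_i \<eta> \<eta>M \<alpha> \<or> regime_ii \<eta> \<gamma> \<beta>M \<eta>M \<delta>M \<sigma>M \<alpha> LK R"
  shows "(\<forall>X s. strict_mono (s :: nat \<Rightarrow> nat) \<and> (W \<circ> s) \<longlonglongrightarrow> X \<longrightarrow> 0 \<in> D X) \<and>
         convergent (\<lambda>t. f (W t)) \<and>
         (regime_ii \<eta> \<gamma> \<beta>M \<eta>M \<delta>M \<sigma>M \<alpha> LK R \<longrightarrow> M \<longlonglongrightarrow> 0)"
proof -
  interpret magd_bounded_run f D W0 c K W G S M U \<eta> \<beta>M \<eta>M \<delta>M \<sigma>M z \<alpha> \<gamma> \<rho> rad LK R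
    by unfold_locales (rule assms)+
  \<comment> \<open>Stated ahead of the case split because both regimes may hold at once, and then M
    must tend to 0 also in the first case.\<close>
  have ii: "convergent (\<lambda>t. f (W t)) \<and> (\<forall>X s. strict_mono s \<and> (W \<circ> s) \<longlonglongrightarrow> X \<longrightarrow> 0 \<in> D X) \<and> M \<longlonglongrightarrow> 0"
    if reg: "regime_ii \<eta> \<gamma> \<beta>M \<eta>M \<delta>M \<sigma>M \<alpha> LK R"
  proof -
    obtain \<tau> r where "magd_momentum_run f D W0 c K W G S M U \<eta> \<beta>M \<eta>M \<delta>M \<sigma>M z \<alpha> \<gamma> \<rho> rad LK R \<tau> r"
      using reg magd_bounded_run_axioms
      unfolding regime_ii_def magd_momentum_run_def magd_momentum_run_axioms_def by blast
    then interpret momentum: magd_momentum_run f D W0 c K W G S M U \<eta> \<beta>M \<eta>M \<delta>M \<sigma>M z \<alpha> \<gamma> \<rho> rad LK R \<tau> r .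
    show ?thesis using momentum.regime_ii_conclusion by blast
  qed
  from assms(12) show ?thesis
  proof
    assume "regime_i \<eta> \<eta>M \<alpha>"
    then show ?thesis using regime_i_conclusion ii by blast
  next
    assume "regime_ii \<eta> \<gamma> \<beta>M \<eta>M \<delta>M \<sigma>M \<alpha> LK R"
    then show ?thesis using ii by blast
  qed
qed

end
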